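(* Let $n>1$ be a positive integer. Let $i\in\{1,2\}$ and $k\in\{0,1,2\}$. If all simultaneously $\rho_{k,i}$-complete and connected subspaces of $\mathbb{S}^n$ are closed in $\mathbb{S}^n$, then $\mathbf{CC}(c\mathbb{R})$ holds.
   Context: The underlying axiom system is ZF (no form of the axiom of choice is assumed). A positive integer $n$ is identified with $\{0,\dots,n-1\}$. $\mathbf{CC}(c\mathbb{R})$ is the statement: every sequence of nonempty complete metric subspaces of $\mathbb{R}$ has a choice function. A subset $Y$ of a metric space $(X,d)$ is $d$-complete if each $d$-Cauchy sequence of points of $Y$ converges in $(X,d)$ to a point of $Y$. The set $\mathbb{S}$ (symmetrized max-plus algebra). Let $\varepsilon=-\infty$, $\mathbb{R}_\varepsilon=\mathbb{R}\cup\{\varepsilon\}$, $e^{-\infty}=\exp(-\infty)=0$. On $\mathbb{R}_\varepsilon\times\mathbb{R}_\varepsilon$ put $(a,b)\bigtriangledown(c,d)$ iff $\max(a,d)=\max(b,c)$, and put $(a,b)\sim(c,d)$ iff $(a,b)\bigtriangledown(c,d)$ in case $a\neq b$ and $c\neq d$, and iff $(a,b)=(c,d)$ otherwise. Then $\mathbb{S}=(\mathbb{R}_\varepsilon\times\mathbb{R}_\varepsilon)/_\sim$. For $r\in\mathbb{R}_\varepsilon$, the elements $\oplus r$, $\ominus r$, $r^\bullet$ of $\mathbb{S}$ are the classes of $(r,\varepsilon)$, $(\varepsilon,r)$, $(r,r)$. Every element of $\mathbb{S}$ has one of these forms, and the representation is unique except that $\oplus\varepsilon=\ominus\varepsilon=\varepsilon^\bullet$.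 If $a\in\{\oplus r,\ominus r,r^\bullet\}$, put $|a|=r$ and let $\operatorname{sgn}(a)$ be the corresponding sign $\oplus$, $\ominus$ or $\bullet$ (ambiguous only for $a=\varepsilon^\bullet$, which does not affect the formulas below). The canonical embedding $\Phi:\mathbb{S}\to\mathbb{C}$ is $\Phi(\oplus r)=\theta e^r$, $\Phi(\ominus r)=\theta^2e^r$, $\Phi(r^\bullet)=e^r$, where $\theta=\frac{-1+\sqrt3 i}{2}$ (here $i$ is the imaginary unit). The Euclidean distance in $\mathbb{S}$ is $d_1(a,b)=|\Phi(a)-\Phi(b)|$. The inner distance is $d_2(a,b)=\left|\exp|a|-\exp|b|\right|$ if $\operatorname{sgn}(a)=\operatorname{sgn}(b)$ and $d_2(a,b)=\exp|a|+\exp|b|$ if $\operatorname{sgn}(a)\neq\operatorname{sgn}(b)$. The topology of $\mathbb{S}$ is the smallest one making $\Phi$ continuous (both $d_1,d_2$ induce it), and $\mathbb{S}^n$ has the product topology. Metrics on $\mathbb{S}^n$, for $i\in\{1,2\}$: $\rho_{0,i}(x,y)=\max\{d_i(x(l),y(l)): l\in n\}$, $\rho_{1,i}(x,y)=\sqrt{\sum_{l\in n}d_i(x(l),y(l))^2}$, $\rho_{2,i}(x,y)=\sum_{l\in n}d_i(x(l),y(l))$. *)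

theory Defs
  imports Main
begin

section \<open>Models of ZF\<close>

text \<open>
  HOL has a choice operator, so a choice principle for the sets and the reals of HOL is simply a
  theorem, and an implication between such principles says nothing there.  The statements below
  are therefore interpreted in an arbitrary first-order model of ZF: the type \<^typ>\<open>'v\<close> is the
  universe of the model, and every quantifier in a notion of the model ranges over \<^typ>\<open>'v\<close>.
  By soundness and completeness of first-order logic, a first-order sentence holds in all these
  models iff ZF proves it.  (If ZF is consistent there is already a model on \<^typ>\<open>nat\<close>.)

  Separation and replacement are the first-order schemes.  They must not be strengthened to
  arbitrary predicates of HOL, since that would make the axiom of choice true in the model.
\<close>

datatype fm = Mem nat nat | Eq nat nat | Neg fm | Conj fm fm | Exists nat fm

primrec sat :: "('v \<Rightarrow> 'v \<Rightarrow> bool) \<Rightarrow> fm \<Rightarrow> (nat \<Rightarrow> 'v) \<Rightarrow> bool" where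
  "sat E (Mem i j) s \<longleftrightarrow> E (s i) (s j)"
| "sat E (Eq i j) s \<longleftrightarrow> s i = s j"
| "sat E (Neg p) s \<longleftrightarrow> \<not> sat E p s"
| "sat E (Conj p q) s \<longleftrightarrow> sat E p s \<and> sat E q s"
| "sat E (Exists i p) s \<longleftrightarrow> (\<exists>x. sat E p (s(i := x)))"

text \<open>In the two schemes the assignment \<open>s\<close> supplies the parameters.\<close>

class zf =
  fixes mem :: "'a \<Rightarrow> 'a \<Rightarrow> bool"  (infix "\<^bold>\<in>" 50)
  assumes extensionality: "(\<And>x. x \<^bold>\<in> a \<longleftrightarrow> x \<^bold>\<in> b) \<Longrightarrow> a = b"
    and foundation: "x \<^bold>\<in> a \<Longrightarrow> \<exists>y. y \<^bold>\<in> a \<and> \<not> (\<exists>z. z \<^bold>\<in> y \<and> z \<^bold>\<in> a)"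
    and pairing: "\<exists>c. \<forall>x. x \<^bold>\<in> c \<longleftrightarrow> x = a \<or> x = b"
    and union: "\<exists>c. \<forall>x. x \<^bold>\<in> c \<longleftrightarrow> (\<exists>y. x \<^bold>\<in> y \<and> y \<^bold>\<in> a)"
    and power_set: "\<exists>c. \<forall>x. x \<^bold>\<in> c \<longleftrightarrow> (\<forall>y. y \<^bold>\<in> x \<longrightarrow> y \<^bold>\<in> a)"
    and infinity: "\<exists>w. (\<exists>z. z \<^bold>\<in> w \<and> (\<forall>x. \<not> x \<^bold>\<in> z)) \<and>
      (\<forall>x. x \<^bold>\<in> w \<longrightarrow> (\<exists>y. y \<^bold>\<in> w \<and> (\<forall>u. u \<^bold>\<in> y \<longleftrightarrow> u \<^bold>\<in> x \<or> u = x)))"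
    and separation: "\<exists>b. \<forall>x. x \<^bold>\<in> b \<longleftrightarrow> x \<^bold>\<in> a \<and> sat mem p (s(0 := x))"
    and replacement: "(\<And>x. x \<^bold>\<in> a \<Longrightarrow> \<exists>!y. sat mem p (s(0 := x, 1 := y))) \<Longrightarrow>
      \<exists>b. \<forall>y. y \<^bold>\<in> b \<longleftrightarrow> (\<exists>x. x \<^bold>\<in> a \<and> sat mem p (s(0 := x, 1 := y)))"

syntax
  "_all_in" :: "pttrn \<Rightarrow> 'v \<Rightarrow> bool \<Rightarrow> bool"  ("(3\<forall>_\<^bold>\<in>_./ _)" [0, 51, 10] 10)
  "_ex_in" :: "pttrn \<Rightarrow> 'v \<Rightarrow> bool \<Rightarrow> bool"  ("(3\<exists>_\<^bold>\<in>_./ _)" [0, 51, 10] 10)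
translations
  "\<forall>x\<^bold>\<in>a. P" \<rightharpoonup> "\<forall>x. CONST mem x a \<longrightarrow> P"
  "\<exists>x\<^bold>\<in>a. P" \<rightharpoonup> "\<exists>x. CONST mem x a \<and> P"

context zf
begin

abbreviation not_mem :: "'a \<Rightarrow> 'a \<Rightarrow> bool"  (infix "\<^bold>\<notin>" 50) where
  "x \<^bold>\<notin> a \<equiv> \<not> x \<^bold>\<in> a"

definition subset_of :: "'a \<Rightarrow> 'a \<Rightarrow> bool"  (infix "\<^bold>\<subseteq>" 50) where
  "a \<^bold>\<subseteq> b \<longleftrightarrow> (\<forall>x. x \<^bold>\<in> a \<longrightarrow> x \<^bold>\<in> b)"

subsection \<open>Sets, functions and natural numbers of the model\<close>

text \<open>
  Functions and predicates of HOL that occur as arguments below (as in \<open>zset P\<close>) are used only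
  to abbreviate first-order expressions: each of them is always applied to arguments that are
  first-order definable in the model with parameters, and each description \<open>THE\<close> is used only
  where ZF proves unique existence.
\<close>

definition zset :: "('a \<Rightarrow> bool) \<Rightarrow> 'a" where
  "zset P = (THE a. \<forall>x. x \<^bold>\<in> a \<longleftrightarrow> P x)"

definition emptyset :: "'a" where
  "emptyset = zset (\<lambda>x. False)"

definition upair :: "'a \<Rightarrow> 'a \<Rightarrow> 'a" where
  "upair a b = zset (\<lambda>x. x = a \<or> x = b)"

definition pair :: "'a \<Rightarrow> 'a \<Rightarrow> 'a" where
  "pair a b = upair (upair a a) (upair a b)"

definition fst_of :: "'a \<Rightarrow> 'a" where
  "fst_of p = (THE a. \<exists>b. p = pair a b)"

definition snd_of :: "'a \<Rightarrow> 'a" where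
  "snd_of p = (THE b. \<exists>a. p = pair a b)"

definition Pow_of :: "'a \<Rightarrow> 'a" where
  "Pow_of a = zset (\<lambda>x. x \<^bold>\<subseteq> a)"

definition diff :: "'a \<Rightarrow> 'a \<Rightarrow> 'a" where
  "diff a b = zset (\<lambda>x. x \<^bold>\<in> a \<and> x \<^bold>\<notin> b)"

definition prod_of :: "'a \<Rightarrow> 'a \<Rightarrow> 'a" where
  "prod_of a b = zset (\<lambda>p. \<exists>x\<^bold>\<in>a. \<exists>y\<^bold>\<in>b. p = pair x y)"

definition funs :: "'a \<Rightarrow> 'a \<Rightarrow> 'a" where
  "funs a b = zset (\<lambda>f. f \<^bold>\<subseteq> prod_of a b \<and> (\<forall>x\<^bold>\<in>a. \<exists>!y. pair x y \<^bold>\<in> f))"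

definition app :: "'a \<Rightarrow> 'a \<Rightarrow> 'a"  (infixl "\<^bold>\<cdot>" 90) where
  "f \<^bold>\<cdot> x = (THE y. pair x y \<^bold>\<in> f)"

definition succ :: "'a \<Rightarrow> 'a" where
  "succ m = zset (\<lambda>x. x \<^bold>\<in> m \<or> x = m)"

definition omega :: "'a" where
  "omega = zset (\<lambda>m. \<forall>w. emptyset \<^bold>\<in> w \<and> (\<forall>x\<^bold>\<in>w. succ x \<^bold>\<in> w) \<longrightarrow> m \<^bold>\<in> w)"

subsection \<open>Real numbers of the model\<close>

definition complete_ordered_field :: "'a \<Rightarrow> 'a \<Rightarrow> 'a \<Rightarrow> 'a \<Rightarrow> 'a \<Rightarrow> 'a \<Rightarrow> bool" where
  "complete_ordered_field R add mul le z e \<longleftrightarrow>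
    (let a = (\<lambda>x y. add \<^bold>\<cdot> pair x y); m = (\<lambda>x y. mul \<^bold>\<cdot> pair x y); l = (\<lambda>x y. pair x y \<^bold>\<in> le) in
      add \<^bold>\<in> funs (prod_of R R) R \<and> mul \<^bold>\<in> funs (prod_of R R) R \<and> le \<^bold>\<subseteq> prod_of R R \<and>
      z \<^bold>\<in> R \<and> e \<^bold>\<in> R \<and> z \<noteq> e \<and>
      (\<forall>x\<^bold>\<in>R. \<forall>y\<^bold>\<in>R. \<forall>w\<^bold>\<in>R. a (a x y) w = a x (a y w)) \<and>
      (\<forall>x\<^bold>\<in>R. \<forall>y\<^bold>\<in>R. a x y = a y x) \<and>
      (\<forall>x\<^bold>\<in>R. a x z = x) \<and>
      (\<forall>x\<^bold>\<in>R. \<exists>y\<^bold>\<in>R. a x y = z) \<and>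
      (\<forall>x\<^bold>\<in>R. \<forall>y\<^bold>\<in>R. \<forall>w\<^bold>\<in>R. m (m x y) w = m x (m y w)) \<and>
      (\<forall>x\<^bold>\<in>R. \<forall>y\<^bold>\<in>R. m x y = m y x) \<and>
      (\<forall>x\<^bold>\<in>R. m x e = x) \<and>
      (\<forall>x\<^bold>\<in>R. x \<noteq> z \<longrightarrow> (\<exists>y\<^bold>\<in>R. m x y = e)) \<and>
      (\<forall>x\<^bold>\<in>R. \<forall>y\<^bold>\<in>R. \<forall>w\<^bold>\<in>R. m x (a y w) = a (m x y) (m x w)) \<and>
      (\<forall>x\<^bold>\<in>R. l x x) \<and>
      (\<forall>x\<^bold>\<in>R. \<forall>y\<^bold>\<in>R. \<forall>w\<^bold>\<in>R. l x y \<and> l y w \<longrightarrow> l x w) \<and>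
      (\<forall>x\<^bold>\<in>R. \<forall>y\<^bold>\<in>R. l x y \<and> l y x \<longrightarrow> x = y) \<and>
      (\<forall>x\<^bold>\<in>R. \<forall>y\<^bold>\<in>R. l x y \<or> l y x) \<and>
      (\<forall>x\<^bold>\<in>R. \<forall>y\<^bold>\<in>R. \<forall>w\<^bold>\<in>R. l x y \<longrightarrow> l (a x w) (a y w)) \<and>
      (\<forall>x\<^bold>\<in>R. \<forall>y\<^bold>\<in>R. l z x \<and> l z y \<longrightarrow> l z (m x y)) \<and>
      (\<forall>S. S \<^bold>\<subseteq> R \<and> S \<noteq> emptyset \<and> (\<exists>b\<^bold>\<in>R. \<forall>x\<^bold>\<in>S. l x b) \<longrightarrow>
        (\<exists>b\<^bold>\<in>R. (\<forall>x\<^bold>\<in>S. l x b) \<and> (\<forall>c\<^bold>\<in>R. (\<forall>x\<^bold>\<in>S. l x c) \<longrightarrow> l b c))))"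

end

text \<open>
  ZF proves that a complete ordered field exists and is unique up to isomorphism.  The real
  line of the model may be any such field; which one is a parameter of the class, so that a
  theorem about the class holds for all of them.  ``Complete'' refers to suprema of sets that
  belong to the model.
\<close>

class zf_reals = zf +
  fixes Reals rplus rtimes rle rzero rone :: 'a
  assumes complete_ordered_field: "complete_ordered_field Reals rplus rtimes rle rzero rone"

abbreviation rzero' :: "'v::zf_reals"  ("\<^bold>0") where "\<^bold>0 \<equiv> rzero"
abbreviation rone' :: "'v::zf_reals"  ("\<^bold>1") where "\<^bold>1 \<equiv> rone"

definition radd :: "'v::zf_reals \<Rightarrow> 'v \<Rightarrow> 'v"  (infixl "\<^bold>+" 65) where
  "x \<^bold>+ y = rplus \<^bold>\<cdot> pair x y"

definition rmult :: "'v::zf_reals \<Rightarrow> 'v \<Rightarrow> 'v"  (infixl "\<^bold>*" 70) where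
  "x \<^bold>* y = rtimes \<^bold>\<cdot> pair x y"

definition rless_eq :: "'v::zf_reals \<Rightarrow> 'v \<Rightarrow> bool"  (infix "\<^bold>\<le>" 50) where
  "x \<^bold>\<le> y \<longleftrightarrow> pair x y \<^bold>\<in> rle"

definition rless :: "'v::zf_reals \<Rightarrow> 'v \<Rightarrow> bool"  (infix "\<^bold><" 50) where
  "x \<^bold>< y \<longleftrightarrow> x \<^bold>\<le> y \<and> x \<noteq> y"

definition rminus :: "'v::zf_reals \<Rightarrow> 'v \<Rightarrow> 'v"  (infixl "\<^bold>-" 65) where
  "x \<^bold>- y = (THE z. z \<^bold>\<in> Reals \<and> y \<^bold>+ z = x)"

definition rdivide :: "'v::zf_reals \<Rightarrow> 'v \<Rightarrow> 'v"  (infixl "\<^bold>'/" 70) where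
  "x \<^bold>/ y = (THE z. z \<^bold>\<in> Reals \<and> y \<^bold>* z = x)"

definition rabs :: "'v::zf_reals \<Rightarrow> 'v" where
  "rabs x = (if \<^bold>0 \<^bold>\<le> x then x else \<^bold>0 \<^bold>- x)"

definition rsqrt :: "'v::zf_reals \<Rightarrow> 'v" where
  "rsqrt x = (THE y. y \<^bold>\<in> Reals \<and> \<^bold>0 \<^bold>\<le> y \<and> y \<^bold>* y = x)"

text \<open>
  \<open>rfold op c a n\<close> is \<open>op (\<dots> (op (op c (a 0)) (a 1)) \<dots>) (a (n - 1))\<close> for a natural number \<open>n\<close> of
  the model.
\<close>

definition rfold :: "('v::zf_reals \<Rightarrow> 'v \<Rightarrow> 'v) \<Rightarrow> 'v \<Rightarrow> ('v \<Rightarrow> 'v) \<Rightarrow> 'v \<Rightarrow> 'v" where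
  "rfold op c a n = (THE y. \<exists>s\<^bold>\<in>funs (succ n) Reals.
     s \<^bold>\<cdot> emptyset = c \<and> (\<forall>l\<^bold>\<in>n. s \<^bold>\<cdot> succ l = op (s \<^bold>\<cdot> l) (a l)) \<and> y = s \<^bold>\<cdot> n)"

definition rsum :: "('v::zf_reals \<Rightarrow> 'v) \<Rightarrow> 'v \<Rightarrow> 'v" where
  "rsum a n = rfold (\<^bold>+) \<^bold>0 a n"

definition rpow :: "'v::zf_reals \<Rightarrow> 'v \<Rightarrow> 'v" where
  "rpow x n = rfold (\<^bold>*) \<^bold>1 (\<lambda>l. x) n"

definition real_of :: "'v::zf_reals \<Rightarrow> 'v" where
  "real_of n = rsum (\<lambda>l. \<^bold>1) n"

definition rmax :: "('v::zf_reals \<Rightarrow> 'v) \<Rightarrow> 'v \<Rightarrow> 'v" where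
  "rmax a n = (THE y. (\<exists>l\<^bold>\<in>n. y = a l) \<and> (\<forall>l\<^bold>\<in>n. a l \<^bold>\<le> y))"

text \<open>On \<^term>\<open>omega\<close>, inclusion is the usual order.\<close>

definition tends_to :: "('v::zf_reals \<Rightarrow> 'v \<Rightarrow> 'v) \<Rightarrow> ('v \<Rightarrow> 'v) \<Rightarrow> 'v \<Rightarrow> bool" where
  "tends_to d a y \<longleftrightarrow> (\<forall>\<delta>\<^bold>\<in>Reals. \<^bold>0 \<^bold>< \<delta> \<longrightarrow>
     (\<exists>N\<^bold>\<in>omega. \<forall>m\<^bold>\<in>omega. N \<^bold>\<subseteq> m \<longrightarrow> d (a m) y \<^bold>< \<delta>))"

definition Cauchy_seq :: "('v::zf_reals \<Rightarrow> 'v \<Rightarrow> 'v) \<Rightarrow> ('v \<Rightarrow> 'v) \<Rightarrow> bool" where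
  "Cauchy_seq d a \<longleftrightarrow> (\<forall>\<delta>\<^bold>\<in>Reals. \<^bold>0 \<^bold>< \<delta> \<longrightarrow>
     (\<exists>N\<^bold>\<in>omega. \<forall>m\<^bold>\<in>omega. \<forall>k\<^bold>\<in>omega. N \<^bold>\<subseteq> m \<and> N \<^bold>\<subseteq> k \<longrightarrow> d (a m) (a k) \<^bold>< \<delta>))"

definition complete_subset :: "'v::zf_reals \<Rightarrow> ('v \<Rightarrow> 'v \<Rightarrow> 'v) \<Rightarrow> 'v \<Rightarrow> bool" where
  "complete_subset X d Y \<longleftrightarrow> Y \<^bold>\<subseteq> X \<and>
     (\<forall>s\<^bold>\<in>funs omega Y. Cauchy_seq d (\<lambda>m. s \<^bold>\<cdot> m) \<longrightarrow> (\<exists>y\<^bold>\<in>Y. tends_to d (\<lambda>m. s \<^bold>\<cdot> m) y))"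

definition rdist :: "'v::zf_reals \<Rightarrow> 'v \<Rightarrow> 'v" where
  "rdist x y = rabs (x \<^bold>- y)"

text \<open>Euler's limit of \<open>(1 + x / m) ^ m\<close> for \<open>m = 1, 2, \<dots>\<close>.\<close>

definition rexp :: "'v::zf_reals \<Rightarrow> 'v" where
  "rexp x = (THE y. y \<^bold>\<in> Reals \<and>
     tends_to rdist (\<lambda>m. rpow (\<^bold>1 \<^bold>+ x \<^bold>/ real_of (succ m)) (succ m)) y)"

text \<open>
  The sequence is a function with domain \<^term>\<open>omega\<close> belonging to the model, and so is the
  choice function; the argument of type \<^typ>\<open>'v itself\<close> names the model.
\<close>

definition CC_cR :: "'v::zf_reals itself \<Rightarrow> bool" where
  "CC_cR (_ :: 'v itself) \<longleftrightarrow> (\<forall>A :: 'v. A \<^bold>\<in> funs omega (Pow_of Reals) \<and>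
     (\<forall>m\<^bold>\<in>omega. A \<^bold>\<cdot> m \<noteq> emptyset \<and> complete_subset Reals rdist (A \<^bold>\<cdot> m)) \<longrightarrow>
     (\<exists>f\<^bold>\<in>funs omega Reals. \<forall>m\<^bold>\<in>omega. f \<^bold>\<cdot> m \<^bold>\<in> A \<^bold>\<cdot> m))"

section \<open>Complex numbers of the model\<close>

definition Complexes :: "'v::zf_reals" where
  "Complexes = prod_of Reals Reals"

definition cminus :: "'v::zf_reals \<Rightarrow> 'v \<Rightarrow> 'v" where
  "cminus z w = pair (fst_of z \<^bold>- fst_of w) (snd_of z \<^bold>- snd_of w)"

definition cmult :: "'v::zf_reals \<Rightarrow> 'v \<Rightarrow> 'v" where
  "cmult z w = pair (fst_of z \<^bold>* fst_of w \<^bold>- snd_of z \<^bold>* snd_of w)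
                    (fst_of z \<^bold>* snd_of w \<^bold>+ snd_of z \<^bold>* fst_of w)"

definition cmod :: "'v::zf_reals \<Rightarrow> 'v" where
  "cmod z = rsqrt (fst_of z \<^bold>* fst_of z \<^bold>+ snd_of z \<^bold>* snd_of z)"

definition cdist :: "'v::zf_reals \<Rightarrow> 'v \<Rightarrow> 'v" where
  "cdist z w = cmod (cminus z w)"

definition complex_of :: "'v::zf_reals \<Rightarrow> 'v" where
  "complex_of x = pair x \<^bold>0"

definition theta :: "'v::zf_reals" where
  "theta = pair ((\<^bold>0 \<^bold>- \<^bold>1) \<^bold>/ (\<^bold>1 \<^bold>+ \<^bold>1)) (rsqrt (\<^bold>1 \<^bold>+ \<^bold>1 \<^bold>+ \<^bold>1) \<^bold>/ (\<^bold>1 \<^bold>+ \<^bold>1))"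

definition open_C :: "'v::zf_reals \<Rightarrow> bool" where
  "open_C U \<longleftrightarrow> U \<^bold>\<subseteq> Complexes \<and> (\<forall>z\<^bold>\<in>U. \<exists>\<delta>\<^bold>\<in>Reals. \<^bold>0 \<^bold>< \<delta> \<and>
     (\<forall>w\<^bold>\<in>Complexes. cdist z w \<^bold>< \<delta> \<longrightarrow> w \<^bold>\<in> U))"

section \<open>The symmetrized max-plus algebra\<close>

text \<open>Any set that is not a real can serve as \<open>-\<infinity>\<close>; by foundation \<^term>\<open>Reals\<close> is one.\<close>

definition minus_inf :: "'v::zf_reals"  ("\<epsilon>") where
  "\<epsilon> = Reals"

definition Reals_eps :: "'v::zf_reals" where
  "Reals_eps = zset (\<lambda>x. x \<^bold>\<in> Reals \<or> x = \<epsilon>)"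

definition emax :: "'v::zf_reals \<Rightarrow> 'v \<Rightarrow> 'v" where
  "emax a b = (if a = \<epsilon> then b else if b = \<epsilon> then a else if a \<^bold>\<le> b then b else a)"

definition eexp :: "'v::zf_reals \<Rightarrow> 'v" where
  "eexp r = (if r = \<epsilon> then \<^bold>0 else rexp r)"

definition balances :: "'v::zf_reals \<Rightarrow> 'v \<Rightarrow> bool"  (infix "\<nabla>" 50) where
  "p \<nabla> q \<longleftrightarrow> emax (fst_of p) (snd_of q) = emax (snd_of p) (fst_of q)"

definition equivalent :: "'v::zf_reals \<Rightarrow> 'v \<Rightarrow> bool"  (infix "\<^bold>\<sim>" 50) where
  "p \<^bold>\<sim> q \<longleftrightarrow> (if fst_of p \<noteq> snd_of p \<and> fst_of q \<noteq> snd_of q then p \<nabla> q else p = q)"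

definition class_of :: "'v::zf_reals \<Rightarrow> 'v" where
  "class_of p = zset (\<lambda>q. q \<^bold>\<in> prod_of Reals_eps Reals_eps \<and> p \<^bold>\<sim> q)"

definition Sym :: "'v::zf_reals" where
  "Sym = zset (\<lambda>x. \<exists>p\<^bold>\<in>prod_of Reals_eps Reals_eps. x = class_of p)"

datatype sign = Plus | Minus | Bal

fun signed :: "sign \<Rightarrow> 'v::zf_reals \<Rightarrow> 'v" where
  "signed Plus r = class_of (pair r \<epsilon>)"
| "signed Minus r = class_of (pair \<epsilon> r)"
| "signed Bal r = class_of (pair r r)"

text \<open>The three forms of the class of \<open>(\<epsilon>, \<epsilon>)\<close> coincide; \<open>sgn_of\<close> gives it the sign \<^term>\<open>Plus\<close>.\<close>

definition sgn_of :: "'v::zf_reals \<Rightarrow> sign" where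
  "sgn_of a = (if \<exists>r\<^bold>\<in>Reals_eps. a = signed Plus r then Plus
               else if \<exists>r\<^bold>\<in>Reals_eps. a = signed Minus r then Minus else Bal)"

definition abs_of :: "'v::zf_reals \<Rightarrow> 'v" where
  "abs_of a = (THE r. r \<^bold>\<in> Reals_eps \<and> (\<exists>\<sigma>. a = signed \<sigma> r))"

definition Phi :: "'v::zf_reals \<Rightarrow> 'v" where
  "Phi a = (case sgn_of a of
      Plus \<Rightarrow> cmult theta (complex_of (eexp (abs_of a)))
    | Minus \<Rightarrow> cmult (cmult theta theta) (complex_of (eexp (abs_of a)))
    | Bal \<Rightarrow> complex_of (eexp (abs_of a)))"

definition d1 :: "'v::zf_reals \<Rightarrow> 'v \<Rightarrow> 'v" where
  "d1 a b = cdist (Phi a) (Phi b)"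

definition d2 :: "'v::zf_reals \<Rightarrow> 'v \<Rightarrow> 'v" where
  "d2 a b = (if sgn_of a = sgn_of b then rabs (eexp (abs_of a) \<^bold>- eexp (abs_of b))
             else eexp (abs_of a) \<^bold>+ eexp (abs_of b))"

text \<open>The initial topology of \<^term>\<open>Phi\<close>: the smallest one making it continuous.\<close>

definition open_Sym :: "'v::zf_reals \<Rightarrow> bool" where
  "open_Sym W \<longleftrightarrow> (\<exists>U. open_C U \<and> W = zset (\<lambda>a. a \<^bold>\<in> Sym \<and> Phi a \<^bold>\<in> U))"

section \<open>Finite powers\<close>

definition Sym_pow :: "'v::zf_reals \<Rightarrow> 'v" where
  "Sym_pow n = funs n Sym"

definition open_Sym_pow :: "'v::zf_reals \<Rightarrow> 'v \<Rightarrow> bool" where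
  "open_Sym_pow n W \<longleftrightarrow> W \<^bold>\<subseteq> Sym_pow n \<and>
     (\<forall>x\<^bold>\<in>W. \<exists>U\<^bold>\<in>funs n (Pow_of Sym). (\<forall>l\<^bold>\<in>n. open_Sym (U \<^bold>\<cdot> l) \<and> x \<^bold>\<cdot> l \<^bold>\<in> U \<^bold>\<cdot> l) \<and>
       (\<forall>y\<^bold>\<in>Sym_pow n. (\<forall>l\<^bold>\<in>n. y \<^bold>\<cdot> l \<^bold>\<in> U \<^bold>\<cdot> l) \<longrightarrow> y \<^bold>\<in> W))"

definition closed_Sym_pow :: "'v::zf_reals \<Rightarrow> 'v \<Rightarrow> bool" where
  "closed_Sym_pow n Y \<longleftrightarrow> Y \<^bold>\<subseteq> Sym_pow n \<and> open_Sym_pow n (diff (Sym_pow n) Y)"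

definition connected_Sym_pow :: "'v::zf_reals \<Rightarrow> 'v \<Rightarrow> bool" where
  "connected_Sym_pow n Y \<longleftrightarrow> Y \<^bold>\<subseteq> Sym_pow n \<and>
     \<not> (\<exists>U V. open_Sym_pow n U \<and> open_Sym_pow n V \<and>
          (\<forall>x\<^bold>\<in>Y. x \<^bold>\<in> U \<or> x \<^bold>\<in> V) \<and> \<not> (\<exists>x\<^bold>\<in>Y. x \<^bold>\<in> U \<and> x \<^bold>\<in> V) \<and>
          (\<exists>x\<^bold>\<in>Y. x \<^bold>\<in> U) \<and> (\<exists>x\<^bold>\<in>Y. x \<^bold>\<in> V))"

text \<open>\<open>rho k i n\<close> is meant for \<open>k \<in> {0, 1, 2}\<close> and \<open>i \<in> {1, 2}\<close> only.\<close>

definition dist_Sym :: "nat \<Rightarrow> 'v::zf_reals \<Rightarrow> 'v \<Rightarrow> 'v" where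
  "dist_Sym i = (if i = 1 then d1 else d2)"

definition rho :: "nat \<Rightarrow> nat \<Rightarrow> 'v::zf_reals \<Rightarrow> 'v \<Rightarrow> 'v \<Rightarrow> 'v" where
  "rho k i n x y =
    (if k = 0 then rmax (\<lambda>l. dist_Sym i (x \<^bold>\<cdot> l) (y \<^bold>\<cdot> l)) n
     else if k = 1 then
       rsqrt (rsum (\<lambda>l. dist_Sym i (x \<^bold>\<cdot> l) (y \<^bold>\<cdot> l) \<^bold>* dist_Sym i (x \<^bold>\<cdot> l) (y \<^bold>\<cdot> l)) n)
     else rsum (\<lambda>l. dist_Sym i (x \<^bold>\<cdot> l) (y \<^bold>\<cdot> l)) n)"

end

theory Submission
  imports Defs
begin

text \<open>
  Let every complete connected subspace of \<open>S\<^sup>n\<close> be closed.  The heart of the proof is that a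
  complete subset \<open>A\<close> of the real line then contains each point \<open>p\<close> that it approaches from one
  side (\<open>complete_approached_mem\<close>).  Say \<open>A\<close> approaches \<open>p\<close> from the right, and let \<open>B\<close> be the set of
  all \<open>t\<close> in \<open>[0, 1/2]\<close> with \<open>p + t\<close> in \<open>A\<close>.  The map \<open>r \<mapsto> \<oplus>r\<close> carries \<open>[0, 1/2]\<close> into \<open>S\<close>, so two
  coordinates of \<open>S\<^sup>n\<close> provide a copy of the square \<open>[0, 1/2]\<^sup>2\<close>, and in it lies the comb
  \<open>B \<times> [0, 1/2] \<union> [0, 1/2] \<times> {0}\<close>: a spine on the first axis and a tooth over each point of \<open>B\<close>.

  The comb is connected because each tooth is attached to the spine (\<open>comb_connected\<close>).  It is
  complete (\<open>comb_complete\<close>): let a Cauchy sequence in it have the coordinatewise limit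
  \<open>(x, y)\<close>.  Either \<open>y = 0\<close> and the limit is on the spine, or the terms are eventually off the spine,
  so their first coordinates form a Cauchy sequence in \<open>B\<close>, and \<open>x\<close> is in \<open>B\<close> because \<open>A\<close> is complete.
  Now the point \<open>(0, 1/2)\<close> is in the closure of the comb, as \<open>B\<close> has points arbitrarily close to \<open>0\<close>.
  By assumption the comb is closed, so \<open>0\<close> is in \<open>B\<close>, which means that \<open>p\<close> is in \<open>A\<close>
  (\<open>comb_closed_imp\<close>).

  Consequently a nonempty complete set of reals that has a nonnegative element has a least
  one, and any other has a greatest element (\<open>canonical_exists\<close>).  This singles out an element of
  each member of a sequence of such sets, and these elements form a choice function.

  All this takes place in a model of ZF, where the existence of a set or a function has to be
  derived from separation, that is, from a first-order definition with parameters.  Hence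
  induction, recursion, suprema and the sequences to which completeness is applied all come with
  a definability obligation.  The calculus of definable predicates and terms in the first section
  discharges these by resolution.  On the other hand, algebra with the reals of the model needs no definability: they
  form a type \<open>mreal\<close> that is an instance of \<^class>\<open>linordered_field\<close>.

  The metrics involve the exponential function, but only its restriction to \<open>[0, 1/2]\<close>, where it is
  bi-Lipschitz (\<open>mexp_bilipschitz\<close>); together with \<open>rho_square_pt\<close> this shows that the \<open>\<rho>\<close>-Cauchy sequences in
  the square are those that are Cauchy in both coordinates.
\<close>

section \<open>Definability with parameters\<close>

text \<open>
  An assignment that holds the arguments \<open>e\<close> of a predicate in its even positions and the
  parameters \<open>c\<close> in the odd ones, so that both supplies are infinite.
\<close>

definition merge :: "(nat \<Rightarrow> 'a) \<Rightarrow> (nat \<Rightarrow> 'a) \<Rightarrow> nat \<Rightarrow> 'a" where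
  "merge c e i = (if even i then e (i div 2) else c (i div 2))"

text \<open>
  A predicate of environments stands for a predicate with arbitrarily many arguments, which are
  addressed by de Bruijn indices: a quantifier binds index \<open>0\<close> and shifts the others.  In this form
  the closure rules below are syntax-directed, and \<open>intro\<close> proves definability.
\<close>

definition definable :: "((nat \<Rightarrow> 'v::zf) \<Rightarrow> bool) \<Rightarrow> bool" where
  "definable P \<longleftrightarrow> (\<exists>p c. \<forall>e. P e \<longleftrightarrow> sat mem p (merge c e))"

definition definable_term :: "((nat \<Rightarrow> 'v::zf) \<Rightarrow> 'v) \<Rightarrow> bool" where
  "definable_term T \<longleftrightarrow> definable (\<lambda>e. e 0 = T (\<lambda>i. e (Suc i)))"

named_theorems definable_intros

primrec rename :: "(nat \<Rightarrow> nat) \<Rightarrow> fm \<Rightarrow> fm" where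
  "rename h (Mem i j) = Mem (h i) (h j)"
| "rename h (Eq i j) = Eq (h i) (h j)"
| "rename h (Neg p) = Neg (rename h p)"
| "rename h (Conj p q) = Conj (rename h p) (rename h q)"
| "rename h (Exists i p) = Exists (h i) (rename h p)"

lemma sat_rename: "inj h \<Longrightarrow> sat E (rename h p) s \<longleftrightarrow> sat E p (s \<circ> h)"
proof (induction p arbitrary: s)
  case (Exists i p)
  have "s(h i := x) \<circ> h = (s \<circ> h)(i := x)" for x
    using Exists.prems by (auto simp: fun_eq_iff inj_def)
  then show ?case by (simp only: rename.simps sat.simps Exists.IH[OF Exists.prems])
qed simp_all

lemma definable_mem_var: "definable (\<lambda>e. e i \<^bold>\<in> e j)"
  unfolding definable_def by (rule exI[of _ "Mem (2 * i) (2 * j)"]) (simp add: merge_def)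

lemma definable_eq_var: "definable (\<lambda>e. e i = e j)"
  unfolding definable_def by (rule exI[of _ "Eq (2 * i) (2 * j)"]) (simp add: merge_def)

lemma definable_not [definable_intros]:
  assumes "definable P" shows "definable (\<lambda>e. \<not> P e)"
proof -
  obtain p c where "\<forall>e. P e \<longleftrightarrow> sat mem p (merge c e)" using assms unfolding definable_def by blast
  then have "\<forall>e. \<not> P e \<longleftrightarrow> sat mem (Neg p) (merge c e)" by simp
  then show ?thesis unfolding definable_def by blast
qed

text \<open>
  The parameters of the two formulas are interleaved; renaming the variables accordingly leaves the
  arguments in place.
\<close>

lemma definable_conj [definable_intros]:
  assumes "definable P" "definable Q" shows "definable (\<lambda>e. P e \<and> Q e)"
proof -
  obtain p c where p: "\<And>e. P e \<longleftrightarrow> sat mem p (merge c e)"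
    using assms(1) unfolding definable_def by blast
  obtain q d where q: "\<And>e. Q e \<longleftrightarrow> sat mem q (merge d e)"
    using assms(2) unfolding definable_def by blast
  define f g :: "nat \<Rightarrow> nat"
    where "f i = (if even i then i else 2 * i - 1)" and "g i = (if even i then i else 2 * i + 1)" for i
  have "inj f"
    by (rule inj_on_inverseI[of _ "\<lambda>k. if even k then k else (k + 1) div 2"]) (auto simp: f_def)
  moreover have "inj g"
    by (rule inj_on_inverseI[of _ "\<lambda>k. if even k then k else k div 2"]) (auto simp: g_def)
  moreover have "merge (merge d c) e \<circ> f = merge c e" for e
  proof
    fix i show "(merge (merge d c) e \<circ> f) i = merge c e i"
    proof (cases "even i")
      case False
      then obtain b where "i = 2 * b + 1" by (rule oddE)
      then show ?thesis by (simp add: merge_def f_def)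
    qed (simp add: merge_def f_def)
  qed
  moreover have "merge (merge d c) e \<circ> g = merge d e" for e
  proof
    fix i show "(merge (merge d c) e \<circ> g) i = merge d e i"
    proof (cases "even i")
      case False
      then obtain b where "i = 2 * b + 1" by (rule oddE)
      then show ?thesis by (simp add: merge_def g_def)
    qed (simp add: merge_def g_def)
  qed
  ultimately have "P e \<and> Q e \<longleftrightarrow> sat mem (Conj (rename f p) (rename g q)) (merge (merge d c) e)" for e
    by (simp add: sat_rename p q)
  then show ?thesis unfolding definable_def by blast
qed

text \<open>
  The bound variable moves from position \<open>0\<close> to position \<open>1\<close>, which is made available by shifting the
  parameters; the other arguments move two places down.
\<close>

lemma definable_ex [definable_intros]:
  assumes "definable (\<lambda>e. Q (\<lambda>i. e (Suc i)) (e 0))" shows "definable (\<lambda>e. \<exists>x. Q e x)"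
proof -
  obtain p c where p: "\<And>e. Q (\<lambda>i. e (Suc i)) (e 0) \<longleftrightarrow> sat mem p (merge c e)"
    using assms unfolding definable_def by blast
  define g :: "nat \<Rightarrow> nat" where "g i = (if i = 0 then 1 else if even i then i - 2 else i + 2)" for i
  have "inj g"
    by (rule inj_on_inverseI[of _ "\<lambda>k. if k = 1 then 0 else if even k then k + 2 else k - 2"])
      (auto simp: g_def; presburger)
  moreover have "(merge (case_nat undefined c) e)(1 := x) \<circ> g = merge c (case_nat x e)" for e x
    by (auto simp: fun_eq_iff merge_def g_def elim!: oddE evenE split: nat.split)
  ultimately have "(\<exists>x. Q e x) \<longleftrightarrow> sat mem (Exists 1 (rename g p)) (merge (case_nat undefined c) e)" for e
    using p[of "case_nat _ e"] by (simp add: sat_rename)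
  then show ?thesis unfolding definable_def by blast
qed

lemma definable_eq_const: "definable (\<lambda>e. e i = c)"
proof -
  have "e i = c \<longleftrightarrow> sat mem (Eq (2 * i) 1) (merge (\<lambda>_. c) e)" for e
    by (simp add: merge_def)
  then show ?thesis unfolding definable_def by blast
qed

lemma definable_inj:
  assumes "definable P" "inj h" shows "definable (\<lambda>e. P (\<lambda>i. e (h i)))"
proof -
  obtain p c where p: "\<And>e. P e \<longleftrightarrow> sat mem p (merge c e)"
    using assms unfolding definable_def by blast
  define g where "g i = (if even i then 2 * h (i div 2) else i)" for i
  have "inj g"
  proof (rule injI)
    fix x y assume "g x = g y"
    then show "x = y"
      using injD[OF assms(2), of "x div 2" "y div 2"]
      by (cases "even x"; cases "even y") (auto simp: g_def elim!: evenE)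
  qed
  moreover have "merge c e \<circ> g = merge c (\<lambda>i. e (h i))" for e
    by (auto simp: fun_eq_iff merge_def g_def)
  ultimately have "P (\<lambda>i. e (h i)) \<longleftrightarrow> sat mem (rename g p) (merge c e)" for e
    by (simp add: sat_rename p)
  then show ?thesis unfolding definable_def by blast
qed

lemma definable_disj [definable_intros]:
  "definable P \<Longrightarrow> definable Q \<Longrightarrow> definable (\<lambda>e. P e \<or> Q e)"
  using definable_not[OF definable_conj[OF definable_not definable_not, of P Q]] by simp

lemma definable_imp [definable_intros]:
  "definable P \<Longrightarrow> definable Q \<Longrightarrow> definable (\<lambda>e. P e \<longrightarrow> Q e)"
  using definable_not[OF definable_conj[OF _ definable_not, of P Q]] by simp

lemma definable_iff [definable_intros]:
  "definable P \<Longrightarrow> definable Q \<Longrightarrow> definable (\<lambda>e. P e \<longleftrightarrow> Q e)"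
  unfolding iff_conv_conj_imp by (intro definable_conj definable_imp)

lemma definable_all [definable_intros]:
  "definable (\<lambda>e. Q (\<lambda>i. e (Suc i)) (e 0)) \<Longrightarrow> definable (\<lambda>e. \<forall>x. Q e x)"
  using definable_not[OF definable_ex[of "\<lambda>e x. \<not> Q e x"], OF definable_not] by simp

lemma definable_var [definable_intros]: "definable_term (\<lambda>e. e i)"
  unfolding definable_term_def by (rule definable_eq_var)

lemma definable_const [definable_intros]: "definable_term (\<lambda>e. c)"
  unfolding definable_term_def by (rule definable_eq_const)

lemma definable_term_shift:
  assumes "definable_term T" shows "definable_term (\<lambda>e. T (\<lambda>i. e (Suc i)))"
proof -
  have "inj (\<lambda>i. if i = 0 then 0 else Suc i)" by (auto simp: inj_def)
  from definable_inj[OF assms[unfolded definable_term_def] this]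
  show ?thesis unfolding definable_term_def by simp
qed

lemma definable_shift:
  "definable P \<Longrightarrow> definable (\<lambda>e. P (\<lambda>i. e (Suc i)))"
  by (rule definable_inj) auto

lemma definable_subst:
  assumes "definable_term T" "definable (\<lambda>e. R (\<lambda>i. e (Suc i)) (e 0))"
  shows "definable (\<lambda>e. R e (T e))"
proof -
  have "definable (\<lambda>e. \<exists>x. x = T e \<and> R e x)"
    using assms unfolding definable_term_def by (intro definable_intros)
  then show ?thesis by simp
qed

text \<open>
  These rules reduce the definability of a predicate or function of the model with terms as
  arguments to the case where the arguments are distinct variables.
\<close>

lemma definable_inst1:
  assumes "definable (\<lambda>e. R (e 0))" "definable_term S"
  shows "definable (\<lambda>e. R (S e))"
  using definable_subst[OF assms(2), of "\<lambda>e. R"] assms(1) by simp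

lemma definable_inst2:
  assumes R: "definable (\<lambda>e. R (e 0) (e 1))" and S: "definable_term S" and T: "definable_term T"
  shows "definable (\<lambda>e. R (S e) (T e))"
proof -
  have "inj (\<lambda>i::nat. if i = 1 then 0 else if i = 0 then 1 else i)" by (auto simp: inj_def)
  from definable_inj[OF R this] have "definable (\<lambda>e. R (e 1) (e 0))" by simp
  then have "definable (\<lambda>e. R (e 0) (T (\<lambda>i. e (Suc i))))"
    using definable_subst[OF definable_term_shift[OF T], of "\<lambda>e y. R (e 0) y"] by simp
  then show ?thesis using definable_subst[OF S, of "\<lambda>e x. R x (T e)"] by simp
qed

lemma definable_inst3:
  assumes R: "definable (\<lambda>e. R (e 0) (e 1) (e 2))"
    and S: "definable_term S" and T: "definable_term T" and U: "definable_term U"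
  shows "definable (\<lambda>e. R (S e) (T e) (U e))"
proof -
  have "inj (\<lambda>i::nat. if i = 2 then 0 else if i = 0 then 1 else if i = 1 then 2 else i)"
    by (auto simp: inj_def)
  from definable_inj[OF R this] have "definable (\<lambda>e. R (e 1) (e 2) (e 0))" by simp
  then have 1: "definable (\<lambda>e. R (e 0) (e 1) (U (\<lambda>i. e (Suc (Suc i)))))"
    using definable_subst[OF definable_term_shift[OF definable_term_shift[OF U]],
        of "\<lambda>e y. R (e 0) (e 1) y"] by (simp add: numeral_2_eq_2)
  have "inj (\<lambda>i::nat. if i = 1 then 0 else if i = 0 then 1 else i)" by (auto simp: inj_def)
  from definable_inj[OF 1 this] have "definable (\<lambda>e. R (e 1) (e 0) (U (\<lambda>i. e (Suc (Suc i)))))"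
    by simp
  then have "definable (\<lambda>e. R (e 0) (T (\<lambda>i. e (Suc i))) (U (\<lambda>i. e (Suc i))))"
    using definable_subst[OF definable_term_shift[OF T], 
      of "\<lambda>e y. R (e 0) y (U (\<lambda>i. e (Suc i)))"] by simp
  then show ?thesis using definable_subst[OF S, of "\<lambda>e x. R x (T e) (U e)"] by simp
qed

lemma definable_term_inst1:
  assumes F: "definable_term (\<lambda>e. F (e 0))" and S: "definable_term S"
  shows "definable_term (\<lambda>e. F (S e))"
proof -
  have "definable (\<lambda>e. e 0 = F (e 1))"
    using F unfolding definable_term_def by simp
  from definable_inst2[where R = "\<lambda>x y. x = F y" and S = "\<lambda>e. e 0" and T = "\<lambda>e. S (\<lambda>i. e (Suc i))",
      OF this definable_var definable_term_shift[OF S]]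
  show ?thesis unfolding definable_term_def .
qed

lemma definable_term_inst2:
  assumes F: "definable_term (\<lambda>e. F (e 0) (e 1))" and S: "definable_term S" and T: "definable_term T"
  shows "definable_term (\<lambda>e. F (S e) (T e))"
proof -
  have "definable (\<lambda>e. e 0 = F (e 1) (e 2))"
    using F unfolding definable_term_def by (simp add: numeral_2_eq_2)
  from definable_inst3[where R = "\<lambda>x y z. x = F y z" and S = "\<lambda>e. e 0"
      and T = "\<lambda>e. S (\<lambda>i. e (Suc i))" and U = "\<lambda>e. T (\<lambda>i. e (Suc i))",
      OF this definable_var definable_term_shift[OF S] definable_term_shift[OF T]]
  show ?thesis unfolding definable_term_def .
qed

lemmas definable_mem [definable_intros] = definable_inst2[where R = mem, OF definable_mem_var]
lemmas definable_eq [definable_intros] = definable_inst2[where R = "(=)", OF definable_eq_var]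

lemma definable_if [definable_intros]:
  assumes "definable P" "definable_term S" "definable_term T"
  shows "definable_term (\<lambda>e. if P e then S e else T e)"
proof -
  have "definable (\<lambda>e. (P (\<lambda>i. e (Suc i)) \<and> e 0 = S (\<lambda>i. e (Suc i)))
      \<or> (\<not> P (\<lambda>i. e (Suc i)) \<and> e 0 = T (\<lambda>i. e (Suc i))))"
    by (intro definable_intros assms definable_shift definable_term_shift)
  then show ?thesis unfolding definable_term_def by (rule back_subst[of definable]) auto
qed

text \<open>
  If no element satisfies \<open>Q\<close>, the description denotes a fixed element of the universe, by
  extensionality of predicates.  Uniqueness without existence is therefore enough; this is used
  below where the existence of a limit is left open.
\<close>

lemma definable_the:
  assumes "definable (\<lambda>e. Q (\<lambda>i. e (Suc i)) (e 0))" "\<And>e y z. Q e y \<Longrightarrow> Q e z \<Longrightarrow> y = z"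
  shows "definable_term (\<lambda>e. THE y. Q e y)"
proof -
  define c where "c = (THE y::'a. False)"
  have "x = (THE y. Q e y) \<longleftrightarrow> Q e x \<or> (\<not> (\<exists>y. Q e y) \<and> x = c)" for x e
  proof (cases "\<exists>y. Q e y")
    case True
    then obtain y where y: "Q e y" by blast
    then have "(THE y. Q e y) = y" using assms(2) by (intro the_equality)
    then show ?thesis using y assms(2) by auto
  next
    case False
    then have "Q e = (\<lambda>y. False)" by auto
    then show ?thesis by (simp add: c_def)
  qed
  moreover have "definable (\<lambda>e. \<exists>x. Q (\<lambda>i. e (Suc i)) x)"
    by (rule definable_shift) (rule definable_ex, rule assms(1))
  then have "definable (\<lambda>e. Q (\<lambda>i. e (Suc i)) (e 0) \<or>
      (\<not> (\<exists>y. Q (\<lambda>i. e (Suc i)) y) \<and> e 0 = c))"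
    by (intro definable_disj definable_conj definable_not assms(1) definable_eq_const)
  ultimately show ?thesis unfolding definable_term_def by simp
qed

lemma definable_ex1 [definable_intros]:
  assumes "definable (\<lambda>e. Q (\<lambda>i. e (Suc i)) (e 0))"
  shows "definable (\<lambda>e. \<exists>!x. Q e x)"
proof -
  have "inj (\<lambda>i::nat. if i = 0 then 0 else Suc i)" by (auto simp: inj_def)
  from definable_inj[OF assms this]
  have 1: "definable (\<lambda>e. Q (\<lambda>i. e (Suc (Suc i))) (e 0))" by simp
  have "definable (\<lambda>e. \<exists>x. Q e x \<and> (\<forall>y. Q e y \<longrightarrow> y = x))"
    by (intro definable_ex definable_conj definable_all definable_imp assms 1 definable_intros)
  then show ?thesis by (simp add: Ex1_def)
qed

section \<open>Sets and functions\<close>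

lemma mem_zset: "\<exists>a. \<forall>x. x \<^bold>\<in> a \<longleftrightarrow> P x \<Longrightarrow> x \<^bold>\<in> zset P \<longleftrightarrow> P x"
proof -
  assume "\<exists>a. \<forall>x. x \<^bold>\<in> a \<longleftrightarrow> P x"
  then have "\<exists>!a. \<forall>x. x \<^bold>\<in> a \<longleftrightarrow> P x" using extensionality by metis
  from theI'[OF this] show ?thesis unfolding zset_def by blast
qed

lemma definable_zset:
  assumes "definable (\<lambda>e. Q (\<lambda>i. e (Suc i)) (e 0))" "\<And>e. \<exists>a. \<forall>x. x \<^bold>\<in> a \<longleftrightarrow> Q e x"
  shows "definable_term (\<lambda>e. zset (\<lambda>x. Q e x))"
  unfolding zset_def
proof (rule definable_the)
  have "inj (\<lambda>i::nat. if i = 0 then 0 else Suc i)" by (auto simp: inj_def)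
  from definable_inj[OF assms(1) this]
  have "definable (\<lambda>e. Q (\<lambda>i. e (Suc (Suc i))) (e 0))" by simp
  then show "definable (\<lambda>e. \<forall>x. (x \<^bold>\<in> e 0) = Q (\<lambda>i. e (Suc i)) x)"
    by (intro definable_intros)
qed (simp add: extensionality)

lemma separation_set:
  assumes "definable (\<lambda>e. P (e 0))" shows "\<exists>b. \<forall>x. x \<^bold>\<in> b \<longleftrightarrow> x \<^bold>\<in> a \<and> P x"
proof -
  obtain p c where p: "\<And>e. P (e 0) \<longleftrightarrow> sat mem p (merge c e)"
    using assms unfolding definable_def by blast
  have "(merge c (\<lambda>_. undefined))(0 := x) = merge c ((\<lambda>_. undefined)(0 := x))" for x
    by (auto simp: fun_eq_iff merge_def)
  then have "P x \<longleftrightarrow> sat mem p ((merge c (\<lambda>_. undefined))(0 := x))" for x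
    using p[of "(\<lambda>_. undefined)(0 := x)"] by simp
  then show ?thesis using separation[of a p "merge c (\<lambda>_. undefined)"] by simp
qed

lemma mem_zset_sub:
  assumes "definable (\<lambda>e. P (e 0))" "\<And>x. P x \<Longrightarrow> x \<^bold>\<in> a" shows "x \<^bold>\<in> zset P \<longleftrightarrow> P x"
  by (rule mem_zset) (use separation_set[OF assms(1), of a] assms(2) in blast)

lemma definable_subset_of [definable_intros]:
  "definable_term S \<Longrightarrow> definable_term T \<Longrightarrow> definable (\<lambda>e. S e \<^bold>\<subseteq> T e)"
  unfolding subset_of_def by (intro definable_intros definable_term_shift)

lemma not_mem_emptyset [simp]: "x \<^bold>\<notin> emptyset"
proof -
  obtain w :: 'a where "\<forall>x. x \<^bold>\<notin> w" using infinity by blast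
  then have "x \<^bold>\<in> emptyset \<longleftrightarrow> False" unfolding emptyset_def by (intro mem_zset) blast
  then show ?thesis by simp
qed

lemma nonempty_ex: "a \<noteq> emptyset \<longleftrightarrow> (\<exists>x. x \<^bold>\<in> a)"
  using extensionality[of a emptyset] by auto

lemma mem_upair [simp]: "x \<^bold>\<in> upair a b \<longleftrightarrow> x = a \<or> x = b"
  unfolding upair_def by (rule mem_zset) (rule pairing)

lemma upair_eq_iff: "upair a b = upair c d \<longleftrightarrow> (a = c \<and> b = d) \<or> (a = d \<and> b = c)"
proof
  assume "upair a b = upair c d"
  then have "\<And>x. x = a \<or> x = b \<longleftrightarrow> x = c \<or> x = d" by (metis mem_upair)
  then show "(a = c \<and> b = d) \<or> (a = d \<and> b = c)" by metis
next
  assume "(a = c \<and> b = d) \<or> (a = d \<and> b = c)"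
  then show "upair a b = upair c d" by (auto intro: extensionality)
qed

lemma pair_inject [simp]: "pair a b = pair c d \<longleftrightarrow> a = c \<and> b = d"
  unfolding pair_def by (auto simp: upair_eq_iff)

lemma definable_upair [definable_intros]:
  assumes "definable_term S" "definable_term T" shows "definable_term (\<lambda>e. upair (S e) (T e))"
  unfolding upair_def
  by (rule definable_zset, intro definable_intros assms definable_term_shift, rule pairing)

lemma definable_pair [definable_intros]:
  "definable_term S \<Longrightarrow> definable_term T \<Longrightarrow> definable_term (\<lambda>e. pair (S e) (T e))"
  unfolding pair_def by (intro definable_intros)

lemma fst_of_pair [simp]: "fst_of (pair a b) = a"
  unfolding fst_of_def by auto

lemma snd_of_pair [simp]: "snd_of (pair a b) = b"
  unfolding snd_of_def by auto

lemma definable_fst_of [definable_intros]: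
  assumes "definable_term S" shows "definable_term (\<lambda>e. fst_of (S e))"
  unfolding fst_of_def
  by (rule definable_the, intro definable_intros assms definable_term_shift, auto)

lemma definable_snd_of [definable_intros]:
  assumes "definable_term S" shows "definable_term (\<lambda>e. snd_of (S e))"
  unfolding snd_of_def
  by (rule definable_the, intro definable_intros assms definable_term_shift, auto)

lemma ex_union: "\<exists>c. \<forall>x. x \<^bold>\<in> c \<longleftrightarrow> x \<^bold>\<in> a \<or> x \<^bold>\<in> b"
  using union[of "upair a b"] by (metis mem_upair)

lemma mem_succ [simp]: "x \<^bold>\<in> succ m \<longleftrightarrow> x \<^bold>\<in> m \<or> x = m"
  unfolding succ_def by (rule mem_zset) (use ex_union[of m "upair m m"] in simp)

lemma definable_succ [definable_intros]:
  assumes "definable_term S" shows "definable_term (\<lambda>e. succ (S e))"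
  unfolding succ_def
proof (rule definable_zset)
  show "\<exists>a. \<forall>x. x \<^bold>\<in> a \<longleftrightarrow> x \<^bold>\<in> S e \<or> x = S e" for e
    using ex_union[of "S e" "upair (S e) (S e)"] by simp
qed (intro definable_intros assms definable_term_shift)

lemma mem_Pow_of [simp]: "x \<^bold>\<in> Pow_of a \<longleftrightarrow> x \<^bold>\<subseteq> a"
  unfolding Pow_of_def by (rule mem_zset) (use power_set[of a] in \<open>simp add: subset_of_def\<close>)

lemma mem_diff [simp]: "x \<^bold>\<in> diff a b \<longleftrightarrow> x \<^bold>\<in> a \<and> x \<^bold>\<notin> b"
  unfolding diff_def by (rule mem_zset_sub[where a = a]) (intro definable_intros, blast)

lemma mem_prod_of: "p \<^bold>\<in> prod_of a b \<longleftrightarrow> (\<exists>x\<^bold>\<in>a. \<exists>y\<^bold>\<in>b. p = pair x y)"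
proof -
  obtain c where c: "\<forall>x. x \<^bold>\<in> c \<longleftrightarrow> x \<^bold>\<in> a \<or> x \<^bold>\<in> b" using ex_union by blast
  show ?thesis
    unfolding prod_of_def
  proof (rule mem_zset_sub)
    fix p assume "\<exists>x\<^bold>\<in>a. \<exists>y\<^bold>\<in>b. p = pair x y"
    then obtain x y where "x \<^bold>\<in> c" "y \<^bold>\<in> c" "p = pair x y" using c by blast
    then show "p \<^bold>\<in> Pow_of (Pow_of c)" by (auto simp: pair_def subset_of_def)
  qed (intro definable_intros)
qed

lemma pair_mem_prod_of [simp]: "pair x y \<^bold>\<in> prod_of a b \<longleftrightarrow> x \<^bold>\<in> a \<and> y \<^bold>\<in> b"
  by (simp add: mem_prod_of)

lemma mem_funs: "f \<^bold>\<in> funs a b \<longleftrightarrow> f \<^bold>\<subseteq> prod_of a b \<and> (\<forall>x\<^bold>\<in>a. \<exists>!y. pair x y \<^bold>\<in> f)"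
  unfolding funs_def by (rule mem_zset_sub[where a = "Pow_of (prod_of a b)"]) (intro definable_intros, simp)

lemma funs_pair_mem: 
  assumes "f \<^bold>\<in> funs a b" "pair x y \<^bold>\<in> f" shows "x \<^bold>\<in> a" "y \<^bold>\<in> b"
  using assms by (auto simp: mem_funs subset_of_def)

lemma funs_unique:
  assumes "f \<^bold>\<in> funs a b" "pair x y \<^bold>\<in> f" "pair x z \<^bold>\<in> f" shows "y = z"
  using assms funs_pair_mem[OF assms(1,2)] by (auto simp: mem_funs)

lemma app_eq:
  assumes "f \<^bold>\<in> funs a b" "pair x y \<^bold>\<in> f" shows "f \<^bold>\<cdot> x = y"
  unfolding app_def using assms funs_unique by blast

lemma pair_app_mem:
  assumes "f \<^bold>\<in> funs a b" "x \<^bold>\<in> a" shows "pair x (f \<^bold>\<cdot> x) \<^bold>\<in> f"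
proof -
  obtain y where "pair x y \<^bold>\<in> f" using assms by (auto simp: mem_funs)
  with app_eq[OF assms(1) this] show ?thesis by simp
qed

lemma pair_mem_iff_app:
  assumes "f \<^bold>\<in> funs a b" shows "pair x y \<^bold>\<in> f \<longleftrightarrow> x \<^bold>\<in> a \<and> y = f \<^bold>\<cdot> x"
  using assms app_eq pair_app_mem funs_pair_mem by metis

lemma app_mem: "f \<^bold>\<in> funs a b \<Longrightarrow> x \<^bold>\<in> a \<Longrightarrow> f \<^bold>\<cdot> x \<^bold>\<in> b"
  using pair_app_mem funs_pair_mem by blast

text \<open>
  Application is a description and hence a definable term only where the value is unique.
\<close>

lemma definable_app:
  assumes "definable_term S" "definable_term T" "\<And>e y z. pair (T e) y \<^bold>\<in> S e \<Longrightarrow> pair (T e) z \<^bold>\<in> S e \<Longrightarrow> y = z"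
  shows "definable_term (\<lambda>e. S e \<^bold>\<cdot> T e)"
  unfolding app_def
  by (rule definable_the, intro definable_intros assms(1,2) definable_term_shift, fact assms(3))

lemma definable_app_const:
  assumes "f \<^bold>\<in> funs a b" "definable_term T"
  shows "definable_term (\<lambda>e. f \<^bold>\<cdot> T e)"
  by (intro definable_app definable_const assms(2)) (rule funs_unique[OF assms(1)])

text \<open>
  The graph of the restriction of \<open>F\<close> to \<open>a\<close>: this turns a definable function of HOL into a function
  belonging to the model.
\<close>

definition lam :: "'v::zf \<Rightarrow> ('v \<Rightarrow> 'v) \<Rightarrow> 'v" where
  "lam a F = zset (\<lambda>p. \<exists>x\<^bold>\<in>a. p = pair x (F x))"

lemma
  assumes F: "definable_term (\<lambda>e. F (e 0))" and b: "\<And>x. x \<^bold>\<in> a \<Longrightarrow> F x \<^bold>\<in> b"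
  shows lam_mem_funs: "lam a F \<^bold>\<in> funs a b"
    and app_lam: "x \<^bold>\<in> a \<Longrightarrow> lam a F \<^bold>\<cdot> x = F x"
proof -
  have m: "p \<^bold>\<in> lam a F \<longleftrightarrow> (\<exists>x\<^bold>\<in>a. p = pair x (F x))" for p
    unfolding lam_def
  proof (rule mem_zset_sub)
    show "\<exists>x\<^bold>\<in>a. p = pair x (F x) \<Longrightarrow> p \<^bold>\<in> prod_of a b" for p using b by auto
  qed (intro definable_intros definable_term_inst1[OF F])
  show 1: "lam a F \<^bold>\<in> funs a b"
    using b by (auto simp: mem_funs subset_of_def m)
  show "x \<^bold>\<in> a \<Longrightarrow> lam a F \<^bold>\<cdot> x = F x"
    by (rule app_eq[OF 1]) (auto simp: m)
qed

section \<open>Natural numbers\<close>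

lemma mem_omega: "m \<^bold>\<in> omega \<longleftrightarrow> (\<forall>w. emptyset \<^bold>\<in> w \<and> (\<forall>x\<^bold>\<in>w. succ x \<^bold>\<in> w) \<longrightarrow> m \<^bold>\<in> w)"
proof -
  obtain w z :: 'a where w: "z \<^bold>\<in> w" "\<forall>x. x \<^bold>\<notin> z"
      "\<forall>x. x \<^bold>\<in> w \<longrightarrow> (\<exists>y. y \<^bold>\<in> w \<and> (\<forall>u. u \<^bold>\<in> y \<longleftrightarrow> u \<^bold>\<in> x \<or> u = x))"
    using infinity by blast
  have "z = emptyset" using w(2) nonempty_ex by blast
  moreover have "succ x \<^bold>\<in> w" if "x \<^bold>\<in> w" for x
  proof -
    obtain y where "y \<^bold>\<in> w" "\<forall>u. u \<^bold>\<in> y \<longleftrightarrow> u \<^bold>\<in> x \<or> u = x" using w(3) \<open>x \<^bold>\<in> w\<close> by blast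
    then have "y = succ x" using extensionality[of y "succ x"] by simp
    then show ?thesis using \<open>y \<^bold>\<in> w\<close> by simp
  qed
  ultimately have "emptyset \<^bold>\<in> w \<and> (\<forall>x\<^bold>\<in>w. succ x \<^bold>\<in> w)" using w(1) by blast
  then show ?thesis
    unfolding omega_def by (intro mem_zset_sub[where a = w]) (intro definable_intros, blast)
qed

lemma emptyset_mem_omega [simp]: "emptyset \<^bold>\<in> omega"
  by (simp add: mem_omega)

lemma succ_mem_omega [simp]: "m \<^bold>\<in> omega \<Longrightarrow> succ m \<^bold>\<in> omega"
  by (simp add: mem_omega)

text \<open>
  There may be nonstandard natural numbers in the model, so induction is restricted to definable
  predicates.
\<close>

lemma omega_induct:
  assumes "m \<^bold>\<in> omega" "definable (\<lambda>e. P (e 0))"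
    and "P emptyset" "\<And>m. m \<^bold>\<in> omega \<Longrightarrow> P m \<Longrightarrow> P (succ m)"
  shows "P m"
proof -
  obtain w where w: "\<forall>x. x \<^bold>\<in> w \<longleftrightarrow> x \<^bold>\<in> omega \<and> P x"
    using separation_set[OF assms(2)] by blast
  have "emptyset \<^bold>\<in> w \<and> (\<forall>x\<^bold>\<in>w. succ x \<^bold>\<in> w)"
    using w assms(3,4) by simp
  then show ?thesis using assms(1) w mem_omega by blast
qed

lemma omega_cases:
  assumes "m \<^bold>\<in> omega" obtains "m = emptyset" | k where "k \<^bold>\<in> omega" "m = succ k"
proof -
  have "m = emptyset \<or> (\<exists>k\<^bold>\<in>omega. m = succ k)"
    by (rule omega_induct[OF assms]) (intro definable_intros, auto)
  then show ?thesis using that by blast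
qed

lemma succ_nonempty [simp]: "succ m \<noteq> emptyset" "emptyset \<noteq> succ m"
  using mem_succ[of m m] not_mem_emptyset[of m] by metis+

lemma mem_omega_trans:
  assumes "m \<^bold>\<in> omega" shows "x \<^bold>\<in> m \<Longrightarrow> x \<^bold>\<in> omega \<and> x \<^bold>\<subseteq> m"
proof -
  have "\<forall>x. x \<^bold>\<in> m \<longrightarrow> x \<^bold>\<in> omega \<and> x \<^bold>\<subseteq> m"
    by (rule omega_induct[OF assms]) (intro definable_intros, auto simp: subset_of_def)
  then show "x \<^bold>\<in> m \<Longrightarrow> x \<^bold>\<in> omega \<and> x \<^bold>\<subseteq> m" by blast
qed

lemma mem_irrefl [simp]: "m \<^bold>\<notin> m"
  using foundation[of m "upair m m"] by auto

lemma mem_asym: "x \<^bold>\<in> y \<Longrightarrow> y \<^bold>\<notin> x"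
  using foundation[of x "upair x y"] by auto

lemma succ_inject [simp]: "succ m = succ k \<longleftrightarrow> m = k"
  using mem_succ[of m m] mem_succ[of m k] mem_succ[of k m] mem_succ[of k k] mem_asym by metis

lemma mem_succ_mono:
  assumes "n \<^bold>\<in> omega" shows "l \<^bold>\<in> n \<Longrightarrow> succ l \<^bold>\<in> succ n"
proof -
  have "\<forall>l\<^bold>\<in>n. succ l \<^bold>\<in> succ n"
    by (rule omega_induct[OF assms]) (intro definable_intros, auto)
  then show "l \<^bold>\<in> n \<Longrightarrow> succ l \<^bold>\<in> succ n" by blast
qed

lemma mem_succ_succD:
  assumes "n \<^bold>\<in> omega" "succ l \<^bold>\<in> succ n" shows "l \<^bold>\<in> n"
  using assms(2) mem_omega_trans[OF assms(1), of "succ l"] mem_succ[of l l]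
  by (auto simp: subset_of_def)

lemma emptyset_mem_succ [simp]:
  assumes "n \<^bold>\<in> omega" shows "emptyset \<^bold>\<in> succ n"
  by (rule omega_induct[OF assms]) (intro definable_intros, auto)

lemma subset_refl [simp]: "m \<^bold>\<subseteq> m" by (simp add: subset_of_def)

lemma subset_succ_iff:
  assumes "N \<^bold>\<in> omega" "m \<^bold>\<in> omega" shows "N \<^bold>\<subseteq> succ m \<longleftrightarrow> N \<^bold>\<subseteq> m \<or> N = succ m"
proof -
  have "N = succ m" if "N \<^bold>\<subseteq> succ m" "m \<^bold>\<in> N"
  proof (rule extensionality)
    show "x \<^bold>\<in> N \<longleftrightarrow> x \<^bold>\<in> succ m" for x
      using that mem_omega_trans[OF assms(1) \<open>m \<^bold>\<in> N\<close>] by (auto simp: subset_of_def)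
  qed
  then show ?thesis by (auto simp: subset_of_def)
qed

lemma subset_linear:
  assumes "N \<^bold>\<in> omega" "m \<^bold>\<in> omega" shows "N \<^bold>\<subseteq> m \<or> m \<^bold>\<subseteq> N"
proof -
  have "N \<^bold>\<subseteq> m \<or> m \<^bold>\<in> N"
  proof (rule omega_induct[OF assms(2)])
    show "N \<^bold>\<subseteq> emptyset \<or> emptyset \<^bold>\<in> N"
      using omega_cases[OF assms(1)] emptyset_mem_succ subset_refl by metis
    fix m assume m: "m \<^bold>\<in> omega" "N \<^bold>\<subseteq> m \<or> m \<^bold>\<in> N"
    have "succ m \<^bold>\<in> N \<or> succ m = N" if "m \<^bold>\<in> N"
      using that by (rule_tac omega_cases[OF assms(1)]) (use mem_succ_mono in \<open>force\<close>)+
    then show "N \<^bold>\<subseteq> succ m \<or> succ m \<^bold>\<in> N"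
      using m by (auto simp: subset_of_def)
  qed (intro definable_intros)
  then show ?thesis using mem_omega_trans[OF assms(1)] by blast
qed

lemma subset_trans: "k \<^bold>\<subseteq> m \<Longrightarrow> m \<^bold>\<subseteq> n \<Longrightarrow> k \<^bold>\<subseteq> n" by (simp add: subset_of_def)

lemma omega_upper_bound:
  assumes "N \<^bold>\<in> omega" "M \<^bold>\<in> omega"
  obtains K where "K \<^bold>\<in> omega" "N \<^bold>\<subseteq> K" "M \<^bold>\<subseteq> K"
  using subset_linear[OF assms] assms subset_refl by blast

section \<open>The real line as a linearly ordered field\<close>

lemma
  shows rplus_funs: "rplus \<^bold>\<in> funs (prod_of Reals Reals) (Reals::'v::zf_reals)"
    and rtimes_funs: "rtimes \<^bold>\<in> funs (prod_of Reals Reals) (Reals::'v)"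
    and rzero_mem: "rzero \<^bold>\<in> (Reals::'v)" and rone_mem: "rone \<^bold>\<in> (Reals::'v)"
    and rzero_neq_rone: "rzero \<noteq> (rone::'v)"
    and radd_assoc: "\<forall>x\<^bold>\<in>Reals. \<forall>y\<^bold>\<in>Reals. \<forall>w\<^bold>\<in>Reals. (x \<^bold>+ y) \<^bold>+ w = x \<^bold>+ (y \<^bold>+ (w::'v))"
    and radd_commute: "\<forall>x\<^bold>\<in>Reals. \<forall>y\<^bold>\<in>Reals. x \<^bold>+ y = y \<^bold>+ (x::'v)"
    and radd_zero: "\<forall>x\<^bold>\<in>Reals. x \<^bold>+ \<^bold>0 = (x::'v)"
    and radd_inverse: "\<forall>x\<^bold>\<in>Reals. \<exists>y\<^bold>\<in>Reals. x \<^bold>+ y = (\<^bold>0::'v)"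
    and rmult_assoc: "\<forall>x\<^bold>\<in>Reals. \<forall>y\<^bold>\<in>Reals. \<forall>w\<^bold>\<in>Reals. (x \<^bold>* y) \<^bold>* w = x \<^bold>* (y \<^bold>* (w::'v))"
    and rmult_commute: "\<forall>x\<^bold>\<in>Reals. \<forall>y\<^bold>\<in>Reals. x \<^bold>* y = y \<^bold>* (x::'v)"
    and rmult_one: "\<forall>x\<^bold>\<in>Reals. x \<^bold>* \<^bold>1 = (x::'v)"
    and rmult_inverse: "\<forall>x\<^bold>\<in>Reals. x \<noteq> \<^bold>0 \<longrightarrow> (\<exists>y\<^bold>\<in>Reals. x \<^bold>* y = (\<^bold>1::'v))"
    and rmult_distrib: "\<forall>x\<^bold>\<in>Reals. \<forall>y\<^bold>\<in>Reals. \<forall>w\<^bold>\<in>Reals. x \<^bold>* (y \<^bold>+ w) = x \<^bold>* y \<^bold>+ x \<^bold>* (w::'v)"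
    and rle_refl: "\<forall>x\<^bold>\<in>Reals. x \<^bold>\<le> (x::'v)"
    and rle_trans: "\<forall>x\<^bold>\<in>Reals. \<forall>y\<^bold>\<in>Reals. \<forall>w\<^bold>\<in>Reals. x \<^bold>\<le> y \<and> y \<^bold>\<le> w \<longrightarrow> x \<^bold>\<le> (w::'v)"
    and rle_antisym: "\<forall>x\<^bold>\<in>Reals. \<forall>y\<^bold>\<in>Reals. x \<^bold>\<le> y \<and> y \<^bold>\<le> x \<longrightarrow> x = (y::'v)"
    and rle_linear: "\<forall>x\<^bold>\<in>Reals. \<forall>y\<^bold>\<in>Reals. x \<^bold>\<le> y \<or> y \<^bold>\<le> (x::'v)"
    and radd_mono: "\<forall>x\<^bold>\<in>Reals. \<forall>y\<^bold>\<in>Reals. \<forall>w\<^bold>\<in>Reals. x \<^bold>\<le> y \<longrightarrow> x \<^bold>+ w \<^bold>\<le> y \<^bold>+ (w::'v)"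
    and rmult_nonneg: "\<forall>x\<^bold>\<in>Reals. \<forall>y\<^bold>\<in>Reals. \<^bold>0 \<^bold>\<le> x \<and> \<^bold>0 \<^bold>\<le> y \<longrightarrow> \<^bold>0 \<^bold>\<le> x \<^bold>* (y::'v)"
    and Reals_complete: "\<forall>S. S \<^bold>\<subseteq> Reals \<and> S \<noteq> emptyset \<and> (\<exists>b\<^bold>\<in>Reals. \<forall>x\<^bold>\<in>S. x \<^bold>\<le> b) \<longrightarrow>
        (\<exists>b\<^bold>\<in>Reals. (\<forall>x\<^bold>\<in>S. x \<^bold>\<le> b) \<and> (\<forall>c\<^bold>\<in>Reals. (\<forall>x\<^bold>\<in>S. x \<^bold>\<le> c) \<longrightarrow> b \<^bold>\<le> (c::'v)))"
  unfolding radd_def rmult_def rless_eq_def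
  by (insert complete_ordered_field[where ?'a = 'v, unfolded complete_ordered_field_def Let_def],
      elim conjE, assumption)+

typedef (overloaded) 'v mreal = "{x::'v::zf_reals. x \<^bold>\<in> Reals}"
  using rzero_mem by auto

lemma Rep_mem [simp]: "Rep_mreal x \<^bold>\<in> Reals"
  using Rep_mreal[of x] by simp

lemma Rep_Abs [simp]: "x \<^bold>\<in> Reals \<Longrightarrow> Rep_mreal (Abs_mreal x) = x"
  by (simp add: Abs_mreal_inverse)

lemma Rep_eq [simp]: "Rep_mreal x = Rep_mreal y \<longleftrightarrow> x = y"
  by (simp add: Rep_mreal_inject)

lemma mreal_cases: "x \<^bold>\<in> Reals \<Longrightarrow> (\<And>y. x = Rep_mreal y \<Longrightarrow> thesis) \<Longrightarrow> thesis"
  using Rep_Abs by metis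

instantiation mreal :: (zf_reals) "{zero, one, plus, minus, uminus, times, inverse, ord, abs, sgn}"
begin

definition "0 = Abs_mreal rzero"
definition "1 = Abs_mreal rone"
definition "x + y = Abs_mreal (Rep_mreal x \<^bold>+ Rep_mreal y)"
definition "x * y = Abs_mreal (Rep_mreal x \<^bold>* Rep_mreal y)"
definition "- x = (SOME y :: 'a mreal. x + y = 0)"
definition "x - y = x + - (y :: 'a mreal)"
definition "inverse x = (if x = 0 then 0 else SOME y :: 'a mreal. x * y = 1)"
definition "x div y = x * inverse (y :: 'a mreal)"
definition "x \<le> y \<longleftrightarrow> Rep_mreal x \<^bold>\<le> Rep_mreal y"
definition "x < y \<longleftrightarrow> x \<le> y \<and> x \<noteq> (y :: 'a mreal)"
definition "\<bar>x\<bar> = (if x < 0 then - x else x :: 'a mreal)"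
definition "sgn x = (if x = 0 then 0 else if 0 < x then 1 else - 1 :: 'a mreal)"

instance ..

end

lemma
  fixes x y :: "'v::zf_reals"
  assumes "x \<^bold>\<in> Reals" "y \<^bold>\<in> Reals"
  shows radd_mem: "x \<^bold>+ y \<^bold>\<in> Reals" and rmult_mem: "x \<^bold>* y \<^bold>\<in> Reals"
  using assms by (simp_all add: radd_def rmult_def app_mem[OF rplus_funs] app_mem[OF rtimes_funs])

lemma Rep_zero: "Rep_mreal 0 = rzero" and Rep_one: "Rep_mreal 1 = rone"
  by (simp_all add: zero_mreal_def one_mreal_def rzero_mem rone_mem)

lemma Rep_add: "Rep_mreal (x + y) = Rep_mreal x \<^bold>+ Rep_mreal y"
  by (simp add: plus_mreal_def radd_mem)

lemma Rep_mult: "Rep_mreal (x * y) = Rep_mreal x \<^bold>* Rep_mreal y"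
  by (simp add: times_mreal_def rmult_mem)

lemma Rep_less_eq: "x \<le> y \<longleftrightarrow> Rep_mreal x \<^bold>\<le> Rep_mreal y"
  by (rule less_eq_mreal_def)

instance mreal :: (zf_reals) field
proof
  fix x y z :: "'a mreal"
  note t = Rep_eq[symmetric] Rep_zero Rep_one Rep_add Rep_mult
  show "x + y + z = x + (y + z)"
    unfolding t using radd_assoc Rep_mem by blast
  show add_comm: "x + y = y + x" for x y :: "'a mreal"
    unfolding t using radd_commute Rep_mem by blast
  have "x + 0 = x"
    unfolding t using radd_zero Rep_mem by blast
  then show "0 + x = x"
    by (simp add: add_comm[of 0])
  show "x * y * z = x * (y * z)"
    unfolding t using rmult_assoc Rep_mem by blast
  show mult_comm: "x * y = y * x" for x y :: "'a mreal"
    unfolding t using rmult_commute Rep_mem by blast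
  have "x * 1 = x"
    unfolding t using rmult_one Rep_mem by blast
  then show "1 * x = x"
    by (simp add: mult_comm[of 1])
  show "(0::'a mreal) \<noteq> 1" unfolding t by (rule rzero_neq_rone)
  have "x * (y + z) = x * y + x * z" for x y z :: "'a mreal"
    unfolding t using rmult_distrib Rep_mem by blast
  then show "(x + y) * z = x * z + y * z" by (simp add: mult_comm)
  have "\<exists>y. x + y = 0" for x :: "'a mreal"
    unfolding t using radd_inverse[rule_format, OF Rep_mem[of x]] Rep_Abs by metis
  from someI_ex[OF this] have "x + - x = 0"
    unfolding uminus_mreal_def by blast
  then show "- x + x = 0" by (simp add: add_comm)
  show "x - y = x + - y" by (simp add: minus_mreal_def)
  have "\<exists>y. x * y = 1" if "x \<noteq> 0"
    using that rmult_inverse[rule_format, OF Rep_mem[of x]] Rep_Abs unfolding t by metis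
  from someI_ex[OF this] have "x \<noteq> 0 \<Longrightarrow> x * inverse x = 1"
    unfolding inverse_mreal_def by simp
  then show "x \<noteq> 0 \<Longrightarrow> inverse x * x = 1" by (simp add: mult_comm)
  show "x div y = x * inverse y" by (simp add: divide_mreal_def)
  show "inverse (0::'a mreal) = 0" by (simp add: inverse_mreal_def)
qed

instance mreal :: (zf_reals) linordered_field
proof
  fix x y z :: "'a mreal"
  note t = Rep_eq[symmetric] Rep_zero Rep_one Rep_add Rep_mult Rep_less_eq
  show refl: "x \<le> x" for x :: "'a mreal" unfolding t using rle_refl Rep_mem by blast
  show "x \<le> y \<Longrightarrow> y \<le> z \<Longrightarrow> x \<le> z" unfolding t using rle_trans Rep_mem by blast
  show antisym: "x \<le> y \<Longrightarrow> y \<le> x \<Longrightarrow> x = y" for x y :: "'a mreal"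
    unfolding t using rle_antisym Rep_mem by blast
  show "x \<le> y \<or> y \<le> x" unfolding t using rle_linear Rep_mem by blast
  show "x < y \<longleftrightarrow> x \<le> y \<and> \<not> y \<le> x"
    unfolding less_mreal_def using antisym refl by blast
  have mono: "x \<le> y \<Longrightarrow> x + z \<le> y + z" for x y z :: "'a mreal"
    unfolding t using radd_mono Rep_mem by blast
  then show "x \<le> y \<Longrightarrow> z + x \<le> z + y" by (simp add: add.commute)
  have nonneg: "0 \<le> x \<Longrightarrow> 0 \<le> y \<Longrightarrow> 0 \<le> x * y" for x y :: "'a mreal"
    unfolding t using rmult_nonneg Rep_mem by blast
  show "\<bar>x\<bar> = (if x < 0 then - x else x)" by (simp add: abs_mreal_def)
  show "sgn x = (if x = 0 then 0 else if 0 < x then 1 else - 1)" by (simp add: sgn_mreal_def)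
  show "z * x < z * y" if "x < y" "0 < z"
  proof -
    have "0 \<le> y - x" using mono[of x y "- x"] that(1) by (simp add: less_mreal_def)
    then have "0 \<le> z * y - z * x" 
      using nonneg[of z "y - x"] that(2) by (simp add: less_mreal_def right_diff_distrib)
    from mono[OF this, of "z * x"] have "z * x \<le> z * y" by simp
    then show ?thesis using that by (simp add: less_mreal_def)
  qed
qed

lemma Rep_less: "x < y \<longleftrightarrow> Rep_mreal x \<^bold>< Rep_mreal y"
  by (simp add: less_mreal_def rless_def Rep_less_eq)

lemma Rep_diff: "Rep_mreal x \<^bold>- Rep_mreal y = Rep_mreal (x - y)"
  unfolding rminus_def
proof (rule the_equality)
  fix z assume z: "z \<^bold>\<in> Reals \<and> Rep_mreal y \<^bold>+ z = Rep_mreal x"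
  then obtain w where "z = Rep_mreal w" using mreal_cases by blast
  with z show "z = Rep_mreal (x - y)" by (auto simp: Rep_add[symmetric])
qed (simp add: Rep_add[symmetric])

lemma Rep_divide: "y \<noteq> 0 \<Longrightarrow> Rep_mreal x \<^bold>/ Rep_mreal y = Rep_mreal (x / y)"
  unfolding rdivide_def
proof (rule the_equality)
  fix z assume y: "y \<noteq> 0" and z: "z \<^bold>\<in> Reals \<and> Rep_mreal y \<^bold>* z = Rep_mreal x"
  then obtain w where "z = Rep_mreal w" using mreal_cases by blast
  with y z show "z = Rep_mreal (x / y)" by (auto simp: Rep_mult[symmetric])
qed (simp add: Rep_mult[symmetric])

lemma Rep_abs: "rabs (Rep_mreal x) = Rep_mreal \<bar>x\<bar>"
  by (auto simp: rabs_def Rep_less_eq[symmetric] Rep_diff Rep_zero[symmetric])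

section \<open>Definability of real-valued terms\<close>

text \<open>
  A total inverse of \<^const>\<open>Rep_mreal\<close>, with value \<open>0\<close> outside the reals.  Being total and definable, it
  allows quantifiers over \<open>mreal\<close> to be replaced by quantifiers over the universe.
\<close>

definition mr :: "'v::zf_reals \<Rightarrow> 'v mreal" where
  "mr x = (if x \<^bold>\<in> Reals then Abs_mreal x else 0)"

lemma mr_Rep [simp]: "mr (Rep_mreal x) = x"
  by (simp add: mr_def Rep_mreal_inverse)

lemma Rep_mr: "Rep_mreal (mr x) = (if x \<^bold>\<in> Reals then x else rzero)"
  by (simp add: mr_def Rep_zero)

lemma ex_mr: "(\<exists>x. P x) \<longleftrightarrow> (\<exists>y. P (mr y))"
  using mr_Rep by metis

definition definable_real :: "((nat \<Rightarrow> 'v::zf_reals) \<Rightarrow> 'v mreal) \<Rightarrow> bool" where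
  "definable_real T \<longleftrightarrow> definable_term (\<lambda>e. Rep_mreal (T e))"

lemma definable_Rep [definable_intros]:
  "definable_real T \<Longrightarrow> definable_term (\<lambda>e. Rep_mreal (T e))"
  by (simp add: definable_real_def)

lemma definable_mr [definable_intros]:
  "definable_term T \<Longrightarrow> definable_real (\<lambda>e. mr (T e))"
  unfolding definable_real_def Rep_mr by (intro definable_intros)

lemma definable_real_const [definable_intros]: "definable_real (\<lambda>e. c)"
  unfolding definable_real_def by (intro definable_intros)

lemma definable_real_shift:
  "definable_real T \<Longrightarrow> definable_real (\<lambda>e. T (\<lambda>i. e (Suc i)))"
  unfolding definable_real_def by (rule definable_term_shift)

lemma definable_real_add [definable_intros]:
  "definable_real S \<Longrightarrow> definable_real T \<Longrightarrow> definable_real (\<lambda>e. S e + T e)"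
  unfolding definable_real_def Rep_add radd_def
  by (rule definable_app_const[OF rplus_funs]) (rule definable_pair)

lemma definable_real_mult [definable_intros]:
  "definable_real S \<Longrightarrow> definable_real T \<Longrightarrow> definable_real (\<lambda>e. S e * T e)"
  unfolding definable_real_def Rep_mult rmult_def
  by (rule definable_app_const[OF rtimes_funs]) (rule definable_pair)

lemma definable_real_le [definable_intros]:
  "definable_real S \<Longrightarrow> definable_real T \<Longrightarrow> definable (\<lambda>e. S e \<le> T e)"
  unfolding Rep_less_eq rless_eq_def by (intro definable_intros)

lemma definable_real_eq [definable_intros]:
  "definable_real S \<Longrightarrow> definable_real T \<Longrightarrow> definable (\<lambda>e. S e = T e)"
  unfolding Rep_eq[symmetric] by (intro definable_intros)

lemma definable_real_less [definable_intros]: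
  "definable_real S \<Longrightarrow> definable_real T \<Longrightarrow> definable (\<lambda>e. S e < T e)"
  unfolding less_mreal_def by (intro definable_intros)

lemma definable_real_if [definable_intros]:
  "definable P \<Longrightarrow> definable_real S \<Longrightarrow> definable_real T \<Longrightarrow>
    definable_real (\<lambda>e. if P e then S e else T e)"
  unfolding definable_real_def if_distrib[of Rep_mreal] by (rule definable_if)

lemma definable_real_ex [definable_intros]:
  "definable (\<lambda>e. Q (\<lambda>i. e (Suc i)) (mr (e 0))) \<Longrightarrow> definable (\<lambda>e. \<exists>x. Q e x)"
  unfolding ex_mr[of "Q _"] by (rule definable_ex)

lemma definable_real_all [definable_intros]:
  assumes "definable (\<lambda>e. Q (\<lambda>i. e (Suc i)) (mr (e 0)))" shows "definable (\<lambda>e. \<forall>x. Q e x)"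
proof -
  have "(\<forall>x. Q e x) \<longleftrightarrow> \<not> (\<exists>x. \<not> Q e x)" for e by blast
  then show ?thesis
    using definable_not[OF definable_real_ex, of "\<lambda>e x. \<not> Q e x", OF definable_not, OF assms] by simp
qed

lemma definable_real_inst1:
  "definable (\<lambda>e. R (mr (e 0))) \<Longrightarrow> definable_real S \<Longrightarrow> definable (\<lambda>e. R (S e))"
  using definable_inst1[of "\<lambda>x. R (mr x)" "\<lambda>e. Rep_mreal (S e)"] by (simp add: definable_real_def)

text \<open>
  An operation of the field is definable as soon as its graph has a definition in terms of
  operations already known to be definable; this yields subtraction and division.
\<close>

lemma definable_real_graph:
  fixes T :: "(nat \<Rightarrow> 'v::zf_reals) \<Rightarrow> 'v mreal"
  assumes "definable (\<lambda>e. mr (e 0) = T (\<lambda>i. e (Suc i)))" shows "definable_real T"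
proof -
  have "definable (\<lambda>e. e 0 \<^bold>\<in> Reals \<and> mr (e 0) = T (\<lambda>i. e (Suc i)))"
    by (intro definable_intros assms)
  moreover have "x \<^bold>\<in> Reals \<and> mr x = y \<longleftrightarrow> x = Rep_mreal y" for x :: 'v and y
    by (auto simp: mr_def Rep_mreal_inverse)
  ultimately show ?thesis by (simp only: definable_real_def definable_term_def)
qed

lemma definable_real_diff [definable_intros]:
  assumes "definable_real S" "definable_real T" shows "definable_real (\<lambda>e. S e - T e)"
proof (rule definable_real_graph)
  have "definable (\<lambda>e. mr (e 0) + T (\<lambda>i. e (Suc i)) = S (\<lambda>i. e (Suc i)))"
    by (intro definable_intros definable_real_shift assms)
  then show "definable (\<lambda>e. mr (e 0) = S (\<lambda>i. e (Suc i)) - T (\<lambda>i. e (Suc i)))"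
    by (simp add: eq_diff_eq)
qed

lemma definable_real_abs [definable_intros]:
  assumes "definable_real T" shows "definable_real (\<lambda>e. \<bar>T e\<bar>)"
proof -
  have "definable_real (\<lambda>e. if T e < 0 then 0 - T e else T e)"
    by (intro definable_intros assms)
  moreover have "(\<lambda>e. \<bar>T e\<bar>) = (\<lambda>e. if T e < 0 then 0 - T e else T e)" by (auto simp: abs_if)
  ultimately show ?thesis by simp
qed

lemma definable_real_divide [definable_intros]:
  assumes "definable_real S" "definable_real T" shows "definable_real (\<lambda>e. S e / T e)"
proof (rule definable_real_graph)
  have "definable (\<lambda>e. T (\<lambda>i. e (Suc i)) = 0 \<and> mr (e 0) = 0 \<or>
      T (\<lambda>i. e (Suc i)) \<noteq> 0 \<and> mr (e 0) * T (\<lambda>i. e (Suc i)) = S (\<lambda>i. e (Suc i)))"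
    by (intro definable_intros definable_real_shift assms)
  then show "definable (\<lambda>e. mr (e 0) = S (\<lambda>i. e (Suc i)) / T (\<lambda>i. e (Suc i)))"
    by (rule back_subst[of definable]) (auto simp: fun_eq_iff eq_divide_eq)
qed

lemma definable_real_app1:
  "definable_real (\<lambda>e. F (e 0)) \<Longrightarrow> definable_term T \<Longrightarrow> definable_real (\<lambda>e. F (T e))"
  unfolding definable_real_def by (rule definable_term_inst1)

section \<open>Suprema, infima and square roots\<close>

text \<open>
  Only sets of the model have suprema; \<open>P\<close> has to be definable for this reason.
\<close>

lemma mreal_sup:
  fixes P :: "'v::zf_reals mreal \<Rightarrow> bool"
  assumes P: "definable (\<lambda>e. P (mr (e 0)))" and "P a" "\<And>x. P x \<Longrightarrow> x \<le> b"
  obtains c where "\<And>x. P x \<Longrightarrow> x \<le> c" "\<And>d. (\<And>x. P x \<Longrightarrow> x \<le> d) \<Longrightarrow> c \<le> d"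
proof -
  obtain S where S: "\<And>x. x \<^bold>\<in> S \<longleftrightarrow> x \<^bold>\<in> Reals \<and> P (mr x)"
    using separation_set[OF P] by blast
  then have m: "Rep_mreal x \<^bold>\<in> S \<longleftrightarrow> P x" for x by simp
  have "S \<^bold>\<subseteq> Reals" using S by (simp add: subset_of_def)
  moreover have "S \<noteq> emptyset" using m \<open>P a\<close> nonempty_ex by blast
  moreover have upper: "(\<forall>x\<^bold>\<in>S. x \<^bold>\<le> Rep_mreal d) \<longleftrightarrow> (\<forall>x. P x \<longrightarrow> x \<le> d)" for d
    unfolding Rep_less_eq using S m mreal_cases by metis
  then have "\<exists>b\<^bold>\<in>Reals. \<forall>x\<^bold>\<in>S. x \<^bold>\<le> b" using assms(3) Rep_mem by blast
  ultimately obtain c where "c \<^bold>\<in> Reals" "\<forall>x\<^bold>\<in>S. x \<^bold>\<le> c"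
      "\<forall>d\<^bold>\<in>Reals. (\<forall>x\<^bold>\<in>S. x \<^bold>\<le> d) \<longrightarrow> c \<^bold>\<le> d"
    using Reals_complete by blast
  moreover then obtain c' where "c = Rep_mreal c'" using mreal_cases by blast
  ultimately have "\<forall>x. P x \<longrightarrow> x \<le> c'" "\<forall>d. (\<forall>x. P x \<longrightarrow> x \<le> d) \<longrightarrow> c' \<le> d"
    using upper Rep_less_eq Rep_mem by metis+
  then show ?thesis using that by blast
qed

lemma mreal_inf:
  fixes P :: "'v::zf_reals mreal \<Rightarrow> bool"
  assumes P: "definable (\<lambda>e. P (mr (e 0)))" and "P a" "\<And>x. P x \<Longrightarrow> b \<le> x"
  obtains c where "\<And>x. P x \<Longrightarrow> c \<le> x" "\<And>d. (\<And>x. P x \<Longrightarrow> d \<le> x) \<Longrightarrow> d \<le> c"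
proof -
  have "definable (\<lambda>e. P (0 - mr (e 0)))"
    by (intro definable_intros definable_real_inst1[OF P])
  moreover have "P (0 - (- a))" "P (0 - x) \<Longrightarrow> x \<le> - b" for x
    using assms(2) by (simp, use assms(3)[of "- x"] in \<open>simp add: le_minus_iff\<close>) 
  ultimately obtain c where c: "\<And>x. P (0 - x) \<Longrightarrow> x \<le> c" "\<And>d. (\<And>x. P (0 - x) \<Longrightarrow> x \<le> d) \<Longrightarrow> c \<le> d"
    using mreal_sup[of "\<lambda>x. P (0 - x)"] by blast
  show ?thesis
  proof
    show "- c \<le> x" if "P x" for x using c(1)[of "- x"] that by (simp add: minus_le_iff)
    show "d \<le> - c" if "\<And>x. P x \<Longrightarrow> d \<le> x" for d
    proof -
      have "x \<le> - d" if "P (0 - x)" for x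
        using \<open>\<And>x. P x \<Longrightarrow> d \<le> x\<close>[OF that] by simp
      then show ?thesis using c(2)[of "- d"] by simp
    qed
  qed
qed

lemma mreal_sqrt:
  fixes x :: "'v::zf_reals mreal"
  assumes "0 \<le> x" obtains y where "0 \<le> y" "y * y = x"
proof -
  have "definable (\<lambda>e. 0 \<le> mr (e 0) \<and> mr (e 0) * mr (e 0) \<le> x)" by (intro definable_intros)
  moreover have bound: "y \<le> x + 1" if "0 \<le> y \<and> y * y \<le> x" for y
  proof (rule ccontr)
    assume "\<not> y \<le> x + 1"
    then have "y * 1 < y * y" "x + 1 < y" using assms by (auto intro!: mult_strict_left_mono)
    with that show False by simp
  qed
  ultimately obtain c where c: "\<And>y. 0 \<le> y \<and> y * y \<le> x \<Longrightarrow> y \<le> c"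
      "\<And>d. (\<And>y. 0 \<le> y \<and> y * y \<le> x \<Longrightarrow> y \<le> d) \<Longrightarrow> c \<le> d"
    using mreal_sup[of "\<lambda>y. 0 \<le> y \<and> y * y \<le> x" 0 "x + 1"] assms by auto
  have "0 \<le> c" using c(1)[of 0] assms by simp
  moreover have "\<not> c * c < x"
  proof
    assume lt: "c * c < x"
    define h where "h = min 1 ((x - c * c) / (2 * c + 1))"
    have "0 < h" "h \<le> 1" using lt \<open>0 \<le> c\<close> by (simp_all add: h_def)
    have "h * (2 * c + 1) \<le> x - c * c"
      using \<open>0 \<le> c\<close> by (simp add: h_def min_le_iff_disj pos_le_divide_eq[symmetric])
    moreover have "(c + h) * (c + h) \<le> c * c + h * (2 * c + 1)"
      using mult_left_mono[OF \<open>h \<le> 1\<close>, of h] \<open>0 < h\<close> by (simp add: algebra_simps)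
    ultimately have "c + h \<le> c" using c(1)[of "c + h"] \<open>0 < h\<close> \<open>0 \<le> c\<close> by simp
    then show False using \<open>0 < h\<close> by simp
  qed
  moreover have "\<not> x < c * c"
  proof
    assume gt: "x < c * c"
    then have "0 < c" using \<open>0 \<le> c\<close> assms by (cases "c = 0") auto
    define h where "h = (c * c - x) / (2 * c)"
    have h: "2 * c * h = c * c - x" "0 < h" using gt \<open>0 < c\<close> by (simp_all add: h_def)
    have "c \<le> c - h"
    proof (rule c(2))
      fix y assume y: "0 \<le> y \<and> y * y \<le> x"
      show "y \<le> c - h"
      proof (rule ccontr)
        assume "\<not> y \<le> c - h"
        moreover have "h \<le> c"
        proof -
          have "0 < c * h" using h(2) \<open>0 < c\<close> by simp
          moreover have "c * h + c * h = c * c - x" using h(1) by (simp add: algebra_simps)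
          ultimately have "c * h \<le> c * c" using assms by linarith
          then show ?thesis using \<open>0 < c\<close> by simp
        qed
        ultimately have "(c - h) * (c - h) \<le> y * y" by (intro mult_mono) auto
        moreover have "(c - h) * (c - h) = x + h * h" using h(1) by (simp add: algebra_simps)
        moreover have "0 < h * h" using h(2) by simp
        ultimately show False using y by simp
      qed
    qed
    then show False using h(2) by simp
  qed
  ultimately show ?thesis using that[of c] by auto
qed

lemma Rep_sqrt:
  assumes "0 \<le> y" shows "rsqrt (Rep_mreal (y * y)) = Rep_mreal y"
  unfolding rsqrt_def
proof (rule the_equality)
  fix z assume z: "z \<^bold>\<in> Reals \<and> \<^bold>0 \<^bold>\<le> z \<and> z \<^bold>* z = Rep_mreal (y * y)"
  then obtain w where w: "z = Rep_mreal w" using mreal_cases by blast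
  with z have "0 \<le> w" "w * w = y * y"
    by (simp_all add: Rep_mult[symmetric] Rep_less_eq Rep_zero)
  then have "w = y" using assms by (simp add: square_eq_iff) linarith
  then show "z = Rep_mreal y" using w by simp
qed (use assms in \<open>simp add: Rep_mult[symmetric] Rep_less_eq Rep_zero\<close>)

section \<open>Recursion on the natural numbers\<close>

text \<open>
  It suffices to exhibit a definable function \<open>F\<close> that satisfies the recursion equations:
  restricted to \<open>succ n\<close> it witnesses existence in the definition of \<^const>\<open>rfold\<close>, and uniqueness follows
  by induction.
\<close>

lemma rfold_eq:
  fixes F :: "'v::zf_reals \<Rightarrow> 'v mreal"
  assumes n: "n \<^bold>\<in> omega" and F: "definable_real (\<lambda>e. F (e 0))" and zero: "Rep_mreal (F emptyset) = c"
    and step: "\<And>l. l \<^bold>\<in> n \<Longrightarrow> Rep_mreal (F (succ l)) = op (Rep_mreal (F l)) (a l)"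
  shows "rfold op c a n = Rep_mreal (F n)"
  unfolding rfold_def
proof (rule the_equality)
  have FR: "definable_term (\<lambda>e. Rep_mreal (F (e 0)))" by (intro definable_intros F)
  note s = lam_mem_funs[OF FR, of "succ n" Reals, simplified]
  have s': "x \<^bold>\<in> n \<or> x = n \<Longrightarrow> lam (succ n) (\<lambda>l. Rep_mreal (F l)) \<^bold>\<cdot> x = Rep_mreal (F x)" for x
    using app_lam[OF FR, of "succ n" Reals] by simp
  have "lam (succ n) (\<lambda>l. Rep_mreal (F l)) \<^bold>\<cdot> emptyset = c"
    using s'[of emptyset] emptyset_mem_succ[OF n] zero by simp
  moreover have "succ l \<^bold>\<in> n \<or> succ l = n" if "l \<^bold>\<in> n" for l
    using mem_succ_mono[OF n that] by simp
  ultimately show "\<exists>s\<^bold>\<in>funs (succ n) Reals. s \<^bold>\<cdot> emptyset = c \<and>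
      (\<forall>l\<^bold>\<in>n. s \<^bold>\<cdot> succ l = op (s \<^bold>\<cdot> l) (a l)) \<and> Rep_mreal (F n) = s \<^bold>\<cdot> n"
    using s s' step by (intro exI[of _ "lam (succ n) (\<lambda>l. Rep_mreal (F l))"]) auto
next
  fix y
  assume "\<exists>s\<^bold>\<in>funs (succ n) Reals. s \<^bold>\<cdot> emptyset = c \<and>
      (\<forall>l\<^bold>\<in>n. s \<^bold>\<cdot> succ l = op (s \<^bold>\<cdot> l) (a l)) \<and> y = s \<^bold>\<cdot> n"
  then obtain s where s: "s \<^bold>\<in> funs (succ n) Reals" "s \<^bold>\<cdot> emptyset = c"
      "\<forall>l\<^bold>\<in>n. s \<^bold>\<cdot> succ l = op (s \<^bold>\<cdot> l) (a l)" "y = s \<^bold>\<cdot> n"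
    by blast
  note m = pair_mem_iff_app[OF s(1)]
  have "n \<^bold>\<in> succ n \<longrightarrow> pair n (Rep_mreal (F n)) \<^bold>\<in> s"
  proof (rule omega_induct[OF n, where P = "\<lambda>l. l \<^bold>\<in> succ n \<longrightarrow> pair l (Rep_mreal (F l)) \<^bold>\<in> s"])
    show "definable (\<lambda>e. e 0 \<^bold>\<in> succ n \<longrightarrow> pair (e 0) (Rep_mreal (F (e 0))) \<^bold>\<in> s)"
      by (intro definable_intros F)
    show "emptyset \<^bold>\<in> succ n \<longrightarrow> pair emptyset (Rep_mreal (F emptyset)) \<^bold>\<in> s"
      using m s(2) zero by simp
    fix l assume l: "l \<^bold>\<in> omega" "l \<^bold>\<in> succ n \<longrightarrow> pair l (Rep_mreal (F l)) \<^bold>\<in> s"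
    show "succ l \<^bold>\<in> succ n \<longrightarrow> pair (succ l) (Rep_mreal (F (succ l))) \<^bold>\<in> s"
    proof
      assume sl: "succ l \<^bold>\<in> succ n"
      then have "l \<^bold>\<in> n" by (rule mem_succ_succD[OF n])
      then have "s \<^bold>\<cdot> succ l = Rep_mreal (F (succ l))"
        using l(2) s(3) step m by simp
      then show "pair (succ l) (Rep_mreal (F (succ l))) \<^bold>\<in> s"
        using m sl by simp
    qed
  qed
  then show "y = Rep_mreal (F n)" using m s(4) by simp
qed

text \<open>
  Recursion with an affine step \<open>x \<mapsto> a * x + b\<close> covers both powers and the embedding of the natural
  numbers.  As the step is given by two numbers rather than by a function, definability in \<open>a\<close>
  and \<open>b\<close> needs no binding construct.
\<close>

definition affine_run :: "'v::zf_reals mreal \<Rightarrow> 'v mreal \<Rightarrow> 'v mreal \<Rightarrow> 'v \<Rightarrow> 'v \<Rightarrow> bool" where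
  "affine_run a b c n s \<longleftrightarrow> s \<^bold>\<in> funs (succ n) Reals \<and> pair emptyset (Rep_mreal c) \<^bold>\<in> s \<and>
    (\<forall>l\<^bold>\<in>n. \<forall>x. pair l (Rep_mreal x) \<^bold>\<in> s \<longrightarrow> pair (succ l) (Rep_mreal (a * x + b)) \<^bold>\<in> s)"

definition affine_rec :: "'v::zf_reals mreal \<Rightarrow> 'v mreal \<Rightarrow> 'v mreal \<Rightarrow> 'v \<Rightarrow> 'v mreal" where
  "affine_rec a b c n = mr (THE y. n \<^bold>\<in> omega \<and> (\<exists>s. affine_run a b c n s \<and> pair n y \<^bold>\<in> s))"

lemma definable_funs [definable_intros]:
  fixes S T :: "(nat \<Rightarrow> 'v::zf) \<Rightarrow> 'v"
  assumes "definable_term S" "definable_term T" shows "definable_term (\<lambda>e. funs (S e) (T e))"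
proof -
  have prod: "definable_term (\<lambda>e :: nat \<Rightarrow> 'v. prod_of (e 0) (e 1))"
    unfolding prod_of_def
  proof (rule definable_zset)
    show "\<exists>a. \<forall>x. x \<^bold>\<in> a \<longleftrightarrow> (\<exists>u\<^bold>\<in>e 0. \<exists>v\<^bold>\<in>e 1. x = pair u v)" for e :: "nat \<Rightarrow> 'v"
      by (rule exI[of _ "prod_of (e 0) (e 1)"]) (simp add: mem_prod_of)
  qed (intro definable_intros)
  have "definable_term (\<lambda>e :: nat \<Rightarrow> 'v. funs (e 0) (e 1))"
    unfolding funs_def
  proof (rule definable_zset)
    show "\<exists>a. \<forall>x. x \<^bold>\<in> a \<longleftrightarrow> x \<^bold>\<subseteq> prod_of (e 0) (e 1) \<and> (\<forall>z\<^bold>\<in>e 0. \<exists>!y. pair z y \<^bold>\<in> x)"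
      for e :: "nat \<Rightarrow> 'v"
      by (rule exI[of _ "funs (e 0) (e 1)"]) (simp add: mem_funs)
  qed (intro definable_intros definable_term_inst2[OF prod])
  from definable_term_inst2[OF this assms] show ?thesis .
qed

lemma definable_affine_run [definable_intros]:
  assumes "definable_real A" "definable_real B" "definable_real C" "definable_term N" "definable_term S"
  shows "definable (\<lambda>e. affine_run (A e) (B e) (C e) (N e) (S e))"
  unfolding affine_run_def
  by (intro definable_intros definable_term_shift definable_real_shift assms)

lemma affine_run_unique:
  assumes n: "n \<^bold>\<in> omega" and s: "affine_run a b c n s" and t: "affine_run a b c n t"
    and "pair n y \<^bold>\<in> s" "pair n z \<^bold>\<in> t"
  shows "y = z"
proof -
  have sf: "s \<^bold>\<in> funs (succ n) Reals" and tf: "t \<^bold>\<in> funs (succ n) Reals"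
    using s t by (simp_all add: affine_run_def)
  have "n \<^bold>\<in> succ n \<longrightarrow> (\<exists>x. pair n (Rep_mreal x) \<^bold>\<in> s \<and> pair n (Rep_mreal x) \<^bold>\<in> t)"
  proof (rule omega_induct[OF n, where
        P = "\<lambda>l. l \<^bold>\<in> succ n \<longrightarrow> (\<exists>x. pair l (Rep_mreal x) \<^bold>\<in> s \<and> pair l (Rep_mreal x) \<^bold>\<in> t)"])
    fix l assume l: "l \<^bold>\<in> omega" "l \<^bold>\<in> succ n \<longrightarrow> (\<exists>x. pair l (Rep_mreal x) \<^bold>\<in> s \<and> pair l (Rep_mreal x) \<^bold>\<in> t)"
    show "succ l \<^bold>\<in> succ n \<longrightarrow> (\<exists>x. pair (succ l) (Rep_mreal x) \<^bold>\<in> s \<and> pair (succ l) (Rep_mreal x) \<^bold>\<in> t)"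
    proof
      assume "succ l \<^bold>\<in> succ n"
      then have "l \<^bold>\<in> n" by (rule mem_succ_succD[OF n])
      then obtain x where "pair l (Rep_mreal x) \<^bold>\<in> s" "pair l (Rep_mreal x) \<^bold>\<in> t" using l(2) by auto
      then have "pair (succ l) (Rep_mreal (a * x + b)) \<^bold>\<in> s" "pair (succ l) (Rep_mreal (a * x + b)) \<^bold>\<in> t"
        using \<open>l \<^bold>\<in> n\<close> s t unfolding affine_run_def by blast+
      then show "\<exists>x. pair (succ l) (Rep_mreal x) \<^bold>\<in> s \<and> pair (succ l) (Rep_mreal x) \<^bold>\<in> t" by blast
    qed
  qed (intro definable_intros, use s t in \<open>auto simp: affine_run_def\<close>)
  then obtain x where "pair n (Rep_mreal x) \<^bold>\<in> s" "pair n (Rep_mreal x) \<^bold>\<in> t" by auto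
  then show ?thesis
    using funs_unique[OF sf assms(4)] funs_unique[OF tf assms(5)] by metis
qed

lemma definable_affine_rec [definable_intros]:
  assumes "definable_real A" "definable_real B" "definable_real C" "definable_term N"
  shows "definable_real (\<lambda>e. affine_rec (A e) (B e) (C e) (N e))"
  unfolding affine_rec_def
proof (intro definable_mr definable_the)
  show "definable (\<lambda>e. N (\<lambda>i. e (Suc i)) \<^bold>\<in> omega \<and>
      (\<exists>s. affine_run (A (\<lambda>i. e (Suc i))) (B (\<lambda>i. e (Suc i))) (C (\<lambda>i. e (Suc i)))
        (N (\<lambda>i. e (Suc i))) s \<and> pair (N (\<lambda>i. e (Suc i))) (e 0) \<^bold>\<in> s))"
    by (intro definable_intros definable_term_shift definable_real_shift assms)
qed (use affine_run_unique in blast)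

lemma affine_rec_eq:
  assumes "n \<^bold>\<in> omega" "affine_run a b c n s" "pair n (Rep_mreal x) \<^bold>\<in> s"
  shows "affine_rec a b c n = x"
proof -
  have "(THE y. n \<^bold>\<in> omega \<and> (\<exists>s. affine_run a b c n s \<and> pair n y \<^bold>\<in> s)) = Rep_mreal x"
  proof (rule the_equality)
    show "n \<^bold>\<in> omega \<and> (\<exists>s. affine_run a b c n s \<and> pair n (Rep_mreal x) \<^bold>\<in> s)"
      using assms by blast
    show "y = Rep_mreal x" if "n \<^bold>\<in> omega \<and> (\<exists>s. affine_run a b c n s \<and> pair n y \<^bold>\<in> s)" for y
      using that affine_run_unique[OF assms(1) _ assms(2) _ assms(3)] by blast
  qed
  then show ?thesis by (simp add: affine_rec_def)
qed

lemma affine_run_zero: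
  obtains s where "affine_run a b c emptyset s" "pair emptyset (Rep_mreal c) \<^bold>\<in> s"
proof -
  define s where "s = upair (pair emptyset (Rep_mreal c)) (pair emptyset (Rep_mreal c))"
  have "affine_run a b c emptyset s" "pair emptyset (Rep_mreal c) \<^bold>\<in> s"
    by (auto simp: affine_run_def s_def mem_funs subset_of_def)
  then show ?thesis using that by blast
qed

lemma affine_run_succ:
  assumes n: "n \<^bold>\<in> omega" and s: "affine_run a b c n s" and x: "pair n (Rep_mreal x) \<^bold>\<in> s"
  obtains t where "affine_run a b c (succ n) t" "pair (succ n) (Rep_mreal (a * x + b)) \<^bold>\<in> t"
proof -
  define p where "p = pair (succ n) (Rep_mreal (a * x + b))"
  obtain t where t: "\<And>q. q \<^bold>\<in> t \<longleftrightarrow> q \<^bold>\<in> s \<or> q = p"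
    using ex_union[of s "upair p p"] by auto
  have sf: "s \<^bold>\<in> funs (succ n) Reals"
    and zero: "pair emptyset (Rep_mreal c) \<^bold>\<in> s"
    and step: "\<And>l x. l \<^bold>\<in> n \<Longrightarrow> pair l (Rep_mreal x) \<^bold>\<in> s \<Longrightarrow> pair (succ l) (Rep_mreal (a * x + b)) \<^bold>\<in> s"
    using s by (auto simp: affine_run_def)
  have dom: "l \<^bold>\<in> succ n" if "pair l y \<^bold>\<in> s" for l y
    using funs_pair_mem[OF sf that] by simp
  have old: "pair l y \<^bold>\<in> t \<longleftrightarrow> pair l y \<^bold>\<in> s" if "l \<^bold>\<in> succ n" for l y
    using t that mem_irrefl[of "succ n"] by (auto simp: p_def simp del: mem_succ)
  have new: "pair (succ n) y \<^bold>\<in> t \<longleftrightarrow> y = Rep_mreal (a * x + b)" for y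
    using t dom[of "succ n" y] mem_irrefl[of "succ n"] by (auto simp: p_def simp del: mem_succ)
  have "t \<^bold>\<subseteq> prod_of (succ (succ n)) Reals"
    unfolding subset_of_def
  proof (intro allI impI)
    fix q assume "q \<^bold>\<in> t"
    moreover have "q \<^bold>\<in> s \<Longrightarrow> q \<^bold>\<in> prod_of (succ n) Reals"
      using sf by (auto simp: mem_funs subset_of_def)
    ultimately show "q \<^bold>\<in> prod_of (succ (succ n)) Reals"
      using t by (auto simp: p_def mem_prod_of)
  qed
  moreover have "\<exists>!y. pair l y \<^bold>\<in> t" if "l \<^bold>\<in> succ (succ n)" for l
  proof (cases "l = succ n")
    case False
    then have "l \<^bold>\<in> succ n" using that by auto
    then show ?thesis using sf old by (auto simp: mem_funs simp del: mem_succ)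
  qed (simp add: new)
  ultimately have "t \<^bold>\<in> funs (succ (succ n)) Reals" by (simp add: mem_funs)
  moreover have "pair emptyset (Rep_mreal c) \<^bold>\<in> t" using t zero by simp
  moreover have "pair (succ l) (Rep_mreal (a * y + b)) \<^bold>\<in> t" 
    if l: "l \<^bold>\<in> succ n" and y: "pair l (Rep_mreal y) \<^bold>\<in> t" for l y
  proof (cases "l = n")
    case True
    then have "y = x" using y old[OF l] x funs_unique[OF sf] by fastforce
    then show ?thesis using True new by simp
  next
    case False
    then have "l \<^bold>\<in> n" using l by simp
    then show ?thesis using step y old[OF l] t by blast
  qed
  ultimately have "affine_run a b c (succ n) t" by (auto simp: affine_run_def simp del: mem_succ)
  then show ?thesis using that new by blast
qed

lemma affine_rec_zero: "affine_rec a b c emptyset = c"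
  using affine_run_zero affine_rec_eq emptyset_mem_omega by metis

lemma affine_rec_succ:
  assumes n: "n \<^bold>\<in> omega" shows "affine_rec a b c (succ n) = a * affine_rec a b c n + b"
proof -
  have "\<exists>s x. affine_run a b c n s \<and> pair n (Rep_mreal x) \<^bold>\<in> s"
  proof (rule omega_induct[OF n])
    show "\<exists>s x. affine_run a b c emptyset s \<and> pair emptyset (Rep_mreal x) \<^bold>\<in> s"
      using affine_run_zero by metis
    show "\<exists>s x. affine_run a b c (succ m) s \<and> pair (succ m) (Rep_mreal x) \<^bold>\<in> s"
      if "m \<^bold>\<in> omega" "\<exists>s x. affine_run a b c m s \<and> pair m (Rep_mreal x) \<^bold>\<in> s" for m
      using that affine_run_succ by metis
  qed (intro definable_intros)
  then obtain s x where s: "affine_run a b c n s" "pair n (Rep_mreal x) \<^bold>\<in> s" by blast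
  obtain t where t: "affine_run a b c (succ n) t" "pair (succ n) (Rep_mreal (a * x + b)) \<^bold>\<in> t"
    using affine_run_succ[OF n s] by blast
  show ?thesis using affine_rec_eq[OF n s] affine_rec_eq[OF _ t] n by simp
qed

definition npow :: "'v::zf_reals mreal \<Rightarrow> 'v \<Rightarrow> 'v mreal" where
  "npow x n = affine_rec x 0 1 n"

definition nreal :: "'v::zf_reals \<Rightarrow> 'v mreal" where
  "nreal n = affine_rec 1 1 0 n"

lemma definable_npow [definable_intros]:
  "definable_real X \<Longrightarrow> definable_term N \<Longrightarrow> definable_real (\<lambda>e. npow (X e) (N e))"
  unfolding npow_def by (intro definable_intros)

lemma definable_nreal [definable_intros]:
  "definable_term N \<Longrightarrow> definable_real (\<lambda>e. nreal (N e))"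
  unfolding nreal_def by (intro definable_intros)

lemma npow_zero [simp]: "npow x emptyset = 1"
  and npow_succ: "n \<^bold>\<in> omega \<Longrightarrow> npow x (succ n) = x * npow x n"
  by (simp_all add: npow_def affine_rec_zero affine_rec_succ)

lemma nreal_zero [simp]: "nreal emptyset = 0"
  and nreal_succ: "n \<^bold>\<in> omega \<Longrightarrow> nreal (succ n) = nreal n + 1"
  by (simp_all add: nreal_def affine_rec_zero affine_rec_succ)

lemma Rep_npow: 
  assumes "n \<^bold>\<in> omega" shows "rpow (Rep_mreal x) n = Rep_mreal (npow x n)"
  unfolding rpow_def
proof (rule rfold_eq[OF assms])
  show "definable_real (\<lambda>e. npow x (e 0))" by (intro definable_intros)
  show "Rep_mreal (npow x (succ l)) = Rep_mreal (npow x l) \<^bold>* Rep_mreal x" if "l \<^bold>\<in> n" for l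
    using mem_omega_trans[OF assms that] by (simp add: npow_succ Rep_mult[symmetric] mult.commute)
qed (simp add: Rep_one)

lemma Rep_nreal: 
  assumes "n \<^bold>\<in> omega" shows "real_of n = Rep_mreal (nreal n)"
  unfolding real_of_def rsum_def
proof (rule rfold_eq[OF assms])
  show "definable_real (\<lambda>e. nreal (e 0))" by (intro definable_intros)
  show "Rep_mreal (nreal (succ l)) = Rep_mreal (nreal l) \<^bold>+ \<^bold>1" if "l \<^bold>\<in> n" for l
    using mem_omega_trans[OF assms that] by (simp add: nreal_succ Rep_add Rep_one)
qed (simp add: Rep_zero)

lemma nreal_nonneg: assumes "n \<^bold>\<in> omega" shows "0 \<le> nreal n"
  by (rule omega_induct[OF assms]) (intro definable_intros, simp_all add: nreal_succ)

lemma npow_nonneg: assumes "n \<^bold>\<in> omega" "0 \<le> x" shows "0 \<le> npow x n"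
  by (rule omega_induct[OF assms(1)]) (intro definable_intros, simp_all add: npow_succ assms(2))

lemma npow_le_one: assumes "n \<^bold>\<in> omega" "0 \<le> x" "x \<le> 1" shows "npow x n \<le> 1"
proof (rule omega_induct[OF assms(1)])
  show "npow x (succ m) \<le> 1" if "m \<^bold>\<in> omega" "npow x m \<le> 1" for m
    using that assms npow_nonneg[OF that(1) assms(2)] by (simp add: npow_succ mult_le_one)
qed (intro definable_intros, simp)

lemma npow_mult_distrib:
  assumes "n \<^bold>\<in> omega" shows "npow (x * y) n = npow x n * npow y n"
  by (rule omega_induct[OF assms]) (intro definable_intros, simp_all add: npow_succ)

lemma Bernoulli:
  assumes "n \<^bold>\<in> omega" "- 1 \<le> x" shows "1 + nreal n * x \<le> npow (1 + x) n"
proof (rule omega_induct[OF assms(1)])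
  fix m assume m: "m \<^bold>\<in> omega" "1 + nreal m * x \<le> npow (1 + x) m"
  have "0 \<le> nreal m * (x * x)" using nreal_nonneg[OF m(1)] by simp
  moreover have "(1 + x) * (1 + nreal m * x) \<le> (1 + x) * npow (1 + x) m"
    using m(2) assms(2) by (intro mult_left_mono) auto
  ultimately show "1 + nreal (succ m) * x \<le> npow (1 + x) (succ m)"
    using m(1) by (simp add: nreal_succ npow_succ algebra_simps)
qed (intro definable_intros, simp)

section \<open>Limits\<close>

definition seq_lim :: "('v::zf_reals \<Rightarrow> 'v mreal) \<Rightarrow> 'v mreal \<Rightarrow> bool" where
  "seq_lim a y \<longleftrightarrow> (\<forall>\<delta>. 0 < \<delta> \<longrightarrow> (\<exists>N\<^bold>\<in>omega. \<forall>m\<^bold>\<in>omega. N \<^bold>\<subseteq> m \<longrightarrow> \<bar>a m - y\<bar> < \<delta>))"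

definition seq_Cauchy :: "('v::zf_reals \<Rightarrow> 'v mreal) \<Rightarrow> bool" where
  "seq_Cauchy a \<longleftrightarrow> (\<forall>\<delta>. 0 < \<delta> \<longrightarrow>
    (\<exists>N\<^bold>\<in>omega. \<forall>m\<^bold>\<in>omega. \<forall>k\<^bold>\<in>omega. N \<^bold>\<subseteq> m \<and> N \<^bold>\<subseteq> k \<longrightarrow> \<bar>a m - a k\<bar> < \<delta>))"

lemma all_pos_Rep: "(\<forall>\<delta>\<^bold>\<in>Reals. \<^bold>0 \<^bold>< \<delta> \<longrightarrow> P \<delta>) \<longleftrightarrow> (\<forall>\<delta>. 0 < \<delta> \<longrightarrow> P (Rep_mreal \<delta>))"
proof -
  have "(\<forall>\<delta>\<^bold>\<in>Reals. Q \<delta>) \<longleftrightarrow> (\<forall>\<delta>. Q (Rep_mreal \<delta>))" for Q :: "'a \<Rightarrow> bool"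
    using mreal_cases Rep_mem by metis
  from this[of "\<lambda>\<delta>. \<^bold>0 \<^bold>< \<delta> \<longrightarrow> P \<delta>"] show ?thesis by (simp add: Rep_less Rep_zero)
qed

lemma tends_to_iff:
  assumes "\<And>m. m \<^bold>\<in> omega \<Longrightarrow> d (X m) Y = Rep_mreal \<bar>a m - y\<bar>"
  shows "tends_to d X Y \<longleftrightarrow> seq_lim a y"
  unfolding tends_to_def seq_lim_def all_pos_Rep
  using assms by (simp add: Rep_less cong: imp_cong)

lemma Rep_dist: "rdist (Rep_mreal x) (Rep_mreal y) = Rep_mreal \<bar>x - y\<bar>"
  by (simp add: rdist_def Rep_diff Rep_abs)

text \<open>
  The additive constant makes this one lemma serve for uniqueness of limits, for bounds on a
  limit and for comparing the increments of two sequences.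
\<close>

lemma seq_lim_eventually_le:
  assumes "seq_lim a y" "seq_lim b z" "N \<^bold>\<in> omega" "\<And>m. m \<^bold>\<in> omega \<Longrightarrow> N \<^bold>\<subseteq> m \<Longrightarrow> a m \<le> b m + c"
  shows "y \<le> z + c"
proof (rule ccontr)
  assume "\<not> y \<le> z + c"
  define \<delta> where "\<delta> = (y - z - c) / 2"
  have "0 < \<delta>" using \<open>\<not> y \<le> z + c\<close> by (simp add: \<delta>_def)
  then obtain N1 N2 where N: "N1 \<^bold>\<in> omega" "\<And>m. m \<^bold>\<in> omega \<Longrightarrow> N1 \<^bold>\<subseteq> m \<Longrightarrow> \<bar>a m - y\<bar> < \<delta>"
      "N2 \<^bold>\<in> omega" "\<And>m. m \<^bold>\<in> omega \<Longrightarrow> N2 \<^bold>\<subseteq> m \<Longrightarrow> \<bar>b m - z\<bar> < \<delta>"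
    using assms(1,2) unfolding seq_lim_def by blast
  obtain K where K: "K \<^bold>\<in> omega" "N1 \<^bold>\<subseteq> K" "N2 \<^bold>\<subseteq> K" using omega_upper_bound N by metis
  obtain m where "m \<^bold>\<in> omega" "K \<^bold>\<subseteq> m" "N \<^bold>\<subseteq> m" using omega_upper_bound K assms(3) by metis
  then have "\<bar>a m - y\<bar> < \<delta>" "\<bar>b m - z\<bar> < \<delta>" "a m \<le> b m + c"
    using N K assms(4) subset_trans by blast+
  moreover have "2 * \<delta> = y - z - c" by (simp add: \<delta>_def)
  ultimately show False by linarith
qed

lemma seq_lim_unique: "seq_lim a y \<Longrightarrow> seq_lim a z \<Longrightarrow> y = z"
  using seq_lim_eventually_le[of a y a z emptyset 0] seq_lim_eventually_le[of a z a y emptyset 0]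
  by (simp add: order.antisym)

lemma seq_lim_const: "seq_lim (\<lambda>m. c) c"
  unfolding seq_lim_def by (auto intro: emptyset_mem_omega)

lemma incseq_bounded_converges:
  fixes a :: "'v::zf_reals \<Rightarrow> 'v mreal"
  assumes a: "definable_real (\<lambda>e. a (e 0))" and mono: "\<And>m. m \<^bold>\<in> omega \<Longrightarrow> a m \<le> a (succ m)"
    and bound: "\<And>m. m \<^bold>\<in> omega \<Longrightarrow> a m \<le> b"
  obtains y where "seq_lim a y"
proof -
  have "definable (\<lambda>e. \<exists>m\<^bold>\<in>omega. mr (e 0) = a m)"
    by (intro definable_intros definable_real_app1[OF a])
  then obtain c where c: "\<And>x. (\<exists>m\<^bold>\<in>omega. x = a m) \<Longrightarrow> x \<le> c"
      "\<And>d. (\<And>x. (\<exists>m\<^bold>\<in>omega. x = a m) \<Longrightarrow> x \<le> d) \<Longrightarrow> c \<le> d"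
    using mreal_sup[of "\<lambda>x. \<exists>m\<^bold>\<in>omega. x = a m" "a emptyset" b] bound emptyset_mem_omega by blast
  have "seq_lim a c"
    unfolding seq_lim_def
  proof (intro allI impI)
    fix \<delta> :: "'v mreal" assume "0 < \<delta>"
    then have "\<not> c \<le> c - \<delta>" by simp
    then have "\<not> (\<forall>m\<^bold>\<in>omega. a m \<le> c - \<delta>)" using c(2)[of "c - \<delta>"] by blast
    then obtain N where N: "N \<^bold>\<in> omega" "c - \<delta> < a N" by (auto simp: not_le)
    have "\<bar>a m - c\<bar> < \<delta>" if m: "m \<^bold>\<in> omega" "N \<^bold>\<subseteq> m" for m
    proof -
      have "N \<^bold>\<subseteq> m \<longrightarrow> a N \<le> a m"
      proof (rule omega_induct[OF m(1)])
        show "N \<^bold>\<subseteq> emptyset \<longrightarrow> a N \<le> a emptyset"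
          using nonempty_ex[of N] by (auto simp: subset_of_def)
        show "N \<^bold>\<subseteq> succ k \<longrightarrow> a N \<le> a (succ k)" if "k \<^bold>\<in> omega" "N \<^bold>\<subseteq> k \<longrightarrow> a N \<le> a k" for k
          using that subset_succ_iff[OF N(1) that(1)] mono[OF that(1)] by auto
      qed (intro definable_intros definable_real_app1[OF a])
      moreover have "a m \<le> c" using c(1) m by blast
      ultimately show ?thesis using N m \<open>0 < \<delta>\<close> by (simp add: abs_if)
    qed
    then show "\<exists>N\<^bold>\<in>omega. \<forall>m\<^bold>\<in>omega. N \<^bold>\<subseteq> m \<longrightarrow> \<bar>a m - c\<bar> < \<delta>" using N by blast
  qed
  then show ?thesis using that by blast
qed

text \<open>
  The limit is the supremum of the numbers that are eventually below the sequence.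
\<close>

lemma Cauchy_converges:
  fixes a :: "'v::zf_reals \<Rightarrow> 'v mreal"
  assumes a: "definable_real (\<lambda>e. a (e 0))" and Cauchy: "seq_Cauchy a"
  obtains y where "seq_lim a y"
proof -
  define P where "P x \<longleftrightarrow> (\<exists>N\<^bold>\<in>omega. \<forall>m\<^bold>\<in>omega. N \<^bold>\<subseteq> m \<longrightarrow> x \<le> a m)" for x
  have near: "\<exists>N\<^bold>\<in>omega. (\<forall>m\<^bold>\<in>omega. N \<^bold>\<subseteq> m \<longrightarrow> \<bar>a m - a N\<bar> < \<delta>) \<and> P (a N - \<delta>) \<and>
      (\<forall>x. P x \<longrightarrow> x \<le> a N + \<delta>)" if \<delta>: "0 < \<delta>" for \<delta>
  proof -
    obtain N where N: "N \<^bold>\<in> omega"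
        "\<forall>m\<^bold>\<in>omega. \<forall>k\<^bold>\<in>omega. N \<^bold>\<subseteq> m \<and> N \<^bold>\<subseteq> k \<longrightarrow> \<bar>a m - a k\<bar> < \<delta>"
      using Cauchy \<delta> unfolding seq_Cauchy_def by blast
    then have 1: "\<bar>a m - a N\<bar> < \<delta>" if "m \<^bold>\<in> omega" "N \<^bold>\<subseteq> m" for m
      using that by simp
    have "a N - \<delta> \<le> a m" if "m \<^bold>\<in> omega" "N \<^bold>\<subseteq> m" for m
      using 1[OF that] by linarith
    then have 2: "P (a N - \<delta>)" unfolding P_def using N(1) by blast
    have "x \<le> a N + \<delta>" if x: "P x" for x
    proof -
      obtain M where M: "M \<^bold>\<in> omega" "\<forall>m\<^bold>\<in>omega. M \<^bold>\<subseteq> m \<longrightarrow> x \<le> a m" using x unfolding P_def by blast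
      obtain K where "K \<^bold>\<in> omega" "N \<^bold>\<subseteq> K" "M \<^bold>\<subseteq> K" using omega_upper_bound N(1) M(1) by metis
      then have "x \<le> a K" "\<bar>a K - a N\<bar> < \<delta>" using M(2) 1 by blast+
      then show ?thesis by linarith
    qed
    then show ?thesis using N(1) 1 2 by blast
  qed
  have "definable (\<lambda>e. P (mr (e 0)))"
    unfolding P_def by (intro definable_intros definable_real_app1[OF a])
  then obtain c where c: "\<And>x. P x \<Longrightarrow> x \<le> c" "\<And>d. (\<And>x. P x \<Longrightarrow> x \<le> d) \<Longrightarrow> c \<le> d"
    using mreal_sup[of P] near[of 1] zero_less_one by metis
  have "seq_lim a c"
    unfolding seq_lim_def
  proof (intro allI impI)
    fix \<delta> :: "'v mreal" assume "0 < \<delta>"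
    then obtain N where N: "N \<^bold>\<in> omega" "\<forall>m\<^bold>\<in>omega. N \<^bold>\<subseteq> m \<longrightarrow> \<bar>a m - a N\<bar> < \<delta> / 2"
        "P (a N - \<delta> / 2)" "\<forall>x. P x \<longrightarrow> x \<le> a N + \<delta> / 2"
      using near[of "\<delta> / 2"] by auto
    then have "a N - \<delta> / 2 \<le> c" "c \<le> a N + \<delta> / 2" using c by blast+
    then have "\<bar>a m - c\<bar> < \<delta>" if "m \<^bold>\<in> omega" "N \<^bold>\<subseteq> m" for m
      using N(2)[rule_format, OF that] by linarith
    then show "\<exists>N\<^bold>\<in>omega. \<forall>m\<^bold>\<in>omega. N \<^bold>\<subseteq> m \<longrightarrow> \<bar>a m - c\<bar> < \<delta>" using N(1) by blast
  qed
  then show ?thesis using that by blast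
qed

section \<open>The exponential function\<close>

definition euler_seq :: "'v::zf_reals mreal \<Rightarrow> 'v \<Rightarrow> 'v mreal" where
  "euler_seq x m = npow (1 + x / nreal (succ m)) (succ m)"

lemma definable_euler_seq [definable_intros]:
  "definable_real X \<Longrightarrow> definable_term M \<Longrightarrow> definable_real (\<lambda>e. euler_seq (X e) (M e))"
  unfolding euler_seq_def by (intro definable_intros)

lemma definable_seq_lim_euler [definable_intros]:
  assumes "definable_real X" "definable_real Y" shows "definable (\<lambda>e. seq_lim (euler_seq (X e)) (Y e))"
  unfolding seq_lim_def
  by (intro definable_intros definable_real_shift assms)

definition mexp :: "'v::zf_reals mreal \<Rightarrow> 'v mreal" where
  "mexp x = (THE y. seq_lim (euler_seq x) y)"

lemma mexp_eq: "seq_lim (euler_seq x) y \<Longrightarrow> mexp x = y"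
  unfolding mexp_def using seq_lim_unique by blast

text \<open>
  Existence of the limit is not claimed: if there is none, both sides are the same description
  of nothing.
\<close>

lemma rexp_eq: "rexp (Rep_mreal x) = (THE z. \<exists>y. seq_lim (euler_seq x) y \<and> z = Rep_mreal y)"
proof -
  have lim: "tends_to rdist (\<lambda>m. rpow (\<^bold>1 \<^bold>+ Rep_mreal x \<^bold>/ real_of (succ m)) (succ m)) (Rep_mreal y) \<longleftrightarrow>
      seq_lim (euler_seq x) y" for y
  proof (rule tends_to_iff)
    fix m :: 'a assume m: "m \<^bold>\<in> omega"
    then have "nreal (succ m) \<noteq> 0" using nreal_nonneg[OF m] by (simp add: nreal_succ)
    then have "rpow (\<^bold>1 \<^bold>+ Rep_mreal x \<^bold>/ real_of (succ m)) (succ m) = Rep_mreal (euler_seq x m)"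
      using m by (simp add: euler_seq_def Rep_nreal Rep_divide Rep_npow Rep_add[symmetric] flip: Rep_one)
    then show "rdist (rpow (\<^bold>1 \<^bold>+ Rep_mreal x \<^bold>/ real_of (succ m)) (succ m)) (Rep_mreal y) =
        Rep_mreal \<bar>euler_seq x m - y\<bar>"
      by (simp add: Rep_dist)
  qed
  have "z \<^bold>\<in> Reals \<and> tends_to rdist (\<lambda>m. rpow (\<^bold>1 \<^bold>+ Rep_mreal x \<^bold>/ real_of (succ m)) (succ m)) z \<longleftrightarrow>
      (\<exists>y. seq_lim (euler_seq x) y \<and> z = Rep_mreal y)" for z
  proof
    assume z: "z \<^bold>\<in> Reals \<and> tends_to rdist (\<lambda>m. rpow (\<^bold>1 \<^bold>+ Rep_mreal x \<^bold>/ real_of (succ m)) (succ m)) z"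
    then obtain y where "z = Rep_mreal y" using mreal_cases by blast
    then show "\<exists>y. seq_lim (euler_seq x) y \<and> z = Rep_mreal y" using z lim by blast
  qed (auto simp: lim)
  then show ?thesis by (simp only: rexp_def)
qed

lemma Rep_exp: "seq_lim (euler_seq x) y \<Longrightarrow> rexp (Rep_mreal x) = Rep_mreal (mexp x)"
  unfolding rexp_eq by (rule the_equality) (auto simp: mexp_eq dest: seq_lim_unique)

text \<open>
  Both estimates are Bernoulli's inequality for the power of a quotient, \<open>(x / y)\<^sup>N\<close> and
  \<open>(y / x)\<^sup>N\<close> respectively.
\<close>

lemma npow_increment:
  assumes n: "n \<^bold>\<in> omega" and y: "1 \<le> y" "y \<le> x"
  shows "nreal (succ n) * (x - y) \<le> npow x (succ n) - npow y (succ n)"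
    and "npow x (succ n) - npow y (succ n) \<le> nreal (succ n) * (x - y) * npow x (succ n)"
proof -
  define N where "N = nreal (succ n)"
  have sn: "succ n \<^bold>\<in> omega" using n by simp
  have N: "1 \<le> N" using nreal_nonneg[OF n] by (simp add: N_def nreal_succ n)
  have "N * (y - 1) \<ge> 1 * (y - 1)" using N y by (intro mult_right_mono) auto
  then have "y \<le> npow y (succ n)" using Bernoulli[OF sn, of "y - 1"] y(1) by (simp add: N_def)
  then have "1 \<le> npow y (succ n) / y" using y by simp
  then have "N * (x - y) * 1 \<le> N * (x - y) * (npow y (succ n) / y)"
    using N y by (intro mult_left_mono) auto
  moreover have "npow y (succ n) * (1 + N * (x / y - 1)) \<le> npow y (succ n) * npow (x / y) (succ n)"
    using Bernoulli[OF sn, of "x / y - 1"] y npow_nonneg[OF sn, of y]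
    by (intro mult_left_mono) (auto simp: N_def)
  moreover have "npow y (succ n) * npow (x / y) (succ n) = npow x (succ n)"
    using npow_mult_distrib[OF sn, of y "x / y"] y by simp
  moreover have "N * (x - y) * (npow y (succ n) / y) = npow y (succ n) * (N * (x / y - 1))"
    using y by (simp add: field_simps)
  ultimately show "nreal (succ n) * (x - y) \<le> npow x (succ n) - npow y (succ n)"
    by (simp add: N_def algebra_simps)
  have "npow x (succ n) * (1 + N * (y / x - 1)) \<le> npow x (succ n) * npow (y / x) (succ n)"
    using Bernoulli[OF sn, of "y / x - 1"] y npow_nonneg[OF sn, of x]
    by (intro mult_left_mono) (auto simp: N_def)
  moreover have "npow x (succ n) * npow (y / x) (succ n) = npow y (succ n)"
    using npow_mult_distrib[OF sn, of x "y / x"] y by simp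
  moreover have "(x - y) / x \<le> x - y" using y by (simp add: divide_le_eq mult_le_cancel_left1)
  then have "N * ((x - y) / x) * npow x (succ n) \<le> N * (x - y) * npow x (succ n)"
    using N npow_nonneg[OF sn, of x] y by (intro mult_right_mono mult_left_mono) auto
  moreover have "N * ((x - y) / x) * npow x (succ n) = - (npow x (succ n) * (N * (y / x - 1)))"
    using y by (simp add: field_simps)
  ultimately show "npow x (succ n) - npow y (succ n) \<le> nreal (succ n) * (x - y) * npow x (succ n)"
    by (simp add: N_def algebra_simps)
qed

text \<open>
  The classical argument: with \<open>a = 1 + x / N\<close> and \<open>b = 1 + x / (N + 1)\<close>, Bernoulli's inequality gives
  \<open>(b / a)\<^sup>N\<^sup>+\<^sup>1 \<ge> 1 / a\<close>, that is, \<open>b\<^sup>N\<^sup>+\<^sup>1 \<ge> a\<^sup>N\<close>.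
\<close>

lemma euler_seq_mono:
  assumes n: "n \<^bold>\<in> omega" and x: "0 \<le> x" shows "euler_seq x n \<le> euler_seq x (succ n)"
proof -
  define N where "N = nreal (succ n)"
  define a b where "a = 1 + x / N" and "b = 1 + x / (N + 1)"
  have N: "1 \<le> N" using nreal_nonneg[OF n] by (simp add: N_def nreal_succ n)
  have sn: "succ n \<^bold>\<in> omega" "succ (succ n) \<^bold>\<in> omega" using n by simp_all
  have "1 \<le> a" "0 < b" using N x by (auto simp: a_def b_def add_pos_nonneg)
  have ratio: "b / a - 1 = - (x / ((N + 1) * (N + x)))"
  proof -
    define D where "D = (N + 1) * (N + x)"
    have "D \<noteq> 0" using N x by (simp add: D_def)
    have "a = (N + x) / N" "b = (N + 1 + x) / (N + 1)"
      using N by (simp_all add: a_def b_def add_divide_distrib)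
    then have "b / a = (N * (N + 1 + x)) / D"
      by (simp add: D_def mult.commute)
    also have "N * (N + 1 + x) = D - x" by (simp add: D_def algebra_simps)
    finally show ?thesis using \<open>D \<noteq> 0\<close> by (simp add: diff_divide_distrib D_def)
  qed
  have "x \<le> (N + 1) * (N + x)"
    using N x mult_mono[of 1 "N + 1" x "N + x"] by simp
  then have "- 1 \<le> b / a - 1" using N x by (simp add: ratio divide_le_eq)
  then have "1 + (N + 1) * (b / a - 1) \<le> npow (b / a) (succ (succ n))"
    using Bernoulli[OF sn(2), of "b / a - 1"] n by (simp add: N_def nreal_succ)
  moreover have "1 + (N + 1) * (b / a - 1) = 1 / a"
  proof -
    have "(N + 1) * (x / ((N + 1) * (N + x))) = x / (N + x)" using N by simp
    moreover have "1 / a = N / (N + x)" using N x by (simp add: a_def field_simps)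
    moreover have "1 - x / (N + x) = N / (N + x)" using N x by (simp add: field_simps)
    ultimately show ?thesis unfolding ratio by simp
  qed
  ultimately have "npow a (succ (succ n)) * (1 / a) \<le> npow a (succ (succ n)) * npow (b / a) (succ (succ n))"
    using npow_nonneg[OF sn(2), of a] \<open>1 \<le> a\<close> by (intro mult_left_mono) auto
  moreover have "npow a (succ (succ n)) * npow (b / a) (succ (succ n)) = npow b (succ (succ n))"
    using npow_mult_distrib[OF sn(2), of a "b / a"] \<open>1 \<le> a\<close> by simp
  moreover have "npow a (succ (succ n)) * (1 / a) = npow a (succ n)"
    using npow_succ[OF sn(1), of a] \<open>1 \<le> a\<close> by simp
  ultimately show ?thesis
    using n by (simp add: euler_seq_def a_def b_def N_def nreal_succ)
qed

text \<open>
  Since \<open>(1 + x/N)\<^sup>N (1 - x/N)\<^sup>N \<le> 1\<close> and, by Bernoulli's inequality, \<open>(1 - x/N)\<^sup>N \<ge> 1 - x \<ge> 1/2\<close>.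
  The range \<open>[0, 1/2]\<close> used throughout is chosen for this short argument.
\<close>

lemma euler_seq_bound:
  assumes n: "n \<^bold>\<in> omega" and x: "0 \<le> x" "x \<le> 1 / 2" shows "euler_seq x n \<le> 2"
proof -
  define N where "N = nreal (succ n)"
  have N: "1 \<le> N" using nreal_nonneg[OF n] by (simp add: N_def nreal_succ n)
  have sn: "succ n \<^bold>\<in> omega" using n by simp
  have xN: "0 \<le> x / N" "x / N \<le> 1 / 2"
    using N x mult_mono[of 1 N x x] by (auto simp: divide_le_eq) 
  have "1 / 2 \<le> npow (1 - x / N) (succ n)"
    using Bernoulli[OF sn, of "- (x / N)"] xN x N by (simp add: N_def[symmetric])
  then have "euler_seq x n * (1 / 2) \<le> euler_seq x n * npow (1 - x / N) (succ n)"
    using npow_nonneg[OF sn, of "1 + x / N"] xN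
    by (intro mult_left_mono) (simp_all add: euler_seq_def N_def)
  also have "\<dots> = npow ((1 + x / N) * (1 - x / N)) (succ n)"
    by (simp add: euler_seq_def N_def npow_mult_distrib sn)
  also have "\<dots> \<le> 1"
  proof (rule npow_le_one[OF sn])
    have "x / N \<le> 1" using xN(2) by linarith
    then show "0 \<le> (1 + x / N) * (1 - x / N)" using xN(1) by simp
    have "(1 + x / N) * (1 - x / N) = 1 - (x / N) * (x / N)" by (simp add: algebra_simps)
    then show "(1 + x / N) * (1 - x / N) \<le> 1" by simp
  qed
  finally show ?thesis by simp
qed

lemma euler_seq_converges:
  assumes "0 \<le> x" "x \<le> 1 / 2" shows "seq_lim (euler_seq x) (mexp x)"
proof -
  have "definable_real (\<lambda>e. euler_seq x (e 0))" by (intro definable_intros)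
  then obtain y where "seq_lim (euler_seq x) y"
    using incseq_bounded_converges[of "euler_seq x" 2] euler_seq_mono euler_seq_bound assms by blast
  then show ?thesis using mexp_eq by blast
qed

text \<open>
  The factor \<open>N\<close> in \<open>npow_increment\<close> cancels against the differences \<open>x/N - y/N\<close>, and the estimates pass to the
  limit.
\<close>

lemma mexp_increment:
  assumes "0 \<le> y" "y \<le> x" "x \<le> 1 / 2"
  shows "x - y \<le> mexp x - mexp y" and "mexp x - mexp y \<le> 2 * (x - y)"
proof -
  have lim: "seq_lim (euler_seq x) (mexp x)" "seq_lim (euler_seq y) (mexp y)"
    using assms by (auto intro: euler_seq_converges)
  have "euler_seq y n \<le> euler_seq x n + - (x - y) \<and> euler_seq x n \<le> euler_seq y n + 2 * (x - y)"
    if n: "n \<^bold>\<in> omega" for n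
  proof -
    define N where "N = nreal (succ n)"
    have N: "1 \<le> N" using nreal_nonneg[OF n] by (simp add: N_def nreal_succ n)
    have le: "1 \<le> 1 + y / N" "1 + y / N \<le> 1 + x / N"
      using assms N by (auto simp: divide_right_mono)
    have diff: "nreal (succ n) * (1 + x / N - (1 + y / N)) = x - y"
      using N by (simp add: N_def[symmetric] field_simps)
    have "(x - y) * euler_seq x n \<le> (x - y) * 2"
      using euler_seq_bound[OF n, of x] assms by (intro mult_left_mono) auto
    then show ?thesis
      using npow_increment[OF n le] unfolding diff by (simp add: euler_seq_def N_def[symmetric])
  qed
  then show "x - y \<le> mexp x - mexp y" "mexp x - mexp y \<le> 2 * (x - y)"
    using seq_lim_eventually_le[OF lim(2,1) emptyset_mem_omega, of "- (x - y)"]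
      seq_lim_eventually_le[OF lim emptyset_mem_omega, of "2 * (x - y)"] by auto
qed

lemma mexp_bilipschitz:
  assumes "0 \<le> x" "x \<le> 1 / 2" "0 \<le> y" "y \<le> 1 / 2"
  shows "\<bar>x - y\<bar> \<le> \<bar>mexp x - mexp y\<bar>" and "\<bar>mexp x - mexp y\<bar> \<le> 2 * \<bar>x - y\<bar>"
proof (atomize(full), cases "y \<le> x")
  case True
  then show "\<bar>x - y\<bar> \<le> \<bar>mexp x - mexp y\<bar> \<and> \<bar>mexp x - mexp y\<bar> \<le> 2 * \<bar>x - y\<bar>"
    using mexp_increment[OF assms(3) True assms(2)] by simp
next
  case False
  then have "x \<le> y" by simp
  then show "\<bar>x - y\<bar> \<le> \<bar>mexp x - mexp y\<bar> \<and> \<bar>mexp x - mexp y\<bar> \<le> 2 * \<bar>x - y\<bar>"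
    using mexp_increment[OF assms(1) _ assms(4)] by (simp add: abs_minus_commute[of x] abs_minus_commute[of "mexp x"])
qed

section \<open>The symmetrized max-plus algebra\<close>

lemma eps_not_real [simp]: "\<epsilon> \<^bold>\<notin> Reals"
  by (simp add: minus_inf_def)

lemma Rep_not_eps [simp]: "Rep_mreal x \<noteq> \<epsilon>" "\<epsilon> \<noteq> Rep_mreal x"
  using Rep_mem[of x] eps_not_real by metis+

lemma mem_Reals_eps: "r \<^bold>\<in> Reals_eps \<longleftrightarrow> r \<^bold>\<in> Reals \<or> r = \<epsilon>"
  unfolding Reals_eps_def by (rule mem_zset) (use ex_union[of Reals "upair \<epsilon> \<epsilon>"] in simp)

lemma eps_mem [simp]: "\<epsilon> \<^bold>\<in> Reals_eps" and Rep_mem_Reals_eps [simp]: "Rep_mreal x \<^bold>\<in> Reals_eps"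
  by (simp_all add: mem_Reals_eps)

lemma Reals_eps_cases:
  assumes "r \<^bold>\<in> Reals_eps" obtains "r = \<epsilon>" | x where "r = Rep_mreal x"
  using assms mreal_cases unfolding mem_Reals_eps by blast

lemma emax_simps [simp]:
  "emax \<epsilon> b = b" "emax a \<epsilon> = a" "emax (Rep_mreal x) (Rep_mreal y) = Rep_mreal (max x y)"
  by (simp_all add: emax_def Rep_less_eq[symmetric] max_def)

lemma definable_emax [definable_intros]:
  "definable_term S \<Longrightarrow> definable_term T \<Longrightarrow> definable_term (\<lambda>e. emax (S e) (T e))"
  unfolding emax_def rless_eq_def by (intro definable_intros)

lemma definable_equivalent [definable_intros]:
  assumes "definable_term S" "definable_term T" shows "definable (\<lambda>e. S e \<^bold>\<sim> T e)"
proof -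
  have "definable (\<lambda>e. ((fst_of (S e) \<noteq> snd_of (S e) \<and> fst_of (T e) \<noteq> snd_of (T e)) \<and>
        emax (fst_of (S e)) (snd_of (T e)) = emax (snd_of (S e)) (fst_of (T e))) \<or>
      (\<not> (fst_of (S e) \<noteq> snd_of (S e) \<and> fst_of (T e) \<noteq> snd_of (T e)) \<and> S e = T e))"
    by (intro definable_intros assms)
  then show ?thesis
    by (rule back_subst[of definable]) (auto simp: fun_eq_iff equivalent_def balances_def)
qed

lemma mem_class_of: "q \<^bold>\<in> class_of p \<longleftrightarrow> q \<^bold>\<in> prod_of Reals_eps Reals_eps \<and> p \<^bold>\<sim> q"
  unfolding class_of_def
  by (rule mem_zset_sub[where a = "prod_of Reals_eps Reals_eps"]) (intro definable_intros, simp)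

lemma definable_class_of [definable_intros]:
  assumes "definable_term S" shows "definable_term (\<lambda>e. class_of (S e))"
  unfolding class_of_def
proof (rule definable_zset)
  show "\<exists>a. \<forall>x. x \<^bold>\<in> a \<longleftrightarrow> x \<^bold>\<in> prod_of Reals_eps Reals_eps \<and> S e \<^bold>\<sim> x" for e
    using mem_class_of by blast
qed (intro definable_intros definable_term_shift assms)

lemma mem_Sym: "x \<^bold>\<in> Sym \<longleftrightarrow> (\<exists>p\<^bold>\<in>prod_of Reals_eps Reals_eps. x = class_of p)"
  unfolding Sym_def
proof (rule mem_zset_sub)
  show "x \<^bold>\<in> Pow_of (prod_of Reals_eps Reals_eps)"
    if "\<exists>p\<^bold>\<in>prod_of Reals_eps Reals_eps. x = class_of p" for x
    using that by (auto simp: subset_of_def mem_class_of)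
qed (intro definable_intros)

fun signed_pair :: "sign \<Rightarrow> 'v::zf_reals \<Rightarrow> 'v" where
  "signed_pair Plus r = pair r \<epsilon>"
| "signed_pair Minus r = pair \<epsilon> r"
| "signed_pair Bal r = pair r r"

lemma signed_eq_class_of: "signed \<sigma> r = class_of (signed_pair \<sigma> r)"
  by (cases \<sigma>) auto

text \<open>
  From here on signed elements are handled through \<open>abs_of_signed\<close> and \<open>sgn_of_Plus\<close>; unfolding them to
  classes would hide the sign.
\<close>

declare signed.simps [simp del]

lemma signed_pair_mem: "r \<^bold>\<in> Reals_eps \<Longrightarrow> signed_pair \<sigma> r \<^bold>\<in> prod_of Reals_eps Reals_eps"
  by (cases \<sigma>) auto

lemma definable_signed [definable_intros]:
  "definable_term T \<Longrightarrow> definable_term (\<lambda>e. signed \<sigma> (T e))"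
  by (cases \<sigma>) (simp_all add: signed.simps, (intro definable_intros, assumption?)+)

lemma signed_mem [simp]: "r \<^bold>\<in> Reals_eps \<Longrightarrow> signed \<sigma> r \<^bold>\<in> Sym"
  unfolding signed_eq_class_of mem_Sym using signed_pair_mem by blast

lemma signed_eq_imp_eq:
  assumes "r \<^bold>\<in> Reals_eps" "s \<^bold>\<in> Reals_eps" "signed \<sigma> r = signed \<tau> s" shows "r = s"
proof -
  have "signed_pair \<sigma> r \<^bold>\<sim> signed_pair \<sigma> r"
    by (rule Reals_eps_cases[OF assms(1)]; cases \<sigma>) (auto simp: equivalent_def balances_def)
  then have "signed_pair \<sigma> r \<^bold>\<in> class_of (signed_pair \<sigma> r)"
    using signed_pair_mem[OF assms(1)] by (simp add: mem_class_of)
  then have "signed_pair \<tau> s \<^bold>\<sim> signed_pair \<sigma> r"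
    using assms(3) mem_class_of unfolding signed_eq_class_of by metis
  then show ?thesis
    by (rule_tac Reals_eps_cases[OF assms(1)]; rule_tac Reals_eps_cases[OF assms(2)]; cases \<sigma>; cases \<tau>)
      (auto simp: equivalent_def balances_def split: if_splits)
qed

lemma abs_of_signed [simp]: "r \<^bold>\<in> Reals_eps \<Longrightarrow> abs_of (signed \<sigma> r) = r"
  unfolding abs_of_def by (rule the_equality) (auto dest: signed_eq_imp_eq)

lemma sgn_of_Plus [simp]: "r \<^bold>\<in> Reals_eps \<Longrightarrow> sgn_of (signed Plus r) = Plus"
  by (auto simp: sgn_of_def)

text \<open>
  A pair in which one entry dominates balances the same pairs as the pair where the smaller entry
  is replaced by \<open>\<epsilon>\<close>.
\<close>

lemma class_of_dominated:
  assumes "b = \<epsilon> \<or> y < x" "b \<noteq> \<epsilon> \<Longrightarrow> b = Rep_mreal y"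
  shows "class_of (pair (Rep_mreal x) b) = signed Plus (Rep_mreal x)"
    and "class_of (pair b (Rep_mreal x)) = signed Minus (Rep_mreal x)"
proof -
  consider "b = \<epsilon>" | "y < x" "b = Rep_mreal y" using assms by blast
  note b = this
  have "(pair (Rep_mreal x) b \<^bold>\<sim> pair c d \<longleftrightarrow> pair (Rep_mreal x) \<epsilon> \<^bold>\<sim> pair c d) \<and>
      (pair b (Rep_mreal x) \<^bold>\<sim> pair c d \<longleftrightarrow> pair \<epsilon> (Rep_mreal x) \<^bold>\<sim> pair c d)"
    if "c \<^bold>\<in> Reals_eps" "d \<^bold>\<in> Reals_eps" for c d
    by (rule b; rule Reals_eps_cases[OF that(1)]; rule Reals_eps_cases[OF that(2)])
      (auto simp: equivalent_def balances_def max_def split: if_splits)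
  then show "class_of (pair (Rep_mreal x) b) = signed Plus (Rep_mreal x)"
    "class_of (pair b (Rep_mreal x)) = signed Minus (Rep_mreal x)"
    by (auto intro!: extensionality simp: mem_class_of mem_prod_of signed.simps)
qed

lemma Sym_cases:
  assumes "a \<^bold>\<in> Sym" obtains \<sigma> r where "r \<^bold>\<in> Reals_eps" "a = signed \<sigma> r"
proof -
  obtain p where "p \<^bold>\<in> prod_of Reals_eps Reals_eps" "a = class_of p"
    using assms mem_Sym by blast
  then obtain r s where r: "r \<^bold>\<in> Reals_eps" and s: "s \<^bold>\<in> Reals_eps" and a: "a = class_of (pair r s)"
    using mem_prod_of[of p] by blast
  show ?thesis
  proof (rule Reals_eps_cases[OF r]; rule Reals_eps_cases[OF s])
    assume "r = \<epsilon>" "s = \<epsilon>"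
    then show ?thesis using a by (intro that[OF r, of Bal]) (simp only: signed.simps)
  next
    fix y assume "r = \<epsilon>" "s = Rep_mreal y"
    then show ?thesis using a by (intro that[OF s, of Minus]) (simp only: signed.simps)
  next
    fix x assume "r = Rep_mreal x" "s = \<epsilon>"
    then show ?thesis using a by (intro that[OF r, of Plus]) (simp only: signed.simps)
  next
    fix x y assume x: "r = Rep_mreal x" and y: "s = Rep_mreal y"
    consider "x < y" | "x = y" | "y < x" using linorder_less_linear[of x y] by blast
    then show ?thesis
    proof cases
      case 1
      show ?thesis
        using class_of_dominated(2)[OF disjI2[OF 1] x] a y by (intro that[OF s, of Minus]) (simp only:)
    next
      case 2
      then show ?thesis using a x y by (intro that[OF r, of Bal]) (simp only: signed.simps)
    next
      case 3
      show ?thesis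
        using class_of_dominated(1)[OF disjI2[OF 3] y] a x by (intro that[OF r, of Plus]) (simp only:)
    qed
  qed
qed

lemma definable_abs_of [definable_intros]:
  assumes "definable_term T" shows "definable_term (\<lambda>e. abs_of (T e))"
proof -
  have sign_ex: "(\<exists>\<sigma>. Q \<sigma>) \<longleftrightarrow> Q Plus \<or> Q Minus \<or> Q Bal" for Q
  proof
    assume "\<exists>\<sigma>. Q \<sigma>"
    then obtain \<sigma> where "Q \<sigma>" by blast
    then show "Q Plus \<or> Q Minus \<or> Q Bal" by (cases \<sigma>) auto
  qed blast
  show ?thesis
    unfolding abs_of_def
  proof (rule definable_the)
    show "definable (\<lambda>e. e 0 \<^bold>\<in> Reals_eps \<and> (\<exists>\<sigma>. T (\<lambda>i. e (Suc i)) = signed \<sigma> (e 0)))"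
      unfolding sign_ex
      by (intro definable_conj definable_disj definable_eq definable_mem definable_signed definable_var
          definable_const definable_term_shift[OF assms])
    show "y = z" if "y \<^bold>\<in> Reals_eps \<and> (\<exists>\<sigma>. T e = signed \<sigma> y)" "z \<^bold>\<in> Reals_eps \<and> (\<exists>\<sigma>. T e = signed \<sigma> z)"
      for e y z
    proof -
      from that obtain \<sigma> \<tau> where "T e = signed \<sigma> y" "T e = signed \<tau> z" by blast
      then have "signed \<sigma> y = signed \<tau> z" by simp
      then show ?thesis using signed_eq_imp_eq that by blast
    qed
  qed
qed

section \<open>The canonical embedding\<close>

text \<open>
  A total, definable variant of \<^const>\<open>eexp\<close>.
\<close>

definition eexp_limit :: "'v::zf_reals \<Rightarrow> 'v" where
  "eexp_limit r = (if r = \<epsilon> then rzero else THE z. \<exists>y. seq_lim (euler_seq (mr r)) y \<and> z = Rep_mreal y)"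

lemma eexp_limit_eq: "r \<^bold>\<in> Reals_eps \<Longrightarrow> eexp r = eexp_limit r"
  by (erule Reals_eps_cases) (simp_all add: eexp_def eexp_limit_def rexp_eq)

lemma definable_eexp_limit [definable_intros]:
  assumes "definable_term T" shows "definable_term (\<lambda>e. eexp_limit (T e))"
proof -
  have "definable_term (\<lambda>e. THE z. \<exists>y. seq_lim (euler_seq (mr (T e))) y \<and> z = Rep_mreal y)"
    by (rule definable_the, intro definable_intros definable_term_shift assms)
      (auto dest: seq_lim_unique)
  then show ?thesis unfolding eexp_limit_def by (intro definable_if definable_intros assms)
qed

text \<open>
  Where Euler's limit is not known to exist, the exponential is at worst one fixed element of the
  universe.  This is enough for the definability of the embedding.
\<close>

lemma eexp_limit_cases: "eexp_limit r \<^bold>\<in> Reals \<or> eexp_limit r = (THE z. False)"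
proof (cases "\<exists>y. seq_lim (euler_seq (mr r)) y")
  case True
  then obtain y where y: "seq_lim (euler_seq (mr r)) y" by blast
  then have "(THE z. \<exists>y. seq_lim (euler_seq (mr r)) y \<and> z = Rep_mreal y) = Rep_mreal y"
    by (intro the_equality) (auto dest: seq_lim_unique)
  then show ?thesis by (simp add: eexp_limit_def rzero_mem)
qed (simp add: eexp_limit_def rzero_mem)

text \<open>
  The canonical embedding as a function of the sign and the modulus.
\<close>

definition spin :: "sign \<Rightarrow> 'v::zf_reals \<Rightarrow> 'v" where
  "spin \<sigma> w = (case \<sigma> of Plus \<Rightarrow> cmult theta (complex_of w)
     | Minus \<Rightarrow> cmult (cmult theta theta) (complex_of w) | Bal \<Rightarrow> complex_of w)"

lemma Phi_eq: "a \<^bold>\<in> Sym \<Longrightarrow> Phi a = spin (sgn_of a) (eexp_limit (abs_of a))"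
  by (erule Sym_cases) (simp add: Phi_def spin_def eexp_limit_eq split: sign.split)

lemma cmult_Rep: "cmult (pair (Rep_mreal a) (Rep_mreal b)) (pair (Rep_mreal c) (Rep_mreal d)) =
    pair (Rep_mreal (a * c - b * d)) (Rep_mreal (a * d + b * c))"
  by (simp add: cmult_def Rep_mult[symmetric] Rep_add[symmetric] Rep_diff)

lemma complex_of_Rep: "complex_of (Rep_mreal x) = pair (Rep_mreal x) (Rep_mreal 0)"
  by (simp add: complex_of_def Rep_zero)

lemma theta_unit:
  obtains p q :: "'v::zf_reals mreal"
  where "theta = pair (Rep_mreal p) (Rep_mreal q)" "p * p + q * q = 1"
proof -
  obtain s :: "'v mreal" where s: "0 \<le> s" "s * s = 3" using mreal_sqrt[of 3] by auto
  have two: "Rep_mreal 1 \<^bold>+ Rep_mreal 1 = Rep_mreal (2 :: 'v mreal)"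
    by (simp add: Rep_add[symmetric])
  have "rsqrt (Rep_mreal 1 \<^bold>+ Rep_mreal 1 \<^bold>+ Rep_mreal 1) = Rep_mreal s"
    using Rep_sqrt[OF s(1)] s(2) by (simp add: Rep_add[symmetric])
  then have "theta = pair (Rep_mreal (- 1 / 2)) (Rep_mreal (s / 2))"
    by (simp add: theta_def two Rep_diff Rep_divide flip: Rep_zero Rep_one)
  moreover have "(- 1 / 2) * (- 1 / 2) + (s / 2) * (s / 2) = 1" using s(2) by simp
  ultimately show ?thesis using that by blast
qed

lemma spin_Rep:
  obtains p q where "\<And>x. spin \<sigma> (Rep_mreal x) = pair (Rep_mreal (p * x)) (Rep_mreal (q * x))"
    "\<sigma> = Plus \<Longrightarrow> p * p + q * q = 1"
proof -
  obtain p q :: "'a mreal" where th: "theta = pair (Rep_mreal p) (Rep_mreal q)" "p * p + q * q = 1"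
    by (rule theta_unit)
  note simps = spin_def complex_of_Rep cmult_Rep th
  show ?thesis
  proof (cases \<sigma>)
    case Plus
    show ?thesis by (rule that[of p q]) (simp_all add: Plus simps)
  next
    case Minus
    show ?thesis by (rule that[of "p * p - q * q" "p * q + q * p"]) (simp_all add: Minus simps)
  next
    case Bal
    show ?thesis by (rule that[of 1 0]) (simp_all add: Bal simps)
  qed
qed

lemma definable_spin [definable_intros]:
  fixes T :: "(nat \<Rightarrow> 'v::zf_reals) \<Rightarrow> 'v"
  assumes "definable_term T" shows "definable_term (\<lambda>e. spin \<sigma> (eexp_limit (T e)))"
proof -
  obtain p q :: "'v mreal"
    where "\<And>x. spin \<sigma> (Rep_mreal x) = pair (Rep_mreal (p * x)) (Rep_mreal (q * x))"
    using spin_Rep[of \<sigma>] by metis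
  moreover have "eexp_limit r \<^bold>\<in> Reals \<Longrightarrow> eexp_limit r = Rep_mreal (mr (eexp_limit r))" for r :: 'v
    by (simp add: Rep_mr)
  ultimately have "spin \<sigma> (eexp_limit r) = (if eexp_limit r \<^bold>\<in> Reals
      then pair (Rep_mreal (p * mr (eexp_limit r))) (Rep_mreal (q * mr (eexp_limit r)))
      else spin \<sigma> (THE z. False))" for r :: 'v
    using eexp_limit_cases[of r] by metis
  then show ?thesis by (simp only:) (intro definable_intros assms)
qed

text \<open>
  An open set is given as the set of all \<open>a\<close> with \<open>Phi a\<close> in \<open>U\<close>.  That this description denotes a set with
  the expected elements is an instance of separation, and requires \<^const>\<open>Phi\<close> to be definable on all of
  \<^const>\<open>Sym\<close>.
\<close>

lemma open_Sym_mem: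
  fixes W :: "'v::zf_reals"
  assumes "open_Sym W" obtains U where "open_C U" "\<And>a. a \<^bold>\<in> W \<longleftrightarrow> a \<^bold>\<in> Sym \<and> Phi a \<^bold>\<in> U"
proof -
  obtain U where U: "open_C U" "W = zset (\<lambda>a. a \<^bold>\<in> Sym \<and> Phi a \<^bold>\<in> U)"
    using assms unfolding open_Sym_def by blast
  have "definable (\<lambda>e :: nat \<Rightarrow> 'v. e 0 \<^bold>\<in> Sym \<and> 
      (if \<exists>r\<^bold>\<in>Reals_eps. e 0 = signed Plus r then spin Plus (eexp_limit (abs_of (e 0)))
       else if \<exists>r\<^bold>\<in>Reals_eps. e 0 = signed Minus r then spin Minus (eexp_limit (abs_of (e 0)))
       else spin Bal (eexp_limit (abs_of (e 0)))) \<^bold>\<in> U)"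
    by (intro definable_intros)
  moreover have "a \<^bold>\<in> Sym \<and> Phi a \<^bold>\<in> U \<longleftrightarrow> a \<^bold>\<in> Sym \<and>
      (if \<exists>r\<^bold>\<in>Reals_eps. a = signed Plus r then spin Plus (eexp_limit (abs_of a))
       else if \<exists>r\<^bold>\<in>Reals_eps. a = signed Minus r then spin Minus (eexp_limit (abs_of a))
       else spin Bal (eexp_limit (abs_of a))) \<^bold>\<in> U" for a
    by (simp only: Phi_eq sgn_of_def if_distrib[of "\<lambda>\<sigma>. spin \<sigma> _"] cong: conj_cong)
  ultimately have "definable (\<lambda>e :: nat \<Rightarrow> 'v. e 0 \<^bold>\<in> Sym \<and> Phi (e 0) \<^bold>\<in> U)" by (simp only:)
  then have "a \<^bold>\<in> W \<longleftrightarrow> a \<^bold>\<in> Sym \<and> Phi a \<^bold>\<in> U" for a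
    unfolding U(2) by (intro mem_zset_sub[where a = Sym]) auto
  then show ?thesis using that U(1) by blast
qed

section \<open>A segment of the positive ray\<close>

definition ray :: "'v::zf_reals mreal \<Rightarrow> 'v" where
  "ray x = signed Plus (Rep_mreal x)"

definition half_seg :: "'v::zf_reals mreal \<Rightarrow> bool" where
  "half_seg x \<longleftrightarrow> 0 \<le> x \<and> x \<le> 1 / 2"

lemma definable_ray [definable_intros]:
  "definable_real T \<Longrightarrow> definable_term (\<lambda>e. ray (T e))"
  unfolding ray_def by (intro definable_intros)

lemma definable_half_seg [definable_intros]:
  "definable_real T \<Longrightarrow> definable (\<lambda>e. half_seg (T e))"
  unfolding half_seg_def by (intro definable_intros)

lemma ray_mem [simp]: "ray x \<^bold>\<in> Sym"
  by (simp add: ray_def)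

lemma ray_inject [simp]: "ray x = ray y \<longleftrightarrow> x = y"
  unfolding ray_def using signed_eq_imp_eq[of "Rep_mreal x" "Rep_mreal y"] by auto

lemma eexp_seg: "half_seg x \<Longrightarrow> eexp (Rep_mreal x) = Rep_mreal (mexp x)"
  by (simp add: eexp_def half_seg_def Rep_exp[OF euler_seq_converges])

lemma cdist_direction:
  assumes "p * p + q * q = 1"
  shows "cdist (pair (Rep_mreal (p * x)) (Rep_mreal (q * x))) (pair (Rep_mreal (p * y)) (Rep_mreal (q * y))) =
    Rep_mreal \<bar>x - y\<bar>"
proof -
  have "(p * x - p * y) * (p * x - p * y) + (q * x - q * y) * (q * x - q * y) =
      (p * p + q * q) * ((x - y) * (x - y))"
    by (simp add: algebra_simps)
  then have "(p * x - p * y) * (p * x - p * y) + (q * x - q * y) * (q * x - q * y) = \<bar>x - y\<bar> * \<bar>x - y\<bar>"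
    using assms by simp
  then show ?thesis
    using Rep_sqrt[of "\<bar>x - y\<bar>"]
    by (simp add: cdist_def cmod_def cminus_def Rep_diff Rep_mult[symmetric] Rep_add[symmetric])
qed

lemma Phi_ray:
  obtains p q where "\<And>x. half_seg x \<Longrightarrow> Phi (ray x) = pair (Rep_mreal (p * mexp x)) (Rep_mreal (q * mexp x))"
    "p * p + q * q = 1"
proof -
  obtain p q :: "'a mreal"
    where pq: "\<And>x. spin Plus (Rep_mreal x) = pair (Rep_mreal (p * x)) (Rep_mreal (q * x))" "p * p + q * q = 1"
    using spin_Rep[of Plus] by blast
  have "Phi (ray x) = pair (Rep_mreal (p * mexp x)) (Rep_mreal (q * mexp x))" if "half_seg x" for x
    using pq(1)[of "mexp x"] eexp_seg[OF that] Phi_eq[OF ray_mem[of x]]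
    by (simp add: ray_def eexp_limit_eq[symmetric])
  then show ?thesis using that pq(2) by blast
qed

text \<open>
  Multiplication by \<open>\<theta>\<close> preserves distances, as \<open>|\<theta>| = 1\<close>; so the Euclidean distance agrees with the inner one here.
\<close>

lemma dist_ray:
  assumes "half_seg x" "half_seg y"
  shows "dist_Sym i (ray x) (ray y) = Rep_mreal \<bar>mexp x - mexp y\<bar>"
proof (cases "i = 1")
  case True
  then show ?thesis
    using Phi_ray cdist_direction assms by (metis d1_def dist_Sym_def)
next
  case False
  then show ?thesis
    using assms by (simp add: dist_Sym_def d2_def ray_def eexp_seg Rep_diff Rep_abs)
qed

lemma open_Sym_ray:
  fixes x :: "'v::zf_reals mreal"
  assumes W: "open_Sym W" and x: "ray x \<^bold>\<in> W" "half_seg x"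
  obtains \<delta> where "0 < \<delta>" "\<And>y. half_seg y \<Longrightarrow> \<bar>x - y\<bar> < \<delta> \<Longrightarrow> ray y \<^bold>\<in> W"
proof -
  obtain U where U: "open_C U" "\<And>a. a \<^bold>\<in> W \<longleftrightarrow> a \<^bold>\<in> Sym \<and> Phi a \<^bold>\<in> U"
    using open_Sym_mem[OF W] by blast
  obtain d where "d \<^bold>\<in> Reals" "\<^bold>0 \<^bold>< d" "\<forall>w\<^bold>\<in>Complexes. cdist (Phi (ray x)) w \<^bold>< d \<longrightarrow> w \<^bold>\<in> U"
    using U x(1) unfolding open_C_def by blast
  then obtain \<delta> where \<delta>: "0 < \<delta>" "\<forall>w\<^bold>\<in>Complexes. cdist (Phi (ray x)) w \<^bold>< Rep_mreal \<delta> \<longrightarrow> w \<^bold>\<in> U"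
    using mreal_cases Rep_less Rep_zero by metis
  obtain p q :: "'v mreal"
    where pq: "\<And>x. half_seg x \<Longrightarrow> Phi (ray x) = pair (Rep_mreal (p * mexp x)) (Rep_mreal (q * mexp x))"
      "p * p + q * q = 1"
    using Phi_ray by blast
  show ?thesis
  proof
    show "0 < \<delta> / 2" using \<delta> by simp
    fix y assume y: "half_seg y" "\<bar>x - y\<bar> < \<delta> / 2"
    then have "\<bar>mexp x - mexp y\<bar> < \<delta>"
      using mexp_bilipschitz(2)[of x y] x(2) by (simp add: half_seg_def)
    then have "cdist (Phi (ray x)) (Phi (ray y)) \<^bold>< Rep_mreal \<delta>"
      using x(2) y(1) by (simp add: pq(1) cdist_direction[OF pq(2)] Rep_less[symmetric])
    moreover have "Phi (ray y) \<^bold>\<in> Complexes"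
      using pq(1) y(1) by (simp add: Complexes_def)
    ultimately show "ray y \<^bold>\<in> W" using \<delta>(2) U(2) by simp
  qed
qed

section \<open>A square in the finite power\<close>

text \<open>
  The point of \<open>S\<^sup>n\<close> with the first two coordinates \<open>\<oplus>u\<close> and \<open>\<oplus>v\<close>.  The other coordinates are \<open>\<oplus>0\<close>, not
  \<open>\<epsilon>\<close>, so that all of them are on the ray.
\<close>

definition square_pt :: "'v::zf_reals \<Rightarrow> 'v mreal \<Rightarrow> 'v mreal \<Rightarrow> 'v" where
  "square_pt n u v = lam n (\<lambda>l. ray (if l = emptyset then u else if l = succ emptyset then v else 0))"

lemma square_pt_mem [simp]: "square_pt n u v \<^bold>\<in> Sym_pow n"
  and square_pt_app: "l \<^bold>\<in> n \<Longrightarrow>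
    square_pt n u v \<^bold>\<cdot> l = ray (if l = emptyset then u else if l = succ emptyset then v else 0)"
proof -
  have F: "definable_term (\<lambda>e. ray (if e 0 = emptyset then u else if e 0 = succ emptyset then v else 0))"
    by (intro definable_intros)
  show "square_pt n u v \<^bold>\<in> Sym_pow n"
    unfolding square_pt_def Sym_pow_def by (rule lam_mem_funs[OF F]) simp
  show "l \<^bold>\<in> n \<Longrightarrow> square_pt n u v \<^bold>\<cdot> l = ray (if l = emptyset then u else if l = succ emptyset then v else 0)"
    unfolding square_pt_def using app_lam[OF F, of n Sym l] by simp
qed

lemma definable_square_pt [definable_intros]:
  assumes "definable_real U" "definable_real V" shows "definable_term (\<lambda>e. square_pt n (U e) (V e))"
  unfolding square_pt_def lam_def
proof (rule definable_zset)
  fix e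
  have "definable (\<lambda>d. \<exists>x\<^bold>\<in>n. d 0 = pair x (ray (if x = emptyset then U e else if x = succ emptyset then V e else 0)))"
    by (intro definable_intros)
  from separation_set[OF this, of "prod_of n Sym"]
  show "\<exists>a. \<forall>p. p \<^bold>\<in> a \<longleftrightarrow>
      (\<exists>x\<^bold>\<in>n. p = pair x (ray (if x = emptyset then U e else if x = succ emptyset then V e else 0)))"
    by (rule ex_forward) auto
qed (intro definable_intros definable_real_shift assms)

lemma two_members:
  assumes "n \<^bold>\<in> omega" "succ emptyset \<^bold>\<in> n"
  shows "emptyset \<^bold>\<in> n" and "n \<noteq> emptyset" and "n \<noteq> succ emptyset"
  using assms mem_omega_trans[OF assms(1,2)] by (auto simp: subset_of_def)

lemma square_pt_inject:
  assumes "n \<^bold>\<in> omega" "succ emptyset \<^bold>\<in> n" and eq: "square_pt n u v = square_pt n u' v'"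
  shows "u = u'" "v = v'"
  using square_pt_app[of emptyset n u v] square_pt_app[of emptyset n u' v'] square_pt_app[of "succ emptyset" n u v]
    square_pt_app[of "succ emptyset" n u' v'] assms two_members[OF assms(1,2)] by simp_all

lemma rsum_two:
  assumes n: "n \<^bold>\<in> omega" "succ emptyset \<^bold>\<in> n"
    and a: "\<And>l. l \<^bold>\<in> n \<Longrightarrow> a l = Rep_mreal (if l = emptyset then x else if l = succ emptyset then y else 0)"
  shows "rsum a n = Rep_mreal (x + y)"
proof -
  define F where "F l = (if l = emptyset then 0 else if l = succ emptyset then x else x + y)" for l :: 'a
  have "rfold (\<^bold>+) \<^bold>0 a n = Rep_mreal (F n)"
  proof (rule rfold_eq[OF n(1)])
    show "definable_real (\<lambda>e. F (e 0))" unfolding F_def by (intro definable_intros)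
    show "Rep_mreal (F (succ l)) = Rep_mreal (F l) \<^bold>+ a l" if "l \<^bold>\<in> n" for l
      using that by (simp add: a F_def Rep_add[symmetric])
  qed (simp add: F_def Rep_zero)
  then show ?thesis using two_members[OF n] by (simp add: rsum_def F_def)
qed

text \<open>
  These bounds are all that is used of the three metrics: on the square each of them is between the
  maximum and the sum of the coordinate distances.
\<close>

lemma rho_square_pt:
  assumes n: "n \<^bold>\<in> omega" "succ emptyset \<^bold>\<in> n"
    and seg: "half_seg u" "half_seg v" "half_seg u'" "half_seg v'"
  obtains r where "rho k i n (square_pt n u v) (square_pt n u' v') = Rep_mreal r"
    "\<bar>mexp u - mexp u'\<bar> \<le> r" "\<bar>mexp v - mexp v'\<bar> \<le> r"
    "r \<le> \<bar>mexp u - mexp u'\<bar> + \<bar>mexp v - mexp v'\<bar>"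
proof -
  define x y where "x = \<bar>mexp u - mexp u'\<bar>" and "y = \<bar>mexp v - mexp v'\<bar>"
  have xy: "0 \<le> x" "0 \<le> y" by (simp_all add: x_def y_def)
  have d: "dist_Sym i (square_pt n u v \<^bold>\<cdot> l) (square_pt n u' v' \<^bold>\<cdot> l) =
      Rep_mreal (if l = emptyset then x else if l = succ emptyset then y else 0)" if "l \<^bold>\<in> n" for l
  proof -
    have "half_seg (0 :: 'a mreal)" by (simp add: half_seg_def)
    then show ?thesis using seg that by (simp add: square_pt_app x_def y_def dist_ray)
  qed
  have "\<exists>r. rho k i n (square_pt n u v) (square_pt n u' v') = Rep_mreal r \<and> x \<le> r \<and> y \<le> r \<and> r \<le> x + y"
  proof -
    consider "k = 0" | "k = 1" | "k \<noteq> 0" "k \<noteq> 1" by blast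
    then show ?thesis
    proof cases
      case 1
      have "rmax (\<lambda>l. dist_Sym i (square_pt n u v \<^bold>\<cdot> l) (square_pt n u' v' \<^bold>\<cdot> l)) n = Rep_mreal (max x y)"
        unfolding rmax_def
      proof (rule the_equality)
        show "(\<exists>l\<^bold>\<in>n. Rep_mreal (max x y) = dist_Sym i (square_pt n u v \<^bold>\<cdot> l) (square_pt n u' v' \<^bold>\<cdot> l)) \<and>
            (\<forall>l\<^bold>\<in>n. dist_Sym i (square_pt n u v \<^bold>\<cdot> l) (square_pt n u' v' \<^bold>\<cdot> l) \<^bold>\<le> Rep_mreal (max x y))"
        proof
          show "\<exists>l\<^bold>\<in>n. Rep_mreal (max x y) = dist_Sym i (square_pt n u v \<^bold>\<cdot> l) (square_pt n u' v' \<^bold>\<cdot> l)"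
          proof (cases "x \<le> y")
            case True
            then show ?thesis using d[OF n(2)] n(2) by (intro exI[of _ "succ emptyset"]) simp
          next
            case False
            then show ?thesis using d[of emptyset] two_members[OF n]
              by (intro exI[of _ emptyset]) simp
          qed
        qed (use xy in \<open>auto simp: d Rep_less_eq[symmetric]\<close>)
        fix z assume z: "(\<exists>l\<^bold>\<in>n. z = dist_Sym i (square_pt n u v \<^bold>\<cdot> l) (square_pt n u' v' \<^bold>\<cdot> l)) \<and>
            (\<forall>l\<^bold>\<in>n. dist_Sym i (square_pt n u v \<^bold>\<cdot> l) (square_pt n u' v' \<^bold>\<cdot> l) \<^bold>\<le> z)"
        then obtain w where w: "z = Rep_mreal w" "w \<in> {x, y, 0}" using d by (auto split: if_splits)
        have "x \<le> w" "y \<le> w"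
          using z w(1) d[of emptyset] d[OF n(2)] two_members[OF n] n(2) Rep_less_eq by fastforce+
        then show "z = Rep_mreal (max x y)" using w xy by auto
      qed
      then have "rho k i n (square_pt n u v) (square_pt n u' v') = Rep_mreal (max x y)" using 1 by (simp add: rho_def)
      then show ?thesis using xy by (intro exI[of _ "max x y"]) auto
    next
      case 2
      obtain r where r: "0 \<le> r" "r * r = x * x + y * y" using mreal_sqrt[of "x * x + y * y"] by auto
      have "rsum (\<lambda>l. dist_Sym i (square_pt n u v \<^bold>\<cdot> l) (square_pt n u' v' \<^bold>\<cdot> l) \<^bold>* dist_Sym i (square_pt n u v \<^bold>\<cdot> l) (square_pt n u' v' \<^bold>\<cdot> l)) n
          = Rep_mreal (x * x + y * y)"
        by (rule rsum_two[OF n]) (simp add: d Rep_mult[symmetric])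
      then have "rho k i n (square_pt n u v) (square_pt n u' v') = Rep_mreal r"
        using 2 Rep_sqrt[OF r(1)] r(2) by (simp add: rho_def)
      moreover have "x \<le> r" "y \<le> r" "r \<le> x + y"
      proof -
        have "x\<^sup>2 \<le> r\<^sup>2" "y\<^sup>2 \<le> r\<^sup>2" "r\<^sup>2 \<le> (x + y)\<^sup>2"
          using r(2) xy by (simp_all add: power2_eq_square algebra_simps)
        then show "x \<le> r" "y \<le> r" "r \<le> x + y"
          using r(1) xy by (auto elim!: power2_le_imp_le)
      qed
      ultimately show ?thesis by blast
    next
      case 3
      have "rsum (\<lambda>l. dist_Sym i (square_pt n u v \<^bold>\<cdot> l) (square_pt n u' v' \<^bold>\<cdot> l)) n = Rep_mreal (x + y)"
        by (rule rsum_two[OF n]) (simp add: d)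
      then have "rho k i n (square_pt n u v) (square_pt n u' v') = Rep_mreal (x + y)" using 3 by (simp add: rho_def)
      then show ?thesis using xy by (intro exI[of _ "x + y"]) auto
    qed
  qed
  then show ?thesis using that unfolding x_def y_def by blast
qed

text \<open>
  Only two coordinates vary, so the minimum of two radii suffices for a box of any dimension.
\<close>

lemma open_Sym_pow_square_pt:
  assumes n: "n \<^bold>\<in> omega" "succ emptyset \<^bold>\<in> n" and W: "open_Sym_pow n W"
    and uv: "square_pt n u v \<^bold>\<in> W" "half_seg u" "half_seg v"
  obtains \<delta> where "0 < \<delta>" "\<And>u' v'. half_seg u' \<Longrightarrow> half_seg v' \<Longrightarrow> \<bar>u - u'\<bar> < \<delta> \<Longrightarrow> \<bar>v - v'\<bar> < \<delta> \<Longrightarrow>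
    square_pt n u' v' \<^bold>\<in> W"
proof -
  obtain U where U: "\<And>l. l \<^bold>\<in> n \<Longrightarrow> open_Sym (U \<^bold>\<cdot> l)" "\<And>l. l \<^bold>\<in> n \<Longrightarrow> square_pt n u v \<^bold>\<cdot> l \<^bold>\<in> U \<^bold>\<cdot> l"
      "\<And>y. y \<^bold>\<in> Sym_pow n \<Longrightarrow> (\<And>l. l \<^bold>\<in> n \<Longrightarrow> y \<^bold>\<cdot> l \<^bold>\<in> U \<^bold>\<cdot> l) \<Longrightarrow> y \<^bold>\<in> W"
    using W uv(1) unfolding open_Sym_pow_def by metis
  note m = two_members[OF n]
  obtain d where d: "0 < d" "\<And>y. half_seg y \<Longrightarrow> \<bar>u - y\<bar> < d \<Longrightarrow> ray y \<^bold>\<in> U \<^bold>\<cdot> emptyset"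
    using open_Sym_ray[OF U(1)[OF m(1)], of u] U(2)[OF m(1)] square_pt_app[OF m(1), of u v] uv(2) by auto
  obtain d' where d': "0 < d'" "\<And>y. half_seg y \<Longrightarrow> \<bar>v - y\<bar> < d' \<Longrightarrow> ray y \<^bold>\<in> U \<^bold>\<cdot> succ emptyset"
    using open_Sym_ray[OF U(1)[OF n(2)], of v] U(2)[OF n(2)] square_pt_app[OF n(2), of u v] uv(3) by auto
  show ?thesis
  proof
    show "0 < min d d'" using d d' by simp
    fix u' v' assume a: "half_seg u'" "half_seg v'" "\<bar>u - u'\<bar> < min d d'" "\<bar>v - v'\<bar> < min d d'"
    show "square_pt n u' v' \<^bold>\<in> W"
    proof (rule U(3)[OF square_pt_mem])
      fix l assume l: "l \<^bold>\<in> n"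
      show "square_pt n u' v' \<^bold>\<cdot> l \<^bold>\<in> U \<^bold>\<cdot> l"
        using a d(2) d'(2) U(2)[OF l] square_pt_app[OF l, of u v] square_pt_app[OF l, of u' v'] by auto
    qed
  qed
qed

section \<open>Sequentially closed sets of reals\<close>

lemma Cauchy_seq_iff:
  assumes "\<And>m k. m \<^bold>\<in> omega \<Longrightarrow> k \<^bold>\<in> omega \<Longrightarrow> d (X m) (X k) = Rep_mreal \<bar>a m - a k\<bar>"
  shows "Cauchy_seq d X \<longleftrightarrow> seq_Cauchy a"
  unfolding Cauchy_seq_def seq_Cauchy_def all_pos_Rep
  using assms by (simp add: Rep_less cong: imp_cong)

lemma seq_lim_imp_Cauchy:
  assumes "seq_lim a y" shows "seq_Cauchy a"
  unfolding seq_Cauchy_def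
proof (intro allI impI)
  fix \<delta> :: "'a mreal" assume "0 < \<delta>"
  then obtain N where N: "N \<^bold>\<in> omega" "\<forall>m\<^bold>\<in>omega. N \<^bold>\<subseteq> m \<longrightarrow> \<bar>a m - y\<bar> < \<delta> / 2"
    using assms unfolding seq_lim_def by (metis half_gt_zero)
  have "\<bar>a m - a k\<bar> < \<delta>" if "m \<^bold>\<in> omega" "k \<^bold>\<in> omega" "N \<^bold>\<subseteq> m \<and> N \<^bold>\<subseteq> k" for m k
  proof -
    have "\<bar>a m - y\<bar> < \<delta> / 2" "\<bar>a k - y\<bar> < \<delta> / 2" using N(2) that by blast+
    then show ?thesis by linarith
  qed
  then show "\<exists>N\<^bold>\<in>omega. \<forall>m\<^bold>\<in>omega. \<forall>k\<^bold>\<in>omega. N \<^bold>\<subseteq> m \<and> N \<^bold>\<subseteq> k \<longrightarrow> \<bar>a m - a k\<bar> < \<delta>"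
    using N(1) by blast
qed

text \<open>
  Sequential closedness with respect to the sequences that belong to the model.
\<close>

definition seq_closed :: "('v::zf_reals mreal \<Rightarrow> bool) \<Rightarrow> bool" where
  "seq_closed B \<longleftrightarrow> (\<forall>a y. definable_real (\<lambda>e. a (e 0)) \<and> (\<forall>m\<^bold>\<in>omega. B (a m)) \<and> seq_lim a y \<longrightarrow> B y)"

lemma half_seg_seq_closed:
  assumes "seq_lim a y" "\<And>m. m \<^bold>\<in> omega \<Longrightarrow> half_seg (a m)" shows "half_seg y"
  using seq_lim_eventually_le[OF seq_lim_const assms(1) emptyset_mem_omega, of 0 0]
    seq_lim_eventually_le[OF assms(1) seq_lim_const emptyset_mem_omega, of "1 / 2" 0] assms(2)
  by (auto simp: half_seg_def)

text \<open>
  The factor \<open>s\<close> is \<open>1\<close> or \<open>-1\<close>, for approach from the right or from the left.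
\<close>

lemma seq_closed_trace:
  fixes p s :: "'v::zf_reals mreal"
  assumes A: "complete_subset Reals rdist A" and s: "\<bar>s\<bar> = 1"
  shows "seq_closed (\<lambda>t. half_seg t \<and> Rep_mreal (p + s * t) \<^bold>\<in> A)"
  unfolding seq_closed_def
proof (intro allI impI)
  fix a :: "'v \<Rightarrow> 'v mreal" and y
  assume a: "definable_real (\<lambda>e. a (e 0)) \<and> (\<forall>m\<^bold>\<in>omega. half_seg (a m) \<and> Rep_mreal (p + s * a m) \<^bold>\<in> A) \<and> seq_lim a y"
  define b where "b m = p + s * a m" for m
  have dist: "\<bar>(p + s * x) - (p + s * z)\<bar> = \<bar>x - z\<bar>" for x z
    using s abs_mult[of s "x - z"] by (simp add: right_diff_distrib)
  have lim: "seq_lim b (p + s * y)"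
    using a unfolding seq_lim_def b_def dist by blast
  have bdef: "definable_term (\<lambda>e. Rep_mreal (b (e 0)))"
    unfolding b_def using a by (intro definable_intros) auto
  define f where "f = lam omega (\<lambda>m. Rep_mreal (b m))"
  have f: "f \<^bold>\<in> funs omega A" "m \<^bold>\<in> omega \<Longrightarrow> f \<^bold>\<cdot> m = Rep_mreal (b m)" for m
    using lam_mem_funs[OF bdef, of omega A] app_lam[OF bdef, of omega A m] a unfolding f_def b_def by auto
  have "Cauchy_seq rdist (\<lambda>m. f \<^bold>\<cdot> m) \<longleftrightarrow> seq_Cauchy b"
    by (rule Cauchy_seq_iff) (simp add: f(2) Rep_dist)
  then obtain z where z: "z \<^bold>\<in> A" "tends_to rdist (\<lambda>m. f \<^bold>\<cdot> m) z"
    using A f(1) seq_lim_imp_Cauchy[OF lim] unfolding complete_subset_def by blast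
  have "z \<^bold>\<in> Reals" using A z(1) unfolding complete_subset_def subset_of_def by blast
  then obtain w where w: "z = Rep_mreal w" by (rule mreal_cases)
  have "tends_to rdist (\<lambda>m. f \<^bold>\<cdot> m) (Rep_mreal w) \<longleftrightarrow> seq_lim b w"
    by (rule tends_to_iff) (simp add: f(2) Rep_dist)
  then have "w = p + s * y" using z(2) w seq_lim_unique[OF _ lim] by blast
  then show "half_seg y \<and> Rep_mreal (p + s * y) \<^bold>\<in> A"
    using half_seg_seq_closed[of a y] a z(1) w by auto
qed

section \<open>The comb\<close>

definition comb :: "'v::zf_reals \<Rightarrow> ('v mreal \<Rightarrow> bool) \<Rightarrow> 'v" where
  "comb n B = zset (\<lambda>x. \<exists>u v. x = square_pt n u v \<and> half_seg u \<and> half_seg v \<and> (B u \<or> v = 0))"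

lemma mem_comb:
  assumes B: "definable (\<lambda>e. B (mr (e 0)))"
  shows "x \<^bold>\<in> comb n B \<longleftrightarrow> (\<exists>u v. x = square_pt n u v \<and> half_seg u \<and> half_seg v \<and> (B u \<or> v = 0))"
  unfolding comb_def
proof (rule mem_zset_sub)
  show "definable (\<lambda>e. \<exists>u v. e 0 = square_pt n u v \<and> half_seg u \<and> half_seg v \<and> (B u \<or> v = 0))"
    by (intro definable_intros definable_real_inst1[OF B])
  show "\<exists>u v. x = square_pt n u v \<and> half_seg u \<and> half_seg v \<and> (B u \<or> v = 0) \<Longrightarrow> x \<^bold>\<in> Sym_pow n" for x
    by auto
qed

lemma comb_subset:
  assumes B: "definable (\<lambda>e. B (mr (e 0)))" shows "comb n B \<^bold>\<subseteq> Sym_pow n"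
  by (auto simp: subset_of_def mem_comb[OF B])

text \<open>
  The coordinates of a Cauchy sequence in the comb are Cauchy, since the exponential expands
  distances on the segment, and they converge, say to \<open>x\<close> and \<open>y\<close>.  If \<open>y > 0\<close>, then from some index \<open>N\<close> on
  the terms are off the spine and the first coordinates are in \<open>B\<close>; hence so is \<open>x\<close>.
\<close>

lemma comb_complete:
  fixes B :: "'v::zf_reals mreal \<Rightarrow> bool"
  assumes n: "n \<^bold>\<in> omega" "succ emptyset \<^bold>\<in> n"
    and B: "definable (\<lambda>e. B (mr (e 0)))" and closed: "seq_closed B"
  shows "complete_subset (Sym_pow n) (rho k i n) (comb n B)"
  unfolding complete_subset_def
proof (intro conjI allI impI)
  show "comb n B \<^bold>\<subseteq> Sym_pow n" by (rule comb_subset[OF B])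
  fix s assume s: "s \<^bold>\<in> funs omega (comb n B)" and Cauchy: "Cauchy_seq (rho k i n) (\<lambda>m. s \<^bold>\<cdot> m)"
  define a where "a m = mr (THE x. \<exists>u v. x = Rep_mreal u \<and> pair m (square_pt n u v) \<^bold>\<in> s)" for m
  define b where "b m = mr (THE x. \<exists>u v. x = Rep_mreal v \<and> pair m (square_pt n u v) \<^bold>\<in> s)" for m
  have unique: "u = u' \<and> v = v'" if "pair m (square_pt n u v) \<^bold>\<in> s" "pair m (square_pt n u' v') \<^bold>\<in> s" for m u v u' v'
    using square_pt_inject[OF n funs_unique[OF s that]] by blast
  have adef: "definable_real (\<lambda>e. a (e 0))"
    unfolding a_def
    by (intro definable_mr definable_the) (intro definable_intros, use unique in blast)
  have bdef: "definable_real (\<lambda>e. b (e 0))"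
    unfolding b_def
    by (intro definable_mr definable_the) (intro definable_intros, use unique in blast)
  have ab: "s \<^bold>\<cdot> m = square_pt n (a m) (b m) \<and> half_seg (a m) \<and> half_seg (b m) \<and> (B (a m) \<or> b m = 0)"
    if m: "m \<^bold>\<in> omega" for m
  proof -
    obtain u v where uv: "s \<^bold>\<cdot> m = square_pt n u v" "half_seg u" "half_seg v" "B u \<or> v = 0"
      using app_mem[OF s m] mem_comb[OF B] by blast
    then have p: "pair m (square_pt n u v) \<^bold>\<in> s" using pair_app_mem[OF s m] by simp
    have "(THE x. \<exists>u v. x = Rep_mreal u \<and> pair m (square_pt n u v) \<^bold>\<in> s) = Rep_mreal u"
      using p unique by (intro the_equality) blast+
    moreover have "(THE x. \<exists>u v. x = Rep_mreal v \<and> pair m (square_pt n u v) \<^bold>\<in> s) = Rep_mreal v"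
      using p unique by (intro the_equality) blast+
    ultimately show ?thesis using uv by (simp add: a_def b_def)
  qed
  have close: "\<bar>a m - a l\<bar> < \<delta> \<and> \<bar>b m - b l\<bar> < \<delta>"
    if m: "m \<^bold>\<in> omega" and l: "l \<^bold>\<in> omega" and r: "rho k i n (s \<^bold>\<cdot> m) (s \<^bold>\<cdot> l) \<^bold>< Rep_mreal \<delta>" for m l \<delta>
  proof -
    note m = ab[OF m] and l = ab[OF l]
    obtain r where r: "rho k i n (square_pt n (a m) (b m)) (square_pt n (a l) (b l)) = Rep_mreal r"
      "\<bar>mexp (a m) - mexp (a l)\<bar> \<le> r" "\<bar>mexp (b m) - mexp (b l)\<bar> \<le> r"
      using rho_square_pt[OF n, of "a m" "b m" "a l" "b l" k i] m l by metis
    have "r < \<delta>" using r(1) \<open>rho k i n (s \<^bold>\<cdot> m) (s \<^bold>\<cdot> l) \<^bold>< Rep_mreal \<delta>\<close> m l by (simp add: Rep_less)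
    moreover have "\<bar>a m - a l\<bar> \<le> \<bar>mexp (a m) - mexp (a l)\<bar>" "\<bar>b m - b l\<bar> \<le> \<bar>mexp (b m) - mexp (b l)\<bar>"
      using mexp_bilipschitz(1) m l by (auto simp: half_seg_def)
    ultimately show ?thesis using r(2,3) by linarith
  qed
  have "seq_Cauchy a" "seq_Cauchy b"
    using Cauchy close unfolding seq_Cauchy_def Cauchy_seq_def all_pos_Rep by meson+
  then obtain x y where lim: "seq_lim a x" "seq_lim b y"
    using Cauchy_converges[OF adef] Cauchy_converges[OF bdef] by metis
  have seg: "half_seg x" "half_seg y"
    using half_seg_seq_closed lim ab by blast+
  have "B x \<or> y = 0"
  proof (cases "y = 0")
    case False
    then have "0 < y" using seg by (simp add: half_seg_def)
    then obtain N where N: "N \<^bold>\<in> omega" "\<And>m. m \<^bold>\<in> omega \<Longrightarrow> N \<^bold>\<subseteq> m \<Longrightarrow> \<bar>b m - y\<bar> < y"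
      using lim(2) unfolding seq_lim_def by blast
    then have BN: "B (a m)" if "m \<^bold>\<in> omega" "N \<^bold>\<subseteq> m" for m
      using N(2)[OF that] ab[OF that(1)] by auto
    \<comment> \<open>The first coordinates before \<open>N\<close> need not be in \<open>B\<close>; they are replaced by the one at \<open>N\<close>.\<close>
    define c where "c m = (if N \<^bold>\<subseteq> m then a m else a N)" for m
    have "definable_real (\<lambda>e. c (e 0))" unfolding c_def by (intro definable_intros adef)
    moreover have "\<forall>m\<^bold>\<in>omega. B (c m)" using BN N(1) by (simp add: c_def)
    moreover have "seq_lim c x"
      unfolding seq_lim_def
    proof (intro allI impI)
      fix \<delta> :: "'v mreal" assume "0 < \<delta>"
      then obtain M where M: "M \<^bold>\<in> omega" "\<forall>m\<^bold>\<in>omega. M \<^bold>\<subseteq> m \<longrightarrow> \<bar>a m - x\<bar> < \<delta>"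
        using lim(1) unfolding seq_lim_def by blast
      obtain K where K: "K \<^bold>\<in> omega" "M \<^bold>\<subseteq> K" "N \<^bold>\<subseteq> K" using omega_upper_bound M(1) N(1) by metis
      then have "\<forall>m\<^bold>\<in>omega. K \<^bold>\<subseteq> m \<longrightarrow> \<bar>c m - x\<bar> < \<delta>"
        using M(2) subset_trans by (auto simp: c_def)
      then show "\<exists>N\<^bold>\<in>omega. \<forall>m\<^bold>\<in>omega. N \<^bold>\<subseteq> m \<longrightarrow> \<bar>c m - x\<bar> < \<delta>" using K(1) by blast
    qed
    ultimately show ?thesis using closed unfolding seq_closed_def by blast
  qed simp
  then have "square_pt n x y \<^bold>\<in> comb n B" using mem_comb[OF B] seg by blast
  moreover have "tends_to (rho k i n) (\<lambda>m. s \<^bold>\<cdot> m) (square_pt n x y)"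
    unfolding tends_to_def all_pos_Rep
  proof (intro allI impI)
    fix \<delta> :: "'v mreal" assume "0 < \<delta>"
    then have "0 < \<delta> / 4" by simp
    then obtain N M where N: "N \<^bold>\<in> omega" "\<And>m. m \<^bold>\<in> omega \<Longrightarrow> N \<^bold>\<subseteq> m \<Longrightarrow> \<bar>a m - x\<bar> < \<delta> / 4"
      and M: "M \<^bold>\<in> omega" "\<And>m. m \<^bold>\<in> omega \<Longrightarrow> M \<^bold>\<subseteq> m \<Longrightarrow> \<bar>b m - y\<bar> < \<delta> / 4"
      using lim unfolding seq_lim_def by meson
    obtain K where K: "K \<^bold>\<in> omega" "M \<^bold>\<subseteq> K" "N \<^bold>\<subseteq> K" using omega_upper_bound M(1) N(1) by metis
    have "rho k i n (s \<^bold>\<cdot> m) (square_pt n x y) \<^bold>< Rep_mreal \<delta>" if m: "m \<^bold>\<in> omega" "K \<^bold>\<subseteq> m" for m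
    proof -
      note abm = ab[OF m(1)]
      have small: "\<bar>a m - x\<bar> < \<delta> / 4" "\<bar>b m - y\<bar> < \<delta> / 4"
        using N(2) M(2) m K subset_trans by blast+
      have lip: "\<bar>mexp (a m) - mexp x\<bar> \<le> 2 * \<bar>a m - x\<bar>" "\<bar>mexp (b m) - mexp y\<bar> \<le> 2 * \<bar>b m - y\<bar>"
        using mexp_bilipschitz(2) abm seg by (auto simp: half_seg_def)
      obtain r where r: "rho k i n (square_pt n (a m) (b m)) (square_pt n x y) = Rep_mreal r"
          "r \<le> \<bar>mexp (a m) - mexp x\<bar> + \<bar>mexp (b m) - mexp y\<bar>"
        using rho_square_pt[OF n, of "a m" "b m" x y k i] abm seg by metis
      have "r \<le> 2 * \<bar>a m - x\<bar> + 2 * \<bar>b m - y\<bar>"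
        using order_trans[OF r(2) add_mono[OF lip]] .
      also have "\<dots> < 2 * (\<delta> / 4) + 2 * (\<delta> / 4)"
        using small by (intro add_strict_mono mult_strict_left_mono) auto
      finally have "r < \<delta>" by simp
      then show ?thesis using r(1) abm by (simp add: Rep_less)
    qed
    then show "\<exists>N\<^bold>\<in>omega. \<forall>m\<^bold>\<in>omega. N \<^bold>\<subseteq> m \<longrightarrow> rho k i n (s \<^bold>\<cdot> m) (square_pt n x y) \<^bold>< Rep_mreal \<delta>"
      using K(1) by blast
  qed
  ultimately show "\<exists>y\<^bold>\<in>comb n B. tends_to (rho k i n) (\<lambda>m. s \<^bold>\<cdot> m) y" by blast
qed

text \<open>
  Connectedness of the segment, by the infimum of the points where \<open>P\<close> fails.
\<close>

lemma half_seg_connected: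
  fixes P :: "'v::zf_reals mreal \<Rightarrow> bool"
  assumes P: "definable (\<lambda>e. P (mr (e 0)))" and "P 0" and x: "half_seg x"
    and open1: "\<And>t. half_seg t \<Longrightarrow> P t \<Longrightarrow> \<exists>\<delta>>0. \<forall>r. half_seg r \<and> \<bar>t - r\<bar> < \<delta> \<longrightarrow> P r"
    and open2: "\<And>t. half_seg t \<Longrightarrow> \<not> P t \<Longrightarrow> \<exists>\<delta>>0. \<forall>r. half_seg r \<and> \<bar>t - r\<bar> < \<delta> \<longrightarrow> \<not> P r"
  shows "P x"
proof (rule ccontr)
  assume "\<not> P x"
  have "definable (\<lambda>e. half_seg (mr (e 0)) \<and> \<not> P (mr (e 0)))"
    by (intro definable_intros P)
  then obtain c where c: "\<And>t. half_seg t \<and> \<not> P t \<Longrightarrow> c \<le> t" "\<And>d. (\<And>t. half_seg t \<and> \<not> P t \<Longrightarrow> d \<le> t) \<Longrightarrow> d \<le> c"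
    using mreal_inf[of "\<lambda>t. half_seg t \<and> \<not> P t" x 0] x \<open>\<not> P x\<close> by (auto simp: half_seg_def)
  have "0 \<le> c" by (rule c(2)) (simp add: half_seg_def)
  moreover have "c \<le> x" using c(1) x \<open>\<not> P x\<close> by blast
  ultimately have seg: "half_seg c" using x by (simp add: half_seg_def)
  show False
  proof (cases "P c")
    case True
    then obtain \<delta> where \<delta>: "0 < \<delta>" "\<And>r. half_seg r \<Longrightarrow> \<bar>c - r\<bar> < \<delta> \<Longrightarrow> P r" using open1[OF seg] by blast
    have "c + \<delta> \<le> c"
    proof (rule c(2))
      fix t assume t: "half_seg t \<and> \<not> P t"
      then have "c \<le> t" "\<not> \<bar>c - t\<bar> < \<delta>" using c(1) \<delta>(2) by blast+
      then show "c + \<delta> \<le> t" by simp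
    qed
    then show False using \<delta>(1) by simp
  next
    case False
    then obtain \<delta> where \<delta>: "0 < \<delta>" "\<And>r. half_seg r \<Longrightarrow> \<bar>c - r\<bar> < \<delta> \<Longrightarrow> \<not> P r" using open2[OF seg] by blast
    have "0 < c" using False \<open>P 0\<close> \<open>0 \<le> c\<close> by (cases "c = 0") auto
    define r where "r = max 0 (c - \<delta> / 2)"
    have "half_seg r" "\<bar>c - r\<bar> < \<delta>" "r < c"
      using seg \<open>0 < c\<close> \<delta>(1) by (auto simp: r_def half_seg_def max_def abs_if field_simps)
    then show False using c(1)[of r] \<delta>(2)[of r] by simp
  qed
qed

text \<open>
  Starting from the origin, \<open>half_seg_connected\<close> shows first that the spine is contained in \<open>U\<close>, and then, starting from
  its foot on the spine, that each tooth is.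
\<close>

lemma comb_subset_clopen:
  fixes U V :: "'v::zf_reals"
  assumes n: "n \<^bold>\<in> omega" "succ emptyset \<^bold>\<in> n" and B: "definable (\<lambda>e. B (mr (e 0)))"
    and U: "open_Sym_pow n U" and V: "open_Sym_pow n V"
    and cover: "\<forall>x\<^bold>\<in>comb n B. x \<^bold>\<in> U \<or> x \<^bold>\<in> V" and disj: "\<not> (\<exists>x\<^bold>\<in>comb n B. x \<^bold>\<in> U \<and> x \<^bold>\<in> V)"
    and origin: "square_pt n 0 0 \<^bold>\<in> U" and x: "x \<^bold>\<in> comb n B"
  shows "x \<^bold>\<in> U"
proof -
  have z: "half_seg (0 :: 'v mreal)" by (simp add: half_seg_def)
  have spine: "square_pt n u 0 \<^bold>\<in> U" if "half_seg u" for u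
  proof (rule half_seg_connected[where P = "\<lambda>t. square_pt n t 0 \<^bold>\<in> U", OF _ origin that])
    show "definable (\<lambda>e. square_pt n (mr (e 0)) 0 \<^bold>\<in> U)" by (intro definable_intros)
    have mem: "square_pt n t 0 \<^bold>\<in> comb n B" if "half_seg t" for t
      using that z mem_comb[OF B] by blast
    fix t :: "'v mreal" assume t: "half_seg t"
    show "\<exists>\<delta>>0. \<forall>r. half_seg r \<and> \<bar>t - r\<bar> < \<delta> \<longrightarrow> square_pt n r 0 \<^bold>\<in> U" if tU: "square_pt n t 0 \<^bold>\<in> U"
    proof -
      obtain \<delta> where \<delta>: "0 < \<delta>"
        "\<And>u' v'. half_seg u' \<Longrightarrow> half_seg v' \<Longrightarrow> \<bar>t - u'\<bar> < \<delta> \<Longrightarrow> \<bar>0 - v'\<bar> < \<delta> \<Longrightarrow> square_pt n u' v' \<^bold>\<in> U"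
        using open_Sym_pow_square_pt[OF n U tU t z] by blast
      then show ?thesis using z by (intro exI[of _ \<delta>]) auto
    qed
    show "\<exists>\<delta>>0. \<forall>r. half_seg r \<and> \<bar>t - r\<bar> < \<delta> \<longrightarrow> \<not> square_pt n r 0 \<^bold>\<in> U" if "\<not> square_pt n t 0 \<^bold>\<in> U"
    proof -
      have tV: "square_pt n t 0 \<^bold>\<in> V" using cover mem[OF t] that by blast
      obtain \<delta> where \<delta>: "0 < \<delta>"
        "\<And>u' v'. half_seg u' \<Longrightarrow> half_seg v' \<Longrightarrow> \<bar>t - u'\<bar> < \<delta> \<Longrightarrow> \<bar>0 - v'\<bar> < \<delta> \<Longrightarrow> square_pt n u' v' \<^bold>\<in> V"
        using open_Sym_pow_square_pt[OF n V tV t z] by blast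
      then have "\<forall>r. half_seg r \<and> \<bar>t - r\<bar> < \<delta> \<longrightarrow> square_pt n r 0 \<^bold>\<in> V" using z by auto
      then show ?thesis using \<delta>(1) disj mem by blast
    qed
  qed
  obtain u v where uv: "x = square_pt n u v" "half_seg u" "half_seg v" "B u \<or> v = 0"
    using x mem_comb[OF B] by blast
  show ?thesis
  proof (cases "v = 0")
    case True
    then show ?thesis using spine uv by simp
  next
    case False
    then have "B u" using uv by blast
    then have mem: "square_pt n u t \<^bold>\<in> comb n B" if "half_seg t" for t
      using that uv(2) mem_comb[OF B] by blast
    have "square_pt n u v \<^bold>\<in> U"
    proof (rule half_seg_connected[where P = "\<lambda>t. square_pt n u t \<^bold>\<in> U", OF _ spine[OF uv(2)] uv(3)])
      show "definable (\<lambda>e. square_pt n u (mr (e 0)) \<^bold>\<in> U)" by (intro definable_intros)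
      fix t :: "'v mreal" assume t: "half_seg t"
      show "\<exists>\<delta>>0. \<forall>r. half_seg r \<and> \<bar>t - r\<bar> < \<delta> \<longrightarrow> square_pt n u r \<^bold>\<in> U" if tU: "square_pt n u t \<^bold>\<in> U"
      proof -
        obtain \<delta> where \<delta>: "0 < \<delta>"
          "\<And>u' v'. half_seg u' \<Longrightarrow> half_seg v' \<Longrightarrow> \<bar>u - u'\<bar> < \<delta> \<Longrightarrow> \<bar>t - v'\<bar> < \<delta> \<Longrightarrow> square_pt n u' v' \<^bold>\<in> U"
          using open_Sym_pow_square_pt[OF n U tU uv(2) t] by blast
        then show ?thesis using uv(2) by (intro exI[of _ \<delta>]) auto
      qed
      show "\<exists>\<delta>>0. \<forall>r. half_seg r \<and> \<bar>t - r\<bar> < \<delta> \<longrightarrow> \<not> square_pt n u r \<^bold>\<in> U" if "\<not> square_pt n u t \<^bold>\<in> U"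
      proof -
        have tV: "square_pt n u t \<^bold>\<in> V" using cover mem[OF t] that by blast
        obtain \<delta> where \<delta>: "0 < \<delta>"
          "\<And>u' v'. half_seg u' \<Longrightarrow> half_seg v' \<Longrightarrow> \<bar>u - u'\<bar> < \<delta> \<Longrightarrow> \<bar>t - v'\<bar> < \<delta> \<Longrightarrow> square_pt n u' v' \<^bold>\<in> V"
          using open_Sym_pow_square_pt[OF n V tV uv(2) t] by blast
        then have "\<forall>r. half_seg r \<and> \<bar>t - r\<bar> < \<delta> \<longrightarrow> square_pt n u r \<^bold>\<in> V" using uv(2) by auto
        then show ?thesis using \<delta>(1) disj mem by blast
      qed
    qed
    then show ?thesis using uv(1) by simp
  qed
qed

lemma comb_connected:
  fixes n :: "'v::zf_reals"
  assumes n: "n \<^bold>\<in> omega" "succ emptyset \<^bold>\<in> n" and B: "definable (\<lambda>e. B (mr (e 0)))"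
  shows "connected_Sym_pow n (comb n B)"
  unfolding connected_Sym_pow_def
proof (intro conjI notI)
  show "comb n B \<^bold>\<subseteq> Sym_pow n" by (rule comb_subset[OF B])
  assume "\<exists>U V. open_Sym_pow n U \<and> open_Sym_pow n V \<and>
          (\<forall>x\<^bold>\<in>comb n B. x \<^bold>\<in> U \<or> x \<^bold>\<in> V) \<and> \<not> (\<exists>x\<^bold>\<in>comb n B. x \<^bold>\<in> U \<and> x \<^bold>\<in> V) \<and>
          (\<exists>x\<^bold>\<in>comb n B. x \<^bold>\<in> U) \<and> (\<exists>x\<^bold>\<in>comb n B. x \<^bold>\<in> V)"
  then show False
  proof (elim exE conjE)
    fix U V y z
    assume U: "open_Sym_pow n U" and V: "open_Sym_pow n V"
      and cover: "\<forall>x\<^bold>\<in>comb n B. x \<^bold>\<in> U \<or> x \<^bold>\<in> V" and disj: "\<not> (\<exists>x\<^bold>\<in>comb n B. x \<^bold>\<in> U \<and> x \<^bold>\<in> V)"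
      and ne: "y \<^bold>\<in> comb n B" "y \<^bold>\<in> U" "z \<^bold>\<in> comb n B" "z \<^bold>\<in> V"
    have "half_seg (0 :: 'v mreal)" by (simp add: half_seg_def)
    then have "square_pt n 0 0 \<^bold>\<in> comb n B" using mem_comb[OF B] by blast
    then consider "square_pt n 0 0 \<^bold>\<in> U" | "square_pt n 0 0 \<^bold>\<in> V" using cover by blast
    then show False
    proof cases
      case 1
      from comb_subset_clopen[OF n B U V cover disj 1 ne(3)] show False using ne disj by blast
    next
      case 2
      have "\<forall>x\<^bold>\<in>comb n B. x \<^bold>\<in> V \<or> x \<^bold>\<in> U" "\<not> (\<exists>x\<^bold>\<in>comb n B. x \<^bold>\<in> V \<and> x \<^bold>\<in> U)"
        using cover disj by blast+
      from comb_subset_clopen[OF n B V U this 2 ne(1)] show False using ne disj by blast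
    qed
  qed
qed

text \<open>
  The point \<open>(0, 1/2)\<close> is in the closure of the points \<open>(t, 1/2)\<close> with \<open>t\<close> in \<open>B\<close>.  As \<open>1/2\<close> is not \<open>0\<close>, it can be in the
  comb only if \<open>0\<close> is in \<open>B\<close>.
\<close>

lemma comb_closed_imp:
  fixes n :: "'v::zf_reals"
  assumes n: "n \<^bold>\<in> omega" "succ emptyset \<^bold>\<in> n" and B: "definable (\<lambda>e. B (mr (e 0)))"
    and closed: "closed_Sym_pow n (comb n B)"
    and approx: "\<And>\<delta>. 0 < \<delta> \<Longrightarrow> \<exists>t. B t \<and> half_seg t \<and> t < \<delta>"
  shows "B 0"
proof (rule ccontr)
  assume "\<not> B 0"
  have seg: "half_seg (0 :: 'v mreal)" "half_seg (1 / 2 :: 'v mreal)" by (simp_all add: half_seg_def)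
  have "\<not> square_pt n 0 (1 / 2) \<^bold>\<in> comb n B"
  proof
    assume "square_pt n 0 (1 / 2) \<^bold>\<in> comb n B"
    then obtain u v where uv: "square_pt n 0 (1 / 2) = square_pt n u v" "B u \<or> v = 0" using mem_comb[OF B] by blast
    from square_pt_inject[OF n uv(1)] have "u = 0" "v = 1 / 2" by simp_all
    then show False using uv(2) \<open>\<not> B 0\<close> by simp
  qed
  then have mem: "square_pt n 0 (1 / 2) \<^bold>\<in> diff (Sym_pow n) (comb n B)" by simp
  have "open_Sym_pow n (diff (Sym_pow n) (comb n B))" using closed by (simp add: closed_Sym_pow_def)
  from open_Sym_pow_square_pt[OF n this mem seg] obtain \<delta> where \<delta>: "0 < \<delta>" "\<And>u' v'. half_seg u' \<Longrightarrow> half_seg v' \<Longrightarrow> \<bar>0 - u'\<bar> < \<delta> \<Longrightarrow>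
      \<bar>1 / 2 - v'\<bar> < \<delta> \<Longrightarrow> square_pt n u' v' \<^bold>\<in> diff (Sym_pow n) (comb n B)"
    by blast
  obtain t where t: "B t" "half_seg t" "t < \<delta>" using approx[OF \<delta>(1)] by blast
  then have "square_pt n t (1 / 2) \<^bold>\<in> diff (Sym_pow n) (comb n B)"
    using \<delta>(2)[OF t(2) seg(2)] \<delta>(1) by (simp add: half_seg_def)
  moreover have "square_pt n t (1 / 2) \<^bold>\<in> comb n B" using t seg(2) mem_comb[OF B] by blast
  ultimately show False by simp
qed

section \<open>Choice\<close>

lemma complete_approached_mem:
  fixes n A :: "'v::zf_reals"
  assumes n: "n \<^bold>\<in> omega" "succ emptyset \<^bold>\<in> n"
    and closed: "\<forall>Y. Y \<^bold>\<subseteq> Sym_pow n \<and> complete_subset (Sym_pow n) (rho k i n) Y \<and> connected_Sym_pow n Y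
           \<longrightarrow> closed_Sym_pow n Y"
    and A: "complete_subset Reals rdist A" and s: "\<bar>s\<bar> = 1"
    and approx: "\<And>\<delta>. 0 < \<delta> \<Longrightarrow> \<exists>t. 0 \<le> t \<and> t < \<delta> \<and> Rep_mreal (p + s * t) \<^bold>\<in> A"
  shows "Rep_mreal p \<^bold>\<in> A"
proof -
  define B where "B t \<longleftrightarrow> half_seg t \<and> Rep_mreal (p + s * t) \<^bold>\<in> A" for t
  have B: "definable (\<lambda>e. B (mr (e 0)))"
    unfolding B_def by (intro definable_intros)
  have "seq_closed B" unfolding B_def by (rule seq_closed_trace[OF A s])
  then have "closed_Sym_pow n (comb n B)"
    using closed comb_subset[OF B] comb_complete[OF n B] comb_connected[OF n B] by blast
  moreover have "\<exists>t. B t \<and> half_seg t \<and> t < \<delta>" if "0 < \<delta>" for \<delta>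
    using approx[of "min \<delta> (1 / 2)"] that by (auto simp: B_def half_seg_def)
  ultimately have "B 0" using comb_closed_imp[OF n B] by blast
  then show ?thesis by (simp add: B_def)
qed

text \<open>
  The least nonnegative element if there is a nonnegative element, and the greatest element
  otherwise: a choice that requires no selection, for sets that contain the points they approach
  from one side.
\<close>

definition canonical :: "'v::zf_reals \<Rightarrow> 'v mreal \<Rightarrow> bool" where
  "canonical a x \<longleftrightarrow>
    (\<exists>y. 0 \<le> y \<and> Rep_mreal y \<^bold>\<in> a) \<and> 0 \<le> x \<and> Rep_mreal x \<^bold>\<in> a \<and> (\<forall>y. 0 \<le> y \<and> Rep_mreal y \<^bold>\<in> a \<longrightarrow> x \<le> y) \<or>
    \<not> (\<exists>y. 0 \<le> y \<and> Rep_mreal y \<^bold>\<in> a) \<and> Rep_mreal x \<^bold>\<in> a \<and> (\<forall>y. Rep_mreal y \<^bold>\<in> a \<longrightarrow> y \<le> x)"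

lemma canonical_unique: "canonical a x \<Longrightarrow> canonical a y \<Longrightarrow> x = y"
  unfolding canonical_def by (meson order.antisym)

lemma canonical_exists:
  fixes a :: "'v::zf_reals"
  assumes x: "Rep_mreal x \<^bold>\<in> a"
    and approached: "\<And>p s. \<bar>s\<bar> = 1 \<Longrightarrow>
      (\<And>\<delta>. 0 < \<delta> \<Longrightarrow> \<exists>t. 0 \<le> t \<and> t < \<delta> \<and> Rep_mreal (p + s * t) \<^bold>\<in> a) \<Longrightarrow> Rep_mreal p \<^bold>\<in> a"
  shows "\<exists>y. canonical a y"
proof (cases "\<exists>y. 0 \<le> y \<and> Rep_mreal y \<^bold>\<in> a")
  case True
  then obtain y where y: "0 \<le> y \<and> Rep_mreal y \<^bold>\<in> a" by blast
  have "definable (\<lambda>e. 0 \<le> mr (e 0) \<and> Rep_mreal (mr (e 0)) \<^bold>\<in> a)" by (intro definable_intros)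
  then obtain c where c: "\<And>y. 0 \<le> y \<and> Rep_mreal y \<^bold>\<in> a \<Longrightarrow> c \<le> y"
      "\<And>d. (\<And>y. 0 \<le> y \<and> Rep_mreal y \<^bold>\<in> a \<Longrightarrow> d \<le> y) \<Longrightarrow> d \<le> c"
    using mreal_inf[of "\<lambda>y. 0 \<le> y \<and> Rep_mreal y \<^bold>\<in> a" y 0] y by blast
  have "Rep_mreal c \<^bold>\<in> a"
  proof (rule approached[of 1])
    fix \<delta> :: "'v mreal" assume "0 < \<delta>"
    then have "\<not> c + \<delta> \<le> c" by simp
    then obtain z where z: "0 \<le> z" "Rep_mreal z \<^bold>\<in> a" "\<not> c + \<delta> \<le> z" using c(2)[of "c + \<delta>"] by blast
    then show "\<exists>t. 0 \<le> t \<and> t < \<delta> \<and> Rep_mreal (c + 1 * t) \<^bold>\<in> a"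
      using c(1)[of z] by (intro exI[of _ "z - c"]) auto
  qed simp
  moreover have "0 \<le> c" using c(2)[of 0] by blast
  ultimately show ?thesis using True c(1) unfolding canonical_def by blast
next
  case False
  have "definable (\<lambda>e. Rep_mreal (mr (e 0)) \<^bold>\<in> a)" by (intro definable_intros)
  moreover have "y \<le> 0" if "Rep_mreal y \<^bold>\<in> a" for y using False that linear[of y 0] by blast
  ultimately obtain c where c: "\<And>y. Rep_mreal y \<^bold>\<in> a \<Longrightarrow> y \<le> c"
      "\<And>d. (\<And>y. Rep_mreal y \<^bold>\<in> a \<Longrightarrow> y \<le> d) \<Longrightarrow> c \<le> d"
    using mreal_sup[of "\<lambda>y. Rep_mreal y \<^bold>\<in> a" x 0] x by blast
  have "Rep_mreal c \<^bold>\<in> a"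
  proof (rule approached[of "- 1"])
    fix \<delta> :: "'v mreal" assume "0 < \<delta>"
    then have "\<not> c \<le> c - \<delta>" by simp
    then obtain z where z: "Rep_mreal z \<^bold>\<in> a" "\<not> z \<le> c - \<delta>" using c(2)[of "c - \<delta>"] by blast
    then show "\<exists>t. 0 \<le> t \<and> t < \<delta> \<and> Rep_mreal (c + - 1 * t) \<^bold>\<in> a"
      using c(1)[of z] by (intro exI[of _ "c - z"]) auto
  qed simp
  then show ?thesis using False c(1) unfolding canonical_def by blast
qed

theorem corollary57:
  fixes n :: "'v::zf_reals" and i k :: nat
  assumes "n \<^bold>\<in> omega" and "succ emptyset \<^bold>\<in> n"
    and "i \<in> {1, 2}" and "k \<in> {0, 1, 2}"
    and "\<forall>Y. Y \<^bold>\<subseteq> Sym_pow n \<and> complete_subset (Sym_pow n) (rho k i n) Y \<and> connected_Sym_pow n Y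
           \<longrightarrow> closed_Sym_pow n Y"
  shows "CC_cR TYPE('v)"
  unfolding CC_cR_def
proof (intro allI impI)
  fix A :: 'v
  assume A: "A \<^bold>\<in> funs omega (Pow_of Reals) \<and>
     (\<forall>m\<^bold>\<in>omega. A \<^bold>\<cdot> m \<noteq> emptyset \<and> complete_subset Reals rdist (A \<^bold>\<cdot> m))"
  have ex: "\<exists>x. canonical (A \<^bold>\<cdot> m) x" if m: "m \<^bold>\<in> omega" for m
  proof -
    have complete: "complete_subset Reals rdist (A \<^bold>\<cdot> m)" and "A \<^bold>\<cdot> m \<noteq> emptyset" using A m by blast+
    then obtain z where "z \<^bold>\<in> A \<^bold>\<cdot> m" "z \<^bold>\<in> Reals"
      unfolding nonempty_ex complete_subset_def subset_of_def by blast
    then obtain x where "Rep_mreal x \<^bold>\<in> A \<^bold>\<cdot> m" using mreal_cases by blast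
    then show ?thesis
      using complete_approached_mem[OF assms(1,2,5) complete] by (rule canonical_exists)
  qed
  define F where "F m = (THE z. \<exists>x. z = Rep_mreal x \<and> canonical (A \<^bold>\<cdot> m) x)" for m
  have "definable_term (\<lambda>e. F (e 0))"
    unfolding F_def
  proof (rule definable_the)
    show "definable (\<lambda>e. \<exists>x. e 0 = Rep_mreal x \<and> canonical (A \<^bold>\<cdot> e (Suc 0)) x)"
      unfolding canonical_def by (intro definable_intros definable_app_const[of A omega "Pow_of Reals"]) (use A in auto)
  qed (use canonical_unique in blast)
  moreover have F: "F m \<^bold>\<in> A \<^bold>\<cdot> m \<and> F m \<^bold>\<in> Reals" if "m \<^bold>\<in> omega" for m
  proof -
    obtain x where x: "canonical (A \<^bold>\<cdot> m) x" using ex[OF \<open>m \<^bold>\<in> omega\<close>] by blast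
    then have "F m = Rep_mreal x" unfolding F_def using canonical_unique by (intro the_equality) blast+
    then show ?thesis using x by (auto simp: canonical_def)
  qed
  ultimately show "\<exists>f\<^bold>\<in>funs omega Reals. \<forall>m\<^bold>\<in>omega. f \<^bold>\<cdot> m \<^bold>\<in> A \<^bold>\<cdot> m"
    using lam_mem_funs[of F omega Reals] app_lam[of F omega Reals] by (intro exI[of _ "lam omega F"]) auto
qed

end
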